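(* Let $k$ be a field and let $\alpha\in k$ be a nonzero element of infinite order in the multiplicative group $k\setminus\{0\}$. Let $A$, $B$, $M$, $L$ and $T_q$ ($q\in\mathbb Z$) be the rings and modules, depending on $\alpha$, defined in the context. Then for every integer $q>0$ and every integer $i\ge 0$: (1) $\operatorname{Ext}^i_A(M,T_q)\neq 0$ if and only if $i\in\{0,\,q-1,\,q\}$. (2) $\operatorname{Ext}^i_B(L,T_q)\neq 0$ if and only if $i\in\{0,\,q-1,\,q\}$.
   Context: Let $A=A_\alpha=k[X_1,X_2,X_3,X_4,X_5]/I_\alpha$, where $I_\alpha$ is the ideal generated by $$\alpha X_1X_3+X_2X_3,\; X_1X_4+X_2X_4,\; X_3^2+\alpha X_1X_5-X_2X_5,\; X_4^2+X_1X_5-X_2X_5,\; X_1^2,\; X_2^2,\; X_3X_4,\; X_3X_5,\; X_4X_5,\; X_5^2.$$ Let $x_i$ be the residue class of $X_i$ in $A$. Let $B=B_\alpha=A/(x_5)$. Let $M$ be the image of the $A$-linear map $A^2\to A^2$ given in the standard basis by the matrix $\begin{pmatrix} x_1 & x_3 \\ x_4 & x_2 \end{pmatrix}$, and let $L=M\otimes_AB$. For each integer $q$ let $T_q=A/J_q$, where $J_q$ is the ideal of $A$ generated by $x_1-x_2,\ x_1-\alpha^qx_3,\ x_1-x_4,\ x_5$; since $x_5\in J_q$, $T_q$ is also a $B$-module. *)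

theory Defs
  imports "HOL-Algebra.Algebra" "HOL-Algebra.Algebraic_Closure_Type" "HOL-Library.Poly_Mapping"
begin

section \<open>Modules\<close>

text \<open>The \<^typ>\<open>('r, 'm) module\<close> record extends \<^typ>\<open>'m ring\<close>; its fields \<^const>\<open>monoid.mult\<close> and
  \<^const>\<open>one\<close> play no role in the locale \<^locale>\<open>module\<close> and are left unspecified below.\<close>

definition regular_mod :: "('r, 'x) ring_scheme \<Rightarrow> ('r, 'r) module" where
  "regular_mod R = \<lparr>carrier = carrier R, monoid.mult = undefined, one = undefined,
     ring.zero = \<zero>\<^bsub>R\<^esub>, add = add R, module.smult = monoid.mult R\<rparr>"

text \<open>The free \<open>R\<close>-module on a set \<open>S\<close>: finitely supported functions, zero outside \<open>S\<close>.\<close>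

definition free_mod :: "('r, 'x) ring_scheme \<Rightarrow> 'b set \<Rightarrow> ('r, 'b \<Rightarrow> 'r) module" where
  "free_mod R S = \<lparr>carrier = {f. (\<forall>x\<in>S. f x \<in> carrier R) \<and> (\<forall>x. x \<notin> S \<longrightarrow> f x = \<zero>\<^bsub>R\<^esub>)
                                \<and> finite {x. f x \<noteq> \<zero>\<^bsub>R\<^esub>}},
     monoid.mult = undefined, one = undefined,
     ring.zero = (\<lambda>x. \<zero>\<^bsub>R\<^esub>), add = (\<lambda>f g x. f x \<oplus>\<^bsub>R\<^esub> g x), module.smult = (\<lambda>r f x. r \<otimes>\<^bsub>R\<^esub> f x)\<rparr>"

definition basis_vec :: "('r, 'x) ring_scheme \<Rightarrow> 'b \<Rightarrow> 'b \<Rightarrow> 'r" where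
  "basis_vec R b = (\<lambda>x. if x = b then \<one>\<^bsub>R\<^esub> else \<zero>\<^bsub>R\<^esub>)"

text \<open>The linear map from a free module to \<open>M\<close> sending each basis vector \<open>b\<close> to \<open>g b\<close>.\<close>

definition lin_ext :: "('r, 'x) ring_scheme \<Rightarrow> ('r, 'm, 'y) module_scheme \<Rightarrow> ('b \<Rightarrow> 'm) \<Rightarrow> ('b \<Rightarrow> 'r) \<Rightarrow> 'm" where
  "lin_ext R M g f = (\<Oplus>\<^bsub>M\<^esub>b\<in>{b. f b \<noteq> \<zero>\<^bsub>R\<^esub>}. f b \<odot>\<^bsub>M\<^esub> g b)"

definition quot_mod :: "('r, 'm, 'y) module_scheme \<Rightarrow> 'm set \<Rightarrow> ('r, 'm set) module" where
  "quot_mod M K = \<lparr>carrier = a_rcosets\<^bsub>M\<^esub> K, monoid.mult = undefined, one = undefined,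
     ring.zero = K, add = set_add M, module.smult = (\<lambda>r C. \<Union>x\<in>C. K +>\<^bsub>M\<^esub> (r \<odot>\<^bsub>M\<^esub> x))\<rparr>"

definition mod_span :: "('r, 'x) ring_scheme \<Rightarrow> ('r, 'm, 'y) module_scheme \<Rightarrow> 'm set \<Rightarrow> 'm set" where
  "mod_span R M C = \<Inter>{H. submodule H R M \<and> C \<subseteq> H}"

definition mod_hom :: "('r, 'x) ring_scheme \<Rightarrow> ('r, 'm, 'y) module_scheme \<Rightarrow> ('r, 'n, 'z) module_scheme \<Rightarrow> ('m \<Rightarrow> 'n) set" where
  "mod_hom R M N = {h \<in> carrier M \<rightarrow> carrier N.
     (\<forall>x\<in>carrier M. \<forall>y\<in>carrier M. h (x \<oplus>\<^bsub>M\<^esub> y) = h x \<oplus>\<^bsub>N\<^esub> h y) \<and>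
     (\<forall>r\<in>carrier R. \<forall>x\<in>carrier M. h (r \<odot>\<^bsub>M\<^esub> x) = r \<odot>\<^bsub>N\<^esub> h x)}"

text \<open>Homs are made extensional (\<^const>\<open>undefined\<close> off the carrier), so that equality
  of functions is equality of linear maps.\<close>

definition Hom_mod :: "('r, 'x) ring_scheme \<Rightarrow> ('r, 'm, 'y) module_scheme \<Rightarrow> ('r, 'n, 'z) module_scheme
    \<Rightarrow> ('r, 'm \<Rightarrow> 'n) module" where
  "Hom_mod R M N = \<lparr>carrier = mod_hom R M N \<inter> extensional (carrier M),
     monoid.mult = undefined, one = undefined,
     ring.zero = (\<lambda>x\<in>carrier M. \<zero>\<^bsub>N\<^esub>),
     add = (\<lambda>f g. \<lambda>x\<in>carrier M. f x \<oplus>\<^bsub>N\<^esub> g x),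
     module.smult = (\<lambda>r f. \<lambda>x\<in>carrier M. r \<odot>\<^bsub>N\<^esub> f x)\<rparr>"

definition tensor_rels :: "('r, 'x) ring_scheme \<Rightarrow> ('r, 'm, 'y) module_scheme \<Rightarrow> ('r, 'n, 'z) module_scheme
    \<Rightarrow> ('m \<times> 'n \<Rightarrow> 'r) set" where
  "tensor_rels R M N = (let F = free_mod R (carrier M \<times> carrier N); e = (\<lambda>m n. basis_vec R (m, n)) in
     mod_span R F
      ({e (m \<oplus>\<^bsub>M\<^esub> m') n \<ominus>\<^bsub>F\<^esub> (e m n \<oplus>\<^bsub>F\<^esub> e m' n) |m m' n.
           m \<in> carrier M \<and> m' \<in> carrier M \<and> n \<in> carrier N} \<union>
       {e m (n \<oplus>\<^bsub>N\<^esub> n') \<ominus>\<^bsub>F\<^esub> (e m n \<oplus>\<^bsub>F\<^esub> e m n') |m n n'.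
           m \<in> carrier M \<and> n \<in> carrier N \<and> n' \<in> carrier N} \<union>
       {e (r \<odot>\<^bsub>M\<^esub> m) n \<ominus>\<^bsub>F\<^esub> (r \<odot>\<^bsub>F\<^esub> e m n) |r m n.
           r \<in> carrier R \<and> m \<in> carrier M \<and> n \<in> carrier N} \<union>
       {e m (r \<odot>\<^bsub>N\<^esub> n) \<ominus>\<^bsub>F\<^esub> (r \<odot>\<^bsub>F\<^esub> e m n) |r m n.
           r \<in> carrier R \<and> m \<in> carrier M \<and> n \<in> carrier N}))"

definition tensor :: "('r, 'x) ring_scheme \<Rightarrow> ('r, 'm, 'y) module_scheme \<Rightarrow> ('r, 'n, 'z) module_scheme
    \<Rightarrow> ('r, ('m \<times> 'n \<Rightarrow> 'r) set) module" where
  "tensor R M N = quot_mod (free_mod R (carrier M \<times> carrier N)) (tensor_rels R M N)"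

text \<open>\<open>M \<otimes>\<^sub>R (R/I)\<close> as a module over the ring \<open>R/I\<close>, with \<open>s (m \<otimes> t) = m \<otimes> st\<close>: the
  scalar \<open>s\<close> acts on representatives by the linear extension of \<open>(m, t) \<mapsto> (m, st)\<close>.\<close>

definition base_change_quot :: "('r, 'x) ring_scheme \<Rightarrow> 'r set \<Rightarrow> ('r, 'm, 'y) module_scheme
    \<Rightarrow> ('r set, ('m \<times> 'r set \<Rightarrow> 'r) set) module" where
  "base_change_quot R I M =
    (let N = quot_mod (regular_mod R) I; F = free_mod R (carrier M \<times> carrier N); T = tensor R M N
     in \<lparr>carrier = carrier T, monoid.mult = undefined, one = undefined, ring.zero = \<zero>\<^bsub>T\<^esub>, add = add T,
         module.smult = (\<lambda>s C. \<Union>f\<in>C. tensor_rels R M N +>\<^bsub>F\<^esub>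
           lin_ext R F (\<lambda>(m, t). basis_vec R (m, s \<otimes>\<^bsub>R Quot I\<^esub> t)) f)\<rparr>)"

text \<open>An \<open>R\<close>-module annihilated by an ideal \<open>I\<close>, viewed as an \<open>R/I\<close>-module: a coset acts as
  any of its elements does.\<close>

definition quot_scalars :: "('r, 'm, 'y) module_scheme \<Rightarrow> ('r set, 'm) module" where
  "quot_scalars N = \<lparr>carrier = carrier N, monoid.mult = undefined, one = undefined,
     ring.zero = \<zero>\<^bsub>N\<^esub>, add = add N, module.smult = (\<lambda>s x. (SOME r. r \<in> s) \<odot>\<^bsub>N\<^esub> x)\<rparr>"


section \<open>Ext\<close>

text \<open>Here \<open>\<epsilon>\<close> is the augmentation and \<open>d n\<close> maps degree \<open>n + 1\<close> to degree \<open>n\<close>.\<close>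

definition free_resolution :: "('r, 'x) ring_scheme \<Rightarrow> ('r, 'm, 'y) module_scheme \<Rightarrow> (nat \<Rightarrow> 'b set)
    \<Rightarrow> (('b \<Rightarrow> 'r) \<Rightarrow> 'm) \<Rightarrow> (nat \<Rightarrow> ('b \<Rightarrow> 'r) \<Rightarrow> ('b \<Rightarrow> 'r)) \<Rightarrow> bool" where
  "free_resolution R M S \<epsilon> d \<longleftrightarrow>
     \<epsilon> \<in> mod_hom R (free_mod R (S 0)) M \<and>
     (\<forall>n. d n \<in> mod_hom R (free_mod R (S (Suc n))) (free_mod R (S n))) \<and>
     \<epsilon> ` carrier (free_mod R (S 0)) = carrier M \<and>
     d 0 ` carrier (free_mod R (S 1)) = {f \<in> carrier (free_mod R (S 0)). \<epsilon> f = \<zero>\<^bsub>M\<^esub>} \<and>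
     (\<forall>n. d (Suc n) ` carrier (free_mod R (S (Suc (Suc n)))) =
        {f \<in> carrier (free_mod R (S (Suc n))). d n f = \<zero>\<^bsub>free_mod R (S n)\<^esub>})"

fun coboundaries :: "('r, 'x) ring_scheme \<Rightarrow> (nat \<Rightarrow> 'b set) \<Rightarrow> (nat \<Rightarrow> ('b \<Rightarrow> 'r) \<Rightarrow> ('b \<Rightarrow> 'r))
    \<Rightarrow> ('r, 'n, 'z) module_scheme \<Rightarrow> nat \<Rightarrow> (('b \<Rightarrow> 'r) \<Rightarrow> 'n) set" where
  "coboundaries R S d N 0 = {\<zero>\<^bsub>Hom_mod R (free_mod R (S 0)) N\<^esub>}"
| "coboundaries R S d N (Suc i) =
     (\<lambda>\<phi>. compose (carrier (free_mod R (S (Suc i)))) \<phi> (d i)) ` carrier (Hom_mod R (free_mod R (S i)) N)"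

definition cocycles :: "('r, 'x) ring_scheme \<Rightarrow> (nat \<Rightarrow> 'b set) \<Rightarrow> (nat \<Rightarrow> ('b \<Rightarrow> 'r) \<Rightarrow> ('b \<Rightarrow> 'r))
    \<Rightarrow> ('r, 'n, 'z) module_scheme \<Rightarrow> nat \<Rightarrow> (('b \<Rightarrow> 'r) \<Rightarrow> 'n) set" where
  "cocycles R S d N i = {\<phi> \<in> carrier (Hom_mod R (free_mod R (S i)) N).
     compose (carrier (free_mod R (S (Suc i)))) \<phi> (d i) = \<zero>\<^bsub>Hom_mod R (free_mod R (S (Suc i))) N\<^esub>}"

definition hom_cohomology :: "('r, 'x) ring_scheme \<Rightarrow> (nat \<Rightarrow> 'b set)
    \<Rightarrow> (nat \<Rightarrow> ('b \<Rightarrow> 'r) \<Rightarrow> ('b \<Rightarrow> 'r)) \<Rightarrow> ('r, 'n, 'z) module_scheme \<Rightarrow> nat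
    \<Rightarrow> ('r, (('b \<Rightarrow> 'r) \<Rightarrow> 'n) set) module" where
  "hom_cohomology R S d N i =
     quot_mod (Hom_mod R (free_mod R (S i)) N \<lparr>carrier := cocycles R S d N i\<rparr>) (coboundaries R S d N i)"

text \<open>Every module has a standard free resolution (theorem \<open>std_free_resolution\<close> below),
  built without choices, whose basis elements all live in a single type.  The basis in
  degree \<open>0\<close> consists of all elements of the module.  The basis in degree \<open>n + 1\<close> consists of all formal linear combinations
  (finite lists of coefficients and basis elements of degree \<open>n\<close>) which represent a cycle;
  each is mapped to the cycle that it represents.\<close>

datatype ('r, 'm) syz = Gen 'm | Syz "('r \<times> ('r, 'm) syz) list"

definition lin_comb :: "('r, 'x) ring_scheme \<Rightarrow> ('r \<times> 'b) list \<Rightarrow> 'b \<Rightarrow> 'r" where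
  "lin_comb R l = (\<lambda>b. foldr (\<lambda>(r, c) s. if c = b then r \<oplus>\<^bsub>R\<^esub> s else s) l \<zero>\<^bsub>R\<^esub>)"

definition std_aug :: "('r, 'x) ring_scheme \<Rightarrow> ('r, 'm, 'y) module_scheme \<Rightarrow> (('r, 'm) syz \<Rightarrow> 'r) \<Rightarrow> 'm" where
  "std_aug R M = lin_ext R M (\<lambda>t. case t of Gen m \<Rightarrow> m | Syz l \<Rightarrow> \<zero>\<^bsub>M\<^esub>)"

text \<open>The boundary does not depend on the degree, since the operations of
  \<^term>\<open>free_mod R S\<close> do not depend on \<open>S\<close>.\<close>

definition std_boundary :: "('r, 'x) ring_scheme \<Rightarrow> (('r, 'm) syz \<Rightarrow> 'r) \<Rightarrow> ('r, 'm) syz \<Rightarrow> 'r" where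
  "std_boundary R = lin_ext R (free_mod R UNIV)
     (\<lambda>t. case t of Gen m \<Rightarrow> \<zero>\<^bsub>free_mod R UNIV\<^esub> | Syz l \<Rightarrow> lin_comb R l)"

primrec std_basis :: "('r, 'x) ring_scheme \<Rightarrow> ('r, 'm, 'y) module_scheme \<Rightarrow> nat \<Rightarrow> ('r, 'm) syz set" where
  "std_basis R M 0 = Gen ` carrier M"
| "std_basis R M (Suc n) = {Syz l |l. set l \<subseteq> carrier R \<times> std_basis R M n \<and>
     (if n = 0 then std_aug R M (lin_comb R l) = \<zero>\<^bsub>M\<^esub>
      else std_boundary R (lin_comb R l) = \<zero>\<^bsub>free_mod R UNIV\<^esub>)}"

definition Ext :: "('r, 'x) ring_scheme \<Rightarrow> nat \<Rightarrow> ('r, 'm, 'y) module_scheme \<Rightarrow> ('r, 'n, 'z) module_scheme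
    \<Rightarrow> ('r, ((('r, 'm) syz \<Rightarrow> 'r) \<Rightarrow> 'n) set) module" where
  "Ext R i M N = hom_cohomology R (std_basis R M) (\<lambda>_. std_boundary R) N i"


subsection \<open>The standard resolution is a free resolution\<close>

lemma free_mod_sel:
  "\<zero>\<^bsub>free_mod R S\<^esub> = (\<lambda>x. \<zero>\<^bsub>R\<^esub>)"
  "f \<oplus>\<^bsub>free_mod R S\<^esub> g = (\<lambda>x. f x \<oplus>\<^bsub>R\<^esub> g x)"
  "r \<odot>\<^bsub>free_mod R S\<^esub> f = (\<lambda>x. r \<otimes>\<^bsub>R\<^esub> f x)"
  "f \<in> carrier (free_mod R S) \<longleftrightarrow> (\<forall>x\<in>S. f x \<in> carrier R) \<and> (\<forall>x. x \<notin> S \<longrightarrow> f x = \<zero>\<^bsub>R\<^esub>)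
     \<and> finite {x. f x \<noteq> \<zero>\<^bsub>R\<^esub>}"
  by (simp_all add: free_mod_def)

declare free_mod_sel [simp]

lemma (in cring) free_mod_val: "f \<in> carrier (free_mod R S) \<Longrightarrow> f x \<in> carrier R"
  by (cases "x \<in> S") auto

lemma (in cring) free_mod_add_closed:
  assumes "f \<in> carrier (free_mod R S)" "g \<in> carrier (free_mod R S)"
  shows "(\<lambda>x. f x \<oplus> g x) \<in> carrier (free_mod R S)"
proof -
  have "finite ({x. f x \<noteq> \<zero>} \<union> {x. g x \<noteq> \<zero>})" using assms by simp
  moreover have "{x. f x \<oplus> g x \<noteq> \<zero>} \<subseteq> {x. f x \<noteq> \<zero>} \<union> {x. g x \<noteq> \<zero>}" by auto
  ultimately have "finite {x. f x \<oplus> g x \<noteq> \<zero>}" by (rule rev_finite_subset)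
  thus ?thesis using assms by simp
qed

lemma (in cring) free_mod_smult_closed:
  assumes "f \<in> carrier (free_mod R S)" "r \<in> carrier R"
  shows "(\<lambda>x. r \<otimes> f x) \<in> carrier (free_mod R S)"
proof -
  have "{x. r \<otimes> f x \<noteq> \<zero>} \<subseteq> {x. f x \<noteq> \<zero>}" using assms by auto
  with assms have "finite {x. r \<otimes> f x \<noteq> \<zero>}" by (auto intro: finite_subset)
  thus ?thesis using assms by simp
qed

lemma (in cring) free_mod_module: "module R (free_mod R S)"
proof (rule moduleI)
  show "abelian_group (free_mod R S)"
  proof (rule abelian_groupI)
    fix f assume f: "f \<in> carrier (free_mod R S)"
    let ?g = "\<lambda>x. \<ominus> \<one> \<otimes> f x"
    have "?g \<in> carrier (free_mod R S)" using f by (rule free_mod_smult_closed) simp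
    moreover have "?g \<oplus>\<^bsub>free_mod R S\<^esub> f = \<zero>\<^bsub>free_mod R S\<^esub>"
      using free_mod_val[OF f] by (auto simp: l_minus l_neg)
    ultimately show "\<exists>y\<in>carrier (free_mod R S). y \<oplus>\<^bsub>free_mod R S\<^esub> f = \<zero>\<^bsub>free_mod R S\<^esub>" by blast
  next
    fix f g assume "f \<in> carrier (free_mod R S)" "g \<in> carrier (free_mod R S)"
    thus "f \<oplus>\<^bsub>free_mod R S\<^esub> g \<in> carrier (free_mod R S)"
      by (simp only: free_mod_sel(2) free_mod_add_closed)
  qed (auto simp del: free_mod_sel(4) simp: free_mod_val a_assoc a_comm a_lcomm, simp)
next
  fix a f assume "a \<in> carrier R" "f \<in> carrier (free_mod R S)"
  thus "a \<odot>\<^bsub>free_mod R S\<^esub> f \<in> carrier (free_mod R S)"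
    by (simp only: free_mod_sel(3) free_mod_smult_closed)
qed (auto simp del: free_mod_sel(4) simp: free_mod_val is_cring l_distr r_distr m_assoc)

lemma (in module) lin_ext_superset:
  assumes "f \<in> carrier (free_mod R S)" "g \<in> S \<rightarrow> carrier M"
    "finite T" "{b. f b \<noteq> \<zero>} \<subseteq> T" "T \<subseteq> S"
  shows "lin_ext R M g f = (\<Oplus>\<^bsub>M\<^esub>b\<in>T. f b \<odot>\<^bsub>M\<^esub> g b)"
  unfolding lin_ext_def using assms
  by (intro M.add.finprod_mono_neutral_cong_left) (auto simp: Pi_iff)

lemma (in module) lin_ext_submodule:
  assumes "f \<in> carrier (free_mod R S)" "g \<in> S \<rightarrow> K" "submodule K R M"
  shows "lin_ext R M g f \<in> K"
proof -
  note K = submoduleE[OF assms(3)]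
  have K0: "\<zero>\<^bsub>M\<^esub> \<in> K" using assms(3) unfolding submodule_def
    using subgroup.one_closed by fastforce
  have "finite T \<Longrightarrow> T \<subseteq> S \<Longrightarrow> (\<Oplus>\<^bsub>M\<^esub>b\<in>T. f b \<odot>\<^bsub>M\<^esub> g b) \<in> K" for T
  proof (induction T rule: finite_induct)
    case empty show ?case using K0 by simp
  next
    case (insert a T)
    have 1: "f b \<odot>\<^bsub>M\<^esub> g b \<in> K" if "b \<in> insert a T" for b
      using that insert.prems assms(1,2) K(4)
      by (auto simp: Pi_iff subset_iff)
    have "(\<Oplus>\<^bsub>M\<^esub>b\<in>insert a T. f b \<odot>\<^bsub>M\<^esub> g b) = f a \<odot>\<^bsub>M\<^esub> g a \<oplus>\<^bsub>M\<^esub> (\<Oplus>\<^bsub>M\<^esub>b\<in>T. f b \<odot>\<^bsub>M\<^esub> g b)"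
      using insert.hyps 1 K(1) by (intro M.finsum_insert) auto
    also have "\<dots> \<in> K" using insert 1 K(5) by auto
    finally show ?case .
  qed
  moreover have "finite {b. f b \<noteq> \<zero>}" "{b. f b \<noteq> \<zero>} \<subseteq> S" using assms(1) by auto
  ultimately show ?thesis unfolding lin_ext_def by blast
qed

lemma (in module) lin_ext_hom:
  assumes g: "g \<in> S \<rightarrow> carrier M"
  shows "lin_ext R M g \<in> mod_hom R (free_mod R S) M"
  unfolding mod_hom_def
proof (intro CollectI conjI ballI)
  show "lin_ext R M g \<in> carrier (free_mod R S) \<rightarrow> carrier M"
    using lin_ext_submodule[OF _ g carrier_is_submodule] by auto
next
  fix f h assume f: "f \<in> carrier (free_mod R S)" and h: "h \<in> carrier (free_mod R S)"
  define T where "T = {b. f b \<noteq> \<zero>} \<union> {b. h b \<noteq> \<zero>}"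
  have T: "finite T" "T \<subseteq> S" using f h by (auto simp: T_def)
  have Tf: "{b. f b \<noteq> \<zero>} \<subseteq> T" and Th: "{b. h b \<noteq> \<zero>} \<subseteq> T" by (auto simp: T_def)
  have "{b. f b \<oplus> h b \<noteq> \<zero>} \<subseteq> T" by (auto simp: T_def)
  note fh = lin_ext_superset[OF R.free_mod_add_closed[OF f h] g T(1) this T(2)]
  have TS: "b \<in> S" if "b \<in> T" for b using that T by auto
  have "lin_ext R M g (f \<oplus>\<^bsub>free_mod R S\<^esub> h)
     = (\<Oplus>\<^bsub>M\<^esub>b\<in>T. (f b \<odot>\<^bsub>M\<^esub> g b) \<oplus>\<^bsub>M\<^esub> (h b \<odot>\<^bsub>M\<^esub> g b))"
    unfolding free_mod_sel(2) fh
    using g R.free_mod_val[OF f] R.free_mod_val[OF h] TS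
    by (intro M.finsum_cong') (auto simp: smult_l_distr Pi_iff)
  also have "\<dots> = lin_ext R M g f \<oplus>\<^bsub>M\<^esub> lin_ext R M g h"
    unfolding lin_ext_superset[OF f g T(1) Tf T(2)] lin_ext_superset[OF h g T(1) Th T(2)]
    using g R.free_mod_val[OF f] R.free_mod_val[OF h] TS
    by (intro M.finsum_addf) (auto simp: Pi_iff)
  finally show "lin_ext R M g (f \<oplus>\<^bsub>free_mod R S\<^esub> h) = lin_ext R M g f \<oplus>\<^bsub>M\<^esub> lin_ext R M g h" .
next
  fix r f assume r: "r \<in> carrier R" and f: "f \<in> carrier (free_mod R S)"
  let ?T = "{b. f b \<noteq> \<zero>}"
  have T: "finite ?T" "?T \<subseteq> S" using f by auto
  have TS: "b \<in> S" if "b \<in> ?T" for b using that T by auto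
  have "{b. r \<otimes> f b \<noteq> \<zero>} \<subseteq> ?T" using r by auto
  note rf = lin_ext_superset[OF R.free_mod_smult_closed[OF f r] g T(1) this T(2)]
  have "lin_ext R M g (r \<odot>\<^bsub>free_mod R S\<^esub> f) = (\<Oplus>\<^bsub>M\<^esub>b\<in>?T. r \<odot>\<^bsub>M\<^esub> (f b \<odot>\<^bsub>M\<^esub> g b))"
    using rf r g R.free_mod_val[OF f] TS
    by (auto intro!: M.add.finprod_cong' simp: smult_assoc1 Pi_iff)
  also have "\<dots> = r \<odot>\<^bsub>M\<^esub> lin_ext R M g f"
    unfolding lin_ext_def using r g R.free_mod_val[OF f] TS T(1)
    by (subst finsum_smult_ldistr) (auto simp: Pi_iff)
  finally show "lin_ext R M g (r \<odot>\<^bsub>free_mod R S\<^esub> f) = r \<odot>\<^bsub>M\<^esub> lin_ext R M g f" .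
qed

lemma (in cring) basis_vec_closed: "b \<in> S \<Longrightarrow> basis_vec R b \<in> carrier (free_mod R S)"
  by (auto simp: basis_vec_def intro: finite_subset[of _ "{b}"])

lemma (in module) lin_ext_basis_vec:
  assumes g: "g \<in> S \<rightarrow> carrier M" and b: "b \<in> S"
  shows "lin_ext R M g (basis_vec R b) = g b"
proof -
  have "lin_ext R M g (basis_vec R b) = (\<Oplus>\<^bsub>M\<^esub>b'\<in>{b}. basis_vec R b b' \<odot>\<^bsub>M\<^esub> g b')"
    using b by (intro lin_ext_superset[OF R.basis_vec_closed[OF b] g]) (auto simp: basis_vec_def)
  also have "\<dots> = g b" using g b by (auto simp: basis_vec_def Pi_iff)
  finally show ?thesis .
qed

lemma (in cring) lin_comb_closed:
  "set l \<subseteq> carrier R \<times> S \<Longrightarrow> lin_comb R l \<in> carrier (free_mod R S)"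
proof (induction l)
  case Nil thus ?case by (simp add: lin_comb_def)
next
  case (Cons a l)
  obtain r b where a: "a = (r, b)" by force
  have eq: "lin_comb R ((r, b) # l) = (\<lambda>x. if x = b then r \<oplus> lin_comb R l x else lin_comb R l x)"
    by (auto simp: lin_comb_def)
  have IH: "lin_comb R l \<in> carrier (free_mod R S)" using Cons by auto
  have "{x. lin_comb R ((r, b) # l) x \<noteq> \<zero>} \<subseteq> insert b {x. lin_comb R l x \<noteq> \<zero>}" by (auto simp: eq)
  hence "finite {x. lin_comb R ((r, b) # l) x \<noteq> \<zero>}" using IH by (auto intro: finite_subset)
  moreover have "r \<in> carrier R" "b \<in> S" using Cons.prems by (auto simp: a)
  ultimately show ?case unfolding a using IH by (simp add: eq)
qed

lemma (in cring) ex_lin_comb: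
  assumes f: "f \<in> carrier (free_mod R S)"
  obtains l where "set l \<subseteq> carrier R \<times> S" "lin_comb R l = f"
proof -
  obtain bs where bs: "distinct bs" "set bs = {b. f b \<noteq> \<zero>}"
    using f finite_distinct_list[of "{b. f b \<noteq> \<zero>}"] by (simp only: free_mod_sel) blast
  let ?l = "\<lambda>bs. map (\<lambda>b. (f b, b)) bs"
  have "distinct bs \<Longrightarrow> lin_comb R (?l bs) x = (if x \<in> set bs then f x else \<zero>)" for x bs
    using free_mod_val[OF f] by (induction bs) (auto simp: lin_comb_def)
  hence "lin_comb R (?l bs) = f" using bs by auto
  moreover have "set (?l bs) \<subseteq> carrier R \<times> S" using f bs by auto
  ultimately show ?thesis using that by blast
qed

lemma (in module) kernel_submodule:
  assumes "module R N" "h \<in> mod_hom R M N"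
  shows "submodule {x \<in> carrier M. h x = \<zero>\<^bsub>N\<^esub>} R M"
proof -
  interpret N: module R N by fact
  have h: "h \<in> carrier M \<rightarrow> carrier N"
    and ha: "\<And>x y. x \<in> carrier M \<Longrightarrow> y \<in> carrier M \<Longrightarrow> h (x \<oplus>\<^bsub>M\<^esub> y) = h x \<oplus>\<^bsub>N\<^esub> h y"
    and hs: "\<And>r x. r \<in> carrier R \<Longrightarrow> x \<in> carrier M \<Longrightarrow> h (r \<odot>\<^bsub>M\<^esub> x) = r \<odot>\<^bsub>N\<^esub> h x"
    using assms(2) by (auto simp: mod_hom_def)
  have h0: "h \<zero>\<^bsub>M\<^esub> = \<zero>\<^bsub>N\<^esub>" using hs[of "\<zero>\<^bsub>R\<^esub>" "\<zero>\<^bsub>M\<^esub>"] funcset_mem[OF h M.zero_closed] by simp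
  have hn: "h (\<ominus>\<^bsub>M\<^esub> x) = \<zero>\<^bsub>N\<^esub>" if "x \<in> carrier M" "h x = \<zero>\<^bsub>N\<^esub>" for x
    using ha[of x "\<ominus>\<^bsub>M\<^esub> x"] h that h0 by (auto simp: M.r_neg Pi_iff)
  show ?thesis by (rule submoduleI) (auto simp: h0 hn ha hs)
qed

lemma (in module) mod_hom_cong:
  assumes "h \<in> mod_hom R M N" "\<And>x. x \<in> carrier M \<Longrightarrow> h' x = h x"
  shows "h' \<in> mod_hom R M N"
  using assms by (auto simp: mod_hom_def Pi_iff)

lemma lin_ext_free_carrier:
  assumes "cring R" "g \<in> S \<rightarrow> carrier (free_mod R U)" "f \<in> carrier (free_mod R S)"
  shows "lin_ext R (free_mod R UNIV) g f = lin_ext R (free_mod R U) g f"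
proof -
  interpret cring R by fact
  interpret V: module R "free_mod R UNIV" by (rule free_mod_module)
  interpret U: module R "free_mod R U" by (rule free_mod_module)
  have sub: "carrier (free_mod R U) \<subseteq> carrier (free_mod R UNIV)"
    using free_mod_val by (fastforce simp del: free_mod_sel(4) simp: free_mod_sel(4)[of _ R UNIV] free_mod_def)
  have 1: "h \<in> T \<rightarrow> carrier (free_mod R U) \<Longrightarrow>
       finsum (free_mod R UNIV) h T = finsum (free_mod R U) h T" if "finite T" for h :: "_ \<Rightarrow> _" and T
    using that
  proof (induction T rule: finite_induct)
    case (insert a T)
    hence "h \<in> T \<rightarrow> carrier (free_mod R UNIV)" "h a \<in> carrier (free_mod R UNIV)" 
      "h \<in> T \<rightarrow> carrier (free_mod R U)" "h a \<in> carrier (free_mod R U)" using sub by blast+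
    thus ?case using insert by (simp del: free_mod_sel(4))
  qed simp
  have eq: "(\<lambda>b. f b \<odot>\<^bsub>free_mod R UNIV\<^esub> g b) = (\<lambda>b. f b \<odot>\<^bsub>free_mod R U\<^esub> g b)" by simp
  have cl: "(\<lambda>b. f b \<odot>\<^bsub>free_mod R U\<^esub> g b) \<in> {b. f b \<noteq> \<zero>\<^bsub>R\<^esub>} \<rightarrow> carrier (free_mod R U)"
  proof
    fix b assume "b \<in> {b. f b \<noteq> \<zero>\<^bsub>R\<^esub>}"
    hence "b \<in> S" using assms(3) by auto
    thus "f b \<odot>\<^bsub>free_mod R U\<^esub> g b \<in> carrier (free_mod R U)"
      using assms by (intro U.smult_closed) (auto simp del: free_mod_sel simp: free_mod_val)
  qed
  have "finite {b. f b \<noteq> \<zero>\<^bsub>R\<^esub>}" using assms(3) by simp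
  from 1[OF this cl] show ?thesis unfolding lin_ext_def eq .
qed

theorem (in module) std_free_resolution:
  "free_resolution R M (std_basis R M) (std_aug R M) (\<lambda>_. std_boundary R)"
proof -
  note std_basis.simps(2)[simp del]
  let ?S = "std_basis R M" and ?F = "\<lambda>n. free_mod R (std_basis R M n)"
  define ga where "ga = (\<lambda>t :: ('a,'c) syz. case t of Gen m \<Rightarrow> m | Syz l \<Rightarrow> \<zero>\<^bsub>M\<^esub>)"
  define gb where "gb = (\<lambda>t :: ('a,'c) syz. case t of Gen m \<Rightarrow> (\<lambda>_. \<zero>\<^bsub>R\<^esub>) | Syz l \<Rightarrow> lin_comb R l)"
  have gb': "std_boundary R = lin_ext R (free_mod R UNIV) gb"
    unfolding std_boundary_def gb_def free_mod_sel(1) ..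
  have ga': "std_aug R M = lin_ext R M ga" by (simp add: std_aug_def ga_def)
  have ga: "ga \<in> ?S 0 \<rightarrow> carrier M" by (auto simp: ga_def)
  have F: "module R (?F n)" for n by (rule R.free_mod_module)
  have aug: "std_aug R M \<in> mod_hom R (?F 0) M" unfolding ga' by (rule lin_ext_hom[OF ga])
  define K where "K n = (if n = 0 then {f \<in> carrier (?F 0). std_aug R M f = \<zero>\<^bsub>M\<^esub>}
      else {f \<in> carrier (?F n). std_boundary R f = (\<lambda>_. \<zero>)})" for n
  have gbK: "gb \<in> ?S (Suc n) \<rightarrow> K n" for n
  proof
    fix t assume "t \<in> ?S (Suc n)"
    then obtain l where "t = Syz l" "set l \<subseteq> carrier R \<times> ?S n"
      "if n = 0 then std_aug R M (lin_comb R l) = \<zero>\<^bsub>M\<^esub> else std_boundary R (lin_comb R l) = (\<lambda>_. \<zero>)"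
      unfolding std_basis.simps(2) free_mod_sel(1) by blast
    thus "gb t \<in> K n" using R.lin_comb_closed[of l "?S n"]
      by (simp add: gb_def K_def del: free_mod_sel std_basis.simps split: if_splits)
  qed
  have KF: "K n \<subseteq> carrier (?F n)" for n by (auto simp: K_def)
  have gbF: "gb \<in> ?S (Suc n) \<rightarrow> carrier (?F n)" for n using gbK KF by blast
  have bd_eq: "std_boundary R f = lin_ext R (?F n) gb f" if "f \<in> carrier (?F (Suc n))" for f n
    unfolding gb' by (rule lin_ext_free_carrier[OF R.is_cring gbF that])
  have hom: "std_boundary R \<in> mod_hom R (?F (Suc n)) (?F n)" for n
  proof -
    have "lin_ext R (?F n) gb \<in> mod_hom R (?F (Suc n)) (?F n)"
      by (rule module.lin_ext_hom[OF F gbF])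
    thus ?thesis by (rule module.mod_hom_cong[OF F]) (rule bd_eq)
  qed
  have Ksub: "submodule (K n) R (?F n)" for n
  proof (cases n)
    case 0
    thus ?thesis using module.kernel_submodule[OF F[of 0] module_axioms aug]
      unfolding K_def by (simp only: simp_thms if_True)
  next
    case (Suc m)
    hence "K n = {f \<in> carrier (?F (Suc m)). std_boundary R f = \<zero>\<^bsub>?F m\<^esub>}"
      unfolding K_def free_mod_sel(1) by (simp only: simp_thms nat.simps if_False)
    thus ?thesis using module.kernel_submodule[OF F[of "Suc m"] F[of m] hom[of m]] Suc by (simp only:)
  qed
  have exact: "std_boundary R ` carrier (?F (Suc n)) = K n" for n
  proof (intro equalityI subsetI)
    fix y assume "y \<in> std_boundary R ` carrier (?F (Suc n))"
    then obtain f where f: "f \<in> carrier (?F (Suc n))" "y = std_boundary R f" by blast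
    show "y \<in> K n" unfolding f(2) bd_eq[OF f(1)] by (rule module.lin_ext_submodule[OF F f(1) gbK Ksub])
  next
    fix y assume y: "y \<in> K n"
    then obtain l where l: "set l \<subseteq> carrier R \<times> ?S n" "lin_comb R l = y"
      using R.ex_lin_comb KF by blast
    have "if n = 0 then std_aug R M y = \<zero>\<^bsub>M\<^esub> else std_boundary R y = (\<lambda>_. \<zero>)"
      using y by (simp add: K_def del: free_mod_sel std_basis.simps split: if_splits)
    hence mem: "Syz l \<in> ?S (Suc n)" unfolding std_basis.simps(2) free_mod_sel(1) using l by blast
    have "std_boundary R (basis_vec R (Syz l)) = gb (Syz l)"
      using bd_eq[OF R.basis_vec_closed[OF mem]] module.lin_ext_basis_vec[OF F gbF mem] by simp
    hence "std_boundary R (basis_vec R (Syz l)) = y" by (simp add: gb_def l)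
    thus "y \<in> std_boundary R ` carrier (?F (Suc n))" using R.basis_vec_closed[OF mem] by blast
  qed
  have "std_aug R M ` carrier (?F 0) = carrier M"
  proof (intro equalityI subsetI)
    fix m assume "m \<in> std_aug R M ` carrier (?F 0)"
    thus "m \<in> carrier M" using aug by (auto simp: mod_hom_def)
  next
    fix m assume "m \<in> carrier M"
    hence mem: "Gen m \<in> ?S 0" by simp
    have "std_aug R M (basis_vec R (Gen m)) = m"
      unfolding ga' using lin_ext_basis_vec[OF ga mem] by (simp add: ga_def)
    thus "m \<in> std_aug R M ` carrier (?F 0)" using R.basis_vec_closed[OF mem] by (metis image_eqI)
  qed
  moreover have "std_boundary R ` carrier (?F 1) = {f \<in> carrier (?F 0). std_aug R M f = \<zero>\<^bsub>M\<^esub>}"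
    using exact[of 0] unfolding K_def by (simp only: simp_thms if_True One_nat_def)
  moreover have "std_boundary R ` carrier (?F (Suc (Suc n))) =
      {f \<in> carrier (?F (Suc n)). std_boundary R f = \<zero>\<^bsub>?F n\<^esub>}" for n
    using exact[of "Suc n"] unfolding K_def free_mod_sel(1) by (simp only: simp_thms nat.simps if_False)
  ultimately show ?thesis unfolding free_resolution_def using aug hom by blast
qed

declare free_mod_sel [simp del]


section \<open>The rings and modules of the theorem\<close>

datatype var = V1 | V2 | V3 | V4 | V5

type_synonym 'k poly5 = "(var \<Rightarrow>\<^sub>0 nat) \<Rightarrow>\<^sub>0 'k"

definition pconst :: "'k::field \<Rightarrow> 'k poly5" where
  "pconst c = Poly_Mapping.single 0 c"

definition pvar :: "var \<Rightarrow> 'k::field poly5" where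
  "pvar v = Poly_Mapping.single (Poly_Mapping.single v 1) 1"

abbreviation P5 :: "'k::field poly5 ring" where
  "P5 \<equiv> ring_of_type_algebra"

definition I_ideal :: "'k::field \<Rightarrow> 'k poly5 set" where
  "I_ideal \<alpha> = Idl\<^bsub>P5\<^esub>
     {pconst \<alpha> * pvar V1 * pvar V3 + pvar V2 * pvar V3,
      pvar V1 * pvar V4 + pvar V2 * pvar V4,
      pvar V3 ^ 2 + pconst \<alpha> * pvar V1 * pvar V5 - pvar V2 * pvar V5,
      pvar V4 ^ 2 + pvar V1 * pvar V5 - pvar V2 * pvar V5,
      pvar V1 ^ 2, pvar V2 ^ 2, pvar V3 * pvar V4, pvar V3 * pvar V5, pvar V4 * pvar V5, pvar V5 ^ 2}"

definition A_ring :: "'k::field \<Rightarrow> 'k poly5 set ring" where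
  "A_ring \<alpha> = P5 Quot I_ideal \<alpha>"

definition cls :: "'k::field \<Rightarrow> 'k poly5 \<Rightarrow> 'k poly5 set" where
  "cls \<alpha> p = I_ideal \<alpha> +>\<^bsub>P5\<^esub> p"

abbreviation xA :: "'k::field \<Rightarrow> var \<Rightarrow> 'k poly5 set" where
  "xA \<alpha> v \<equiv> cls \<alpha> (pvar v)"

definition x5_ideal :: "'k::field \<Rightarrow> 'k poly5 set set" where
  "x5_ideal \<alpha> = Idl\<^bsub>A_ring \<alpha>\<^esub> {xA \<alpha> V5}"

definition B_ring :: "'k::field \<Rightarrow> 'k poly5 set set ring" where
  "B_ring \<alpha> = A_ring \<alpha> Quot x5_ideal \<alpha>"

text \<open>\<open>A\<^sup>2\<close> is \<^term>\<open>free_mod (A_ring \<alpha>) {1, 2::nat}\<close>; matrices act on column vectors.\<close>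

definition M_map :: "'k::field \<Rightarrow> (nat \<Rightarrow> 'k poly5 set) \<Rightarrow> nat \<Rightarrow> 'k poly5 set" where
  "M_map \<alpha> v = (\<lambda>i.
     if i = 1 then xA \<alpha> V1 \<otimes>\<^bsub>A_ring \<alpha>\<^esub> v 1 \<oplus>\<^bsub>A_ring \<alpha>\<^esub> xA \<alpha> V3 \<otimes>\<^bsub>A_ring \<alpha>\<^esub> v 2
     else if i = 2 then xA \<alpha> V4 \<otimes>\<^bsub>A_ring \<alpha>\<^esub> v 1 \<oplus>\<^bsub>A_ring \<alpha>\<^esub> xA \<alpha> V2 \<otimes>\<^bsub>A_ring \<alpha>\<^esub> v 2
     else \<zero>\<^bsub>A_ring \<alpha>\<^esub>)"

definition M_mod :: "'k::field \<Rightarrow> ('k poly5 set, nat \<Rightarrow> 'k poly5 set) module" where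
  "M_mod \<alpha> = (let F = free_mod (A_ring \<alpha>) {1, 2} in F\<lparr>carrier := M_map \<alpha> ` carrier F\<rparr>)"

definition L_mod :: "'k::field
    \<Rightarrow> ('k poly5 set set, ((nat \<Rightarrow> 'k poly5 set) \<times> 'k poly5 set set \<Rightarrow> 'k poly5 set) set) module" where
  "L_mod \<alpha> = base_change_quot (A_ring \<alpha>) (x5_ideal \<alpha>) (M_mod \<alpha>)"

definition J_ideal :: "'k::field \<Rightarrow> int \<Rightarrow> 'k poly5 set set" where
  "J_ideal \<alpha> q = Idl\<^bsub>A_ring \<alpha>\<^esub>
     {xA \<alpha> V1 \<ominus>\<^bsub>A_ring \<alpha>\<^esub> xA \<alpha> V2,
      xA \<alpha> V1 \<ominus>\<^bsub>A_ring \<alpha>\<^esub> (cls \<alpha> (pconst (\<alpha> powi q)) \<otimes>\<^bsub>A_ring \<alpha>\<^esub> xA \<alpha> V3),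
      xA \<alpha> V1 \<ominus>\<^bsub>A_ring \<alpha>\<^esub> xA \<alpha> V4,
      xA \<alpha> V5}"

definition T_mod :: "'k::field \<Rightarrow> int \<Rightarrow> ('k poly5 set, 'k poly5 set set) module" where
  "T_mod \<alpha> q = quot_mod (regular_mod (A_ring \<alpha>)) (J_ideal \<alpha> q)"

definition T_mod_B :: "'k::field \<Rightarrow> int \<Rightarrow> ('k poly5 set set, 'k poly5 set set) module" where
  "T_mod_B \<alpha> q = quot_scalars (T_mod \<alpha> q)"

end

(* Put D_i = (x_1, alpha^i x_3; x_4, x_2). Over A, and over B as well, the sequence of matrices D_i is exact:
   D_i D_(i+1) = 0 by the relations, and a coordinate computation in the 12-dimensional algebra A shows that
   every vector killed by D_i lies in the image of D_(i+1). So D_1, D_2, ... is a free resolution of M = im D_0.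
   Because the sequence stays exact over B, the tensor product L is the image of D_0 over B, and its
   resolution is the reduction of that of M.

   T_q is k[x]/(x^2), where x_1, x_2, x_4 act as x and x_3 acts as alpha^(-q) x. Hence Hom(-, T_q) turns D_i
   into x N_i with N_i a 2x2 matrix over k of determinant 1 - alpha^(i-q), up to transposition. This is singular
   exactly for i = q, so in positive degrees the complex has cohomology only in degrees q - 1 and q. *)

theory Submission
  imports Defs
begin

section \<open>Comparison of free resolutions\<close>

text \<open>\<open>Ext\<close> is computed from the standard resolution, whose bases consist of all
  elements and all formal syzygies, so nothing can be read off from it. A comparison of resolutions
  is needed, but a weak one: nonvanishing means that some cocycle is not a coboundary, and the
  inclusion of cocycles in coboundaries passes between any two free resolutions. No isomorphism of
  cohomology is built. A is given by generators and relations, so the independence of twelve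
  monomials has to be proved. It comes from an algebra written down on 12-tuples: evaluation in it
  kills the defining ideal, and every polynomial is congruent to a normal form with the same value.
  So the ideal is the kernel of evaluation, and (x_5) and J_q become sets of coordinate vectors. L
  consists of cosets of formal sums. Sending m tensor t to t times the reduction of m maps it to
  B^2. This is injective because relations lift: a relation over B between the columns of D_0 is D_1
  w by exactness over B, and D_1 of a lift of w is a relation over A.\<close>

lemma mod_hom_closed: "h \<in> mod_hom R M N \<Longrightarrow> x \<in> carrier M \<Longrightarrow> h x \<in> carrier N"
  and mod_hom_add: "h \<in> mod_hom R M N \<Longrightarrow> x \<in> carrier M \<Longrightarrow> y \<in> carrier M
    \<Longrightarrow> h (x \<oplus>\<^bsub>M\<^esub> y) = h x \<oplus>\<^bsub>N\<^esub> h y"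
  and mod_hom_smult: "h \<in> mod_hom R M N \<Longrightarrow> r \<in> carrier R \<Longrightarrow> x \<in> carrier M
    \<Longrightarrow> h (r \<odot>\<^bsub>M\<^esub> x) = r \<odot>\<^bsub>N\<^esub> h x"
  by (auto simp: mod_hom_def)

lemma mod_hom_zero:
  assumes "module R M" "module R N" "h \<in> mod_hom R M N"
  shows "h \<zero>\<^bsub>M\<^esub> = \<zero>\<^bsub>N\<^esub>"
proof -
  interpret M: module R M by fact
  interpret N: module R N by fact
  have "h (\<zero>\<^bsub>R\<^esub> \<odot>\<^bsub>M\<^esub> \<zero>\<^bsub>M\<^esub>) = \<zero>\<^bsub>R\<^esub> \<odot>\<^bsub>N\<^esub> h \<zero>\<^bsub>M\<^esub>" by (rule mod_hom_smult[OF assms(3)]) auto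
  thus ?thesis using mod_hom_closed[OF assms(3)] by simp
qed

lemma mod_hom_minus:
  assumes "module R M" "module R N" "h \<in> mod_hom R M N" "x \<in> carrier M" "y \<in> carrier M"
  shows "h (x \<ominus>\<^bsub>M\<^esub> y) = h x \<ominus>\<^bsub>N\<^esub> h y"
proof -
  interpret M: module R M by fact
  interpret N: module R N by fact
  have "h (\<ominus>\<^bsub>R\<^esub> \<one>\<^bsub>R\<^esub> \<odot>\<^bsub>M\<^esub> y) = \<ominus>\<^bsub>R\<^esub> \<one>\<^bsub>R\<^esub> \<odot>\<^bsub>N\<^esub> h y" by (rule mod_hom_smult[OF assms(3)]) (auto simp: assms)
  thus ?thesis using assms mod_hom_closed[OF assms(3)] mod_hom_add[OF assms(3), of x "\<ominus>\<^bsub>M\<^esub> y"]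
    by (simp add: M.smult_l_minus N.smult_l_minus a_minus_def)
qed

lemma mod_hom_compose:
  "h \<in> mod_hom R M N \<Longrightarrow> h' \<in> mod_hom R N P \<Longrightarrow> (\<lambda>x. h' (h x)) \<in> mod_hom R M P"
  by (auto simp: mod_hom_def Pi_iff)

lemma (in abelian_group) minus_eq_zero_iff:
  assumes "x \<in> carrier G" "y \<in> carrier G"
  shows "x \<ominus> y = \<zero> \<longleftrightarrow> x = y"
proof
  assume "x \<ominus> y = \<zero>"
  thus "x = y" using assms minus_equality[of x "\<ominus> y"] by (simp add: minus_eq)
qed (use assms in \<open>simp add: minus_eq r_neg\<close>)

lemma (in module) mod_hom_diff:
  assumes "module R N" "h \<in> mod_hom R M N" "h' \<in> mod_hom R M N"
  shows "(\<lambda>x. h x \<ominus>\<^bsub>N\<^esub> h' x) \<in> mod_hom R M N"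
proof -
  interpret N: module R N by fact
  have 1: "(a \<oplus>\<^bsub>N\<^esub> b) \<ominus>\<^bsub>N\<^esub> (c \<oplus>\<^bsub>N\<^esub> e) = (a \<ominus>\<^bsub>N\<^esub> c) \<oplus>\<^bsub>N\<^esub> (b \<ominus>\<^bsub>N\<^esub> e)"
    if "a \<in> carrier N" "b \<in> carrier N" "c \<in> carrier N" "e \<in> carrier N" for a b c e
    using that by (simp add: N.minus_eq N.minus_add N.a_ac)
  have 2: "r \<odot>\<^bsub>N\<^esub> a \<ominus>\<^bsub>N\<^esub> r \<odot>\<^bsub>N\<^esub> b = r \<odot>\<^bsub>N\<^esub> (a \<ominus>\<^bsub>N\<^esub> b)"
    if "a \<in> carrier N" "b \<in> carrier N" "r \<in> carrier R" for a b r
    using that by (simp add: N.minus_eq N.smult_r_distr N.smult_r_minus)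
  show ?thesis
    using assms(2,3) unfolding mod_hom_def[of R M N]
    by (auto simp: Pi_iff mod_hom_def 1 2)
qed

lemma (in cring) lin_comb_Nil: "lin_comb R [] = \<zero>\<^bsub>free_mod R S\<^esub>"
  by (auto simp: lin_comb_def free_mod_sel)

lemma (in cring) lin_comb_Cons:
  assumes "r \<in> carrier R" "set l \<subseteq> carrier R \<times> S"
  shows "lin_comb R ((r, b) # l) = (r \<odot>\<^bsub>free_mod R S\<^esub> basis_vec R b) \<oplus>\<^bsub>free_mod R S\<^esub> lin_comb R l"
  using assms free_mod_val[OF lin_comb_closed[OF assms(2)]]
  by (auto simp: free_mod_sel basis_vec_def lin_comb_def)

text \<open>Every element is the \<open>lin_comb\<close> of a list, so induction on the list adds
  one multiple of a basis vector at a time. This serves both for equality of linear maps and for the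
  shape of tensors.\<close>

lemma (in cring) free_mod_induct [consumes 1, case_names zero add]:
  assumes "f \<in> carrier (free_mod R S)" "P \<zero>\<^bsub>free_mod R S\<^esub>"
    "\<And>r b g. r \<in> carrier R \<Longrightarrow> b \<in> S \<Longrightarrow> g \<in> carrier (free_mod R S) \<Longrightarrow> P g \<Longrightarrow>
       P ((r \<odot>\<^bsub>free_mod R S\<^esub> basis_vec R b) \<oplus>\<^bsub>free_mod R S\<^esub> g)"
  shows "P f"
proof -
  obtain l where l: "set l \<subseteq> carrier R \<times> S" "lin_comb R l = f" using ex_lin_comb[OF assms(1)] .
  from l(1) have "P (lin_comb R l)"
  proof (induction l)
    case Nil show ?case using assms(2) by (simp only: lin_comb_Nil[of S])
  next
    case (Cons a l)
    obtain r b where a: "a = (r, b)" by force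
    have "r \<in> carrier R" "b \<in> S" "set l \<subseteq> carrier R \<times> S" using Cons.prems a by auto
    thus ?case using assms(3)[OF _ _ lin_comb_closed] Cons.IH by (simp add: a lin_comb_Cons)
  qed
  thus ?thesis by (simp add: l)
qed

lemma (in module) free_mod_hom_eqI:
  assumes "u \<in> mod_hom R (free_mod R S) M" "v \<in> mod_hom R (free_mod R S) M"
    "\<And>b. b \<in> S \<Longrightarrow> u (basis_vec R b) = v (basis_vec R b)" "f \<in> carrier (free_mod R S)"
  shows "u f = v f"
  using assms(4)
proof (induction rule: R.free_mod_induct)
  case zero
  show ?case using assms(1,2) mod_hom_zero[OF R.free_mod_module module_axioms] by metis
next
  case (add r b g)
  interpret F: module R "free_mod R S" by (rule R.free_mod_module)
  show ?case using add assms(3) R.basis_vec_closed[of b S]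
    by (simp add: mod_hom_add[OF assms(1)] mod_hom_add[OF assms(2)]
        mod_hom_smult[OF assms(1)] mod_hom_smult[OF assms(2)])
qed

text \<open>Projectivity of free modules: preimages under \<open>p\<close> are chosen for basis
  vectors only, and linearity carries the equation to all elements.\<close>

lemma free_mod_lift:
  assumes "module R U" "module R Y" "p \<in> mod_hom R U Y" "v \<in> mod_hom R (free_mod R S) Y"
    "\<And>f. f \<in> carrier (free_mod R S) \<Longrightarrow> v f \<in> p ` carrier U"
  shows "\<exists>w\<in>mod_hom R (free_mod R S) U. \<forall>f\<in>carrier (free_mod R S). p (w f) = v f"
proof -
  interpret U: module R U by fact
  interpret Y: module R Y by fact
  have "\<forall>b\<in>S. \<exists>x\<in>carrier U. p x = v (basis_vec R b)"
    using assms(5) U.R.basis_vec_closed by (metis image_iff)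
  then obtain g where g: "\<And>b. b \<in> S \<Longrightarrow> g b \<in> carrier U" "\<And>b. b \<in> S \<Longrightarrow> p (g b) = v (basis_vec R b)"
    by metis
  have gS: "g \<in> S \<rightarrow> carrier U" using g by auto
  let ?w = "lin_ext R U g"
  have w: "?w \<in> mod_hom R (free_mod R S) U" by (rule U.lin_ext_hom[OF gS])
  have "p (?w f) = v f" if "f \<in> carrier (free_mod R S)" for f
    by (rule Y.free_mod_hom_eqI[OF mod_hom_compose[OF w assms(3)] assms(4) _ that])
      (simp add: U.lin_ext_basis_vec[OF gS] g)
  with w show ?thesis by blast
qed

section \<open>Chain maps and homotopies between free resolutions\<close>

lemma free_resolutionD:
  assumes "free_resolution R M S \<epsilon> d"
  shows "\<epsilon> \<in> mod_hom R (free_mod R (S 0)) M"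
    and "d n \<in> mod_hom R (free_mod R (S (Suc n))) (free_mod R (S n))"
    and "\<epsilon> ` carrier (free_mod R (S 0)) = carrier M"
    and "d 0 ` carrier (free_mod R (S (Suc 0))) = {f \<in> carrier (free_mod R (S 0)). \<epsilon> f = \<zero>\<^bsub>M\<^esub>}"
    and "d (Suc n) ` carrier (free_mod R (S (Suc (Suc n)))) =
        {f \<in> carrier (free_mod R (S (Suc n))). d n f = \<zero>\<^bsub>free_mod R (S n)\<^esub>}"
  using assms unfolding free_resolution_def One_nat_def by blast+

text \<open>The identity of \<open>M\<close> is lifted degree by degree; each lift exists because
  cycles of the target resolution are boundaries.\<close>

lemma (in module) ex_chain_map:
  assumes F: "free_resolution R M S \<epsilon> d" and G: "free_resolution R M S' \<epsilon>' d'"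
  obtains f where "\<And>n. f n \<in> mod_hom R (free_mod R (S n)) (free_mod R (S' n))"
    "\<And>x. x \<in> carrier (free_mod R (S 0)) \<Longrightarrow> \<epsilon>' (f 0 x) = \<epsilon> x"
    "\<And>n x. x \<in> carrier (free_mod R (S (Suc n))) \<Longrightarrow> d' n (f (Suc n) x) = f n (d n x)"
proof -
  note F = free_resolutionD[OF F] and G = free_resolutionD[OF G]
  note m = R.free_mod_module
  \<comment> \<open>The second clause carries the induction: \<open>f\<close> sends boundaries to
    boundaries of the target, which is what the next lift requires. With it, dependent choice looks
    at one degree at a time.\<close>
  define P where "P n f \<longleftrightarrow> f \<in> mod_hom R (free_mod R (S n)) (free_mod R (S' n)) \<and>
      (\<forall>x\<in>carrier (free_mod R (S (Suc n))). f (d n x) \<in> d' n ` carrier (free_mod R (S' (Suc n)))) \<and>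
      (n = 0 \<longrightarrow> (\<forall>x\<in>carrier (free_mod R (S 0)). \<epsilon>' (f x) = \<epsilon> x))" for n f
  define Q where "Q n f f' \<longleftrightarrow> (\<forall>x\<in>carrier (free_mod R (S (Suc n))). d' n (f' x) = f (d n x))" for n f f'
  have "\<exists>f. P 0 f"
  proof -
    have "\<And>x. x \<in> carrier (free_mod R (S 0)) \<Longrightarrow> \<epsilon> x \<in> \<epsilon>' ` carrier (free_mod R (S' 0))"
      using F(3) G(3) by blast
    from free_mod_lift[OF m module_axioms G(1) F(1) this]
    obtain w where w: "w \<in> mod_hom R (free_mod R (S 0)) (free_mod R (S' 0))"
      "\<And>x. x \<in> carrier (free_mod R (S 0)) \<Longrightarrow> \<epsilon>' (w x) = \<epsilon> x" by blast
    have "w (d 0 x) \<in> d' 0 ` carrier (free_mod R (S' (Suc 0)))"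
      if x: "x \<in> carrier (free_mod R (S (Suc 0)))" for x
    proof -
      have "d 0 x \<in> {f \<in> carrier (free_mod R (S 0)). \<epsilon> f = \<zero>\<^bsub>M\<^esub>}" using x unfolding F(4)[symmetric] by blast
      thus ?thesis unfolding G(4) using w mod_hom_closed[OF w(1)] by auto
    qed
    thus ?thesis unfolding P_def using w by blast
  qed
  moreover have "\<exists>f'. P (Suc n) f' \<and> Q n f f'" if "P n f" for n f
  proof -
    have f: "f \<in> mod_hom R (free_mod R (S n)) (free_mod R (S' n))"
      and "\<And>x. x \<in> carrier (free_mod R (S (Suc n))) \<Longrightarrow> f (d n x) \<in> d' n ` carrier (free_mod R (S' (Suc n)))"
      using that by (auto simp: P_def)
    from free_mod_lift[OF m m G(2) mod_hom_compose[OF F(2) f] this(2)]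
    obtain w where w: "w \<in> mod_hom R (free_mod R (S (Suc n))) (free_mod R (S' (Suc n)))"
      "\<And>x. x \<in> carrier (free_mod R (S (Suc n))) \<Longrightarrow> d' n (w x) = f (d n x)" by blast
    have "w (d (Suc n) x) \<in> d' (Suc n) ` carrier (free_mod R (S' (Suc (Suc n))))"
      if x: "x \<in> carrier (free_mod R (S (Suc (Suc n))))" for x
    proof -
      have "d (Suc n) x \<in> {f \<in> carrier (free_mod R (S (Suc n))). d n f = \<zero>\<^bsub>free_mod R (S n)\<^esub>}"
        using x unfolding F(5)[symmetric] by blast
      thus ?thesis unfolding G(5) using w mod_hom_closed[OF w(1)] mod_hom_zero[OF m m f] by auto
    qed
    thus ?thesis unfolding P_def Q_def using w by blast
  qed
  ultimately obtain f where f: "\<And>n. P n (f n)" "\<And>n. Q n (f n) (f (Suc n))"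
    using dependent_nat_choice[of P Q] by blast
  show ?thesis by (rule that[of f]) (use f in \<open>simp_all add: P_def Q_def\<close>)
qed

text \<open>An endomorphism over the identity is homotopic to it: d kills e - id - h d, so exactness
  lifts this map to the next degree.\<close>

lemma (in module) ex_homotopy:
  assumes G: "free_resolution R M S \<epsilon> d"
    and e: "\<And>n. e n \<in> mod_hom R (free_mod R (S n)) (free_mod R (S n))"
      "\<And>x. x \<in> carrier (free_mod R (S 0)) \<Longrightarrow> \<epsilon> (e 0 x) = \<epsilon> x"
      "\<And>n x. x \<in> carrier (free_mod R (S (Suc n))) \<Longrightarrow> d n (e (Suc n) x) = e n (d n x)"
  obtains h where "\<And>n. h n \<in> mod_hom R (free_mod R (S n)) (free_mod R (S (Suc n)))"
    "\<And>x. x \<in> carrier (free_mod R (S 0)) \<Longrightarrow> d 0 (h 0 x) = e 0 x \<ominus>\<^bsub>free_mod R (S 0)\<^esub> x"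
    "\<And>n x. x \<in> carrier (free_mod R (S (Suc n))) \<Longrightarrow>
      d (Suc n) (h (Suc n) x) = e (Suc n) x \<ominus>\<^bsub>free_mod R (S (Suc n))\<^esub> x \<ominus>\<^bsub>free_mod R (S (Suc n))\<^esub> h n (d n x)"
proof -
  note G = free_resolutionD[OF G]
  note m = R.free_mod_module
  let ?F = "\<lambda>n. free_mod R (S n)"
  interpret F: module R "?F n" for n by (rule m)
  have id: "(\<lambda>x. x) \<in> mod_hom R (?F n) (?F n)" for n by (simp add: mod_hom_def)
  \<comment> \<open>The homotopy identity involves the map of the previous degree, but on boundaries
    that term vanishes since d d = 0. Stating the invariant at \<open>d n x\<close> keeps it free of
    earlier maps.\<close>
  define P where "P n h \<longleftrightarrow> h \<in> mod_hom R (?F n) (?F (Suc n)) \<and>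
      (\<forall>x\<in>carrier (?F (Suc n)). d n (h (d n x)) = e n (d n x) \<ominus>\<^bsub>?F n\<^esub> d n x) \<and>
      (n = 0 \<longrightarrow> (\<forall>x\<in>carrier (?F 0). d 0 (h x) = e 0 x \<ominus>\<^bsub>?F 0\<^esub> x))" for n h
  define Q where "Q n h h' \<longleftrightarrow> (\<forall>x\<in>carrier (?F (Suc n)).
      d (Suc n) (h' x) = e (Suc n) x \<ominus>\<^bsub>?F (Suc n)\<^esub> x \<ominus>\<^bsub>?F (Suc n)\<^esub> h (d n x))" for n h h'
  have "\<exists>h. P 0 h"
  proof -
    let ?u = "\<lambda>x. e 0 x \<ominus>\<^bsub>?F 0\<^esub> x"
    have u: "?u \<in> mod_hom R (?F 0) (?F 0)" by (rule F.mod_hom_diff[OF m e(1) id])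
    have "?u x \<in> d 0 ` carrier (?F (Suc 0))" if "x \<in> carrier (?F 0)" for x
      unfolding G(4) using that mod_hom_closed[OF e(1)] mod_hom_closed[OF G(1)]
      by (simp add: mod_hom_minus[OF m module_axioms G(1)] e(2) M.minus_eq M.r_neg F.minus_closed)
    from free_mod_lift[OF m m G(2) u this]
    obtain w where w: "w \<in> mod_hom R (?F 0) (?F (Suc 0))"
      "\<And>x. x \<in> carrier (?F 0) \<Longrightarrow> d 0 (w x) = ?u x" by blast
    show ?thesis unfolding P_def using w mod_hom_closed[OF G(2)] by blast
  qed
  moreover have "\<exists>h'. P (Suc n) h' \<and> Q n h h'" if "P n h" for n h
  proof -
    have h: "h \<in> mod_hom R (?F n) (?F (Suc n))"
      and hd: "\<And>x. x \<in> carrier (?F (Suc n)) \<Longrightarrow> d n (h (d n x)) = e n (d n x) \<ominus>\<^bsub>?F n\<^esub> d n x"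
      using that by (auto simp: P_def)
    let ?u = "\<lambda>x. e (Suc n) x \<ominus>\<^bsub>?F (Suc n)\<^esub> x \<ominus>\<^bsub>?F (Suc n)\<^esub> h (d n x)"
    have u: "?u \<in> mod_hom R (?F (Suc n)) (?F (Suc n))"
      by (intro F.mod_hom_diff m e(1) id mod_hom_compose[OF G(2) h])
    have "?u x \<in> d (Suc n) ` carrier (?F (Suc (Suc n)))" if x: "x \<in> carrier (?F (Suc n))" for x
    proof -
      have c: "e (Suc n) x \<in> carrier (?F (Suc n))" "d n x \<in> carrier (?F n)" "h (d n x) \<in> carrier (?F (Suc n))"
        "e n (d n x) \<in> carrier (?F n)"
        using x mod_hom_closed[OF G(2)] mod_hom_closed[OF e(1)] mod_hom_closed[OF h] by auto
      have "d n (?u x) = (e n (d n x) \<ominus>\<^bsub>?F n\<^esub> d n x) \<ominus>\<^bsub>?F n\<^esub> (e n (d n x) \<ominus>\<^bsub>?F n\<^esub> d n x)"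
        using c x by (simp add: mod_hom_minus[OF m m G(2)] F.minus_closed e(3) hd)
      also have "\<dots> = \<zero>\<^bsub>?F n\<^esub>" using c by (simp add: F.minus_closed F.minus_eq_zero_iff)
      finally show ?thesis unfolding G(5) using c x by (simp add: F.minus_closed)
    qed
    from free_mod_lift[OF m m G(2) u this]
    obtain w where w: "w \<in> mod_hom R (?F (Suc n)) (?F (Suc (Suc n)))"
      "\<And>x. x \<in> carrier (?F (Suc n)) \<Longrightarrow> d (Suc n) (w x) = ?u x" by blast
    have "d (Suc n) (w (d (Suc n) x)) = e (Suc n) (d (Suc n) x) \<ominus>\<^bsub>?F (Suc n)\<^esub> d (Suc n) x"
      if x: "x \<in> carrier (?F (Suc (Suc n)))" for x
    proof -
      have y: "d (Suc n) x \<in> {f \<in> carrier (?F (Suc n)). d n f = \<zero>\<^bsub>?F n\<^esub>}"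
        using x unfolding G(5)[symmetric] by blast
      have "e (Suc n) (d (Suc n) x) \<in> carrier (?F (Suc n))" using y mod_hom_closed[OF e(1)] by auto
      with y show ?thesis using mod_hom_zero[OF m m h] by (simp add: w(2) F.minus_eq)
    qed
    thus ?thesis unfolding P_def Q_def using w by blast
  qed
  ultimately obtain h where h: "\<And>n. P n (h n)" "\<And>n. Q n (h n) (h (Suc n))"
    using dependent_nat_choice[of P Q] by blast
  show ?thesis by (rule that[of h]) (use h in \<open>simp_all add: P_def Q_def\<close>)
qed

section \<open>Cocycles, coboundaries and the nonvanishing of Ext\<close>

lemma Hom_mod_sel:
  "f \<in> carrier (Hom_mod R M N) \<longleftrightarrow> f \<in> mod_hom R M N \<and> f \<in> extensional (carrier M)"
  "\<zero>\<^bsub>Hom_mod R M N\<^esub> = (\<lambda>x\<in>carrier M. \<zero>\<^bsub>N\<^esub>)"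
  "f \<oplus>\<^bsub>Hom_mod R M N\<^esub> g = (\<lambda>x\<in>carrier M. f x \<oplus>\<^bsub>N\<^esub> g x)"
  by (simp_all add: Hom_mod_def)

lemma mem_cocycles_iff:
  "\<phi> \<in> cocycles R S d N i \<longleftrightarrow> \<phi> \<in> mod_hom R (free_mod R (S i)) N \<and> \<phi> \<in> extensional (carrier (free_mod R (S i)))
     \<and> (\<forall>x\<in>carrier (free_mod R (S (Suc i))). \<phi> (d i x) = \<zero>\<^bsub>N\<^esub>)"
  unfolding cocycles_def Hom_mod_sel(2) mem_Collect_eq Hom_mod_sel(1) compose_def
  by (auto simp: restrict_def fun_eq_iff)

lemma mem_coboundaries_0_iff:
  "\<phi> \<in> coboundaries R S d N 0 \<longleftrightarrow> \<phi> \<in> extensional (carrier (free_mod R (S 0)))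
     \<and> (\<forall>x\<in>carrier (free_mod R (S 0)). \<phi> x = \<zero>\<^bsub>N\<^esub>)"
  by (auto simp: Hom_mod_sel extensional_def fun_eq_iff)

lemma (in module) restrict_mod_hom:
  "h \<in> mod_hom R M N \<Longrightarrow> restrict h (carrier M) \<in> mod_hom R M N"
  by (erule mod_hom_cong) simp

lemma mem_coboundaries_Suc_iff:
  assumes "cring R" "d i \<in> mod_hom R (free_mod R (S (Suc i))) (free_mod R (S i))"
  shows "\<phi> \<in> coboundaries R S d N (Suc i) \<longleftrightarrow> \<phi> \<in> extensional (carrier (free_mod R (S (Suc i))))
     \<and> (\<exists>\<psi>\<in>mod_hom R (free_mod R (S i)) N. \<forall>x\<in>carrier (free_mod R (S (Suc i))). \<phi> x = \<psi> (d i x))"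
    (is "?l \<longleftrightarrow> ?r")
proof
  interpret R: cring R by fact
  interpret F: module R "free_mod R (S i)" by (rule R.free_mod_module)
  assume ?r
  then obtain \<psi> where p: "\<phi> \<in> extensional (carrier (free_mod R (S (Suc i))))"
    "\<psi> \<in> mod_hom R (free_mod R (S i)) N" "\<And>x. x \<in> carrier (free_mod R (S (Suc i))) \<Longrightarrow> \<phi> x = \<psi> (d i x)" by blast
  let ?p = "restrict \<psi> (carrier (free_mod R (S i)))"
  have "?p \<in> carrier (Hom_mod R (free_mod R (S i)) N)"
    using p(2) F.restrict_mod_hom by (simp add: Hom_mod_sel)
  moreover have "\<phi> = compose (carrier (free_mod R (S (Suc i)))) ?p (d i)"
    by (rule extensionalityI[OF p(1)]) (auto simp: compose_def p(3) mod_hom_closed[OF assms(2)])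
  ultimately show ?l by auto
qed (auto simp: compose_def Hom_mod_sel)

text \<open>With comparison maps f, g and a homotopy h between f g and the identity, a cocycle
  \<phi> satisfies 0 = \<phi> d' h = \<phi> f g - \<phi> - \<phi> h d'. If \<phi> f = \<psi> d, then
  \<phi> = (\<psi> g - \<phi> h) d'.\<close>

lemma (in module) cohomology_vanishing_transfer:
  assumes F: "free_resolution R M S \<epsilon> d" and G: "free_resolution R M S' \<epsilon>' d'" and N: "module R N"
    and van: "cocycles R S d N i \<subseteq> coboundaries R S d N i"
  shows "cocycles R S' d' N i \<subseteq> coboundaries R S' d' N i"
proof
  fix \<phi> assume "\<phi> \<in> cocycles R S' d' N i"
  hence phi: "\<phi> \<in> mod_hom R (free_mod R (S' i)) N" "\<phi> \<in> extensional (carrier (free_mod R (S' i)))"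
    "\<And>x. x \<in> carrier (free_mod R (S' (Suc i))) \<Longrightarrow> \<phi> (d' i x) = \<zero>\<^bsub>N\<^esub>"
    by (auto simp: mem_cocycles_iff)
  interpret N: module R N by fact
  note m = R.free_mod_module
  let ?F = "\<lambda>n. free_mod R (S n)" and ?G = "\<lambda>n. free_mod R (S' n)"
  interpret F: module R "?F n" for n by (rule m)
  interpret G: module R "?G n" for n by (rule m)
  obtain f where f: "\<And>n. f n \<in> mod_hom R (?F n) (?G n)"
    "\<And>x. x \<in> carrier (?F 0) \<Longrightarrow> \<epsilon>' (f 0 x) = \<epsilon> x"
    "\<And>n x. x \<in> carrier (?F (Suc n)) \<Longrightarrow> d' n (f (Suc n) x) = f n (d n x)"
    by (rule ex_chain_map[OF F G]) blast
  obtain g where g: "\<And>n. g n \<in> mod_hom R (?G n) (?F n)"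
    "\<And>x. x \<in> carrier (?G 0) \<Longrightarrow> \<epsilon> (g 0 x) = \<epsilon>' x"
    "\<And>n x. x \<in> carrier (?G (Suc n)) \<Longrightarrow> d n (g (Suc n) x) = g n (d' n x)"
    by (rule ex_chain_map[OF G F]) blast
  note fc = mod_hom_closed[OF f(1)] and gc = mod_hom_closed[OF g(1)]
  note F = free_resolutionD[OF F]
  note G' = free_resolutionD[OF G]
  note dc = mod_hom_closed[OF F(2)] and dc' = mod_hom_closed[OF G'(2)]
  obtain h where h: "\<And>n. h n \<in> mod_hom R (?G n) (?G (Suc n))"
    "\<And>x. x \<in> carrier (?G 0) \<Longrightarrow> d' 0 (h 0 x) = f 0 (g 0 x) \<ominus>\<^bsub>?G 0\<^esub> x"
    "\<And>n x. x \<in> carrier (?G (Suc n)) \<Longrightarrow>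
      d' (Suc n) (h (Suc n) x) = f (Suc n) (g (Suc n) x) \<ominus>\<^bsub>?G (Suc n)\<^esub> x \<ominus>\<^bsub>?G (Suc n)\<^esub> h n (d' n x)"
    by (rule ex_homotopy[OF G, of "\<lambda>n x. f n (g n x)"])
      (auto simp: f g fc gc dc dc' intro: mod_hom_compose[OF g(1) f(1)])
  note hc = mod_hom_closed[OF h(1)]
  have pc: "\<phi> x \<in> carrier N" if "x \<in> carrier (?G i)" for x using mod_hom_closed[OF phi(1) that] .
  let ?p = "restrict (\<lambda>x. \<phi> (f i x)) (carrier (?F i))"
  have "?p \<in> cocycles R S d N i"
    using phi f fc dc unfolding mem_cocycles_iff
    by (auto simp: f(3)[symmetric] intro!: F.restrict_mod_hom mod_hom_compose[OF f(1) phi(1)])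
  hence p: "?p \<in> coboundaries R S d N i" using van by blast
  show "\<phi> \<in> coboundaries R S' d' N i"
  proof (cases i)
    \<comment> \<open>In degree 0 only the zero map is a coboundary, so \<phi> f = 0, and the term
      with h d' is absent: \<phi> = \<phi> f g = 0.\<close>
    case 0
    have "\<phi> x = \<zero>\<^bsub>N\<^esub>" if x: "x \<in> carrier (?G 0)" for x
    proof -
      have "\<phi> (f 0 (g 0 x)) = \<zero>\<^bsub>N\<^esub>" using p gc x unfolding 0 mem_coboundaries_0_iff by auto
      moreover have "\<phi> (d' 0 (h 0 x)) = \<zero>\<^bsub>N\<^esub>" using phi(3) hc x 0 by auto
      moreover have "\<phi> (d' 0 (h 0 x)) = \<phi> (f 0 (g 0 x)) \<ominus>\<^bsub>N\<^esub> \<phi> x"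
        unfolding h(2)[OF x] using x fc gc phi(1) 0 by (intro mod_hom_minus[OF m N]) auto
      ultimately show ?thesis using pc[of x] x 0 by (simp add: N.minus_eq)
    qed
    thus ?thesis using phi(2) 0 unfolding 0 mem_coboundaries_0_iff by simp
  next
    case (Suc j)
    from p[unfolded Suc mem_coboundaries_Suc_iff[where S = S and d = d and i = j, OF R.is_cring F(2)]] obtain \<psi> where
      psi: "\<psi> \<in> mod_hom R (?F j) N" "\<And>x. x \<in> carrier (?F (Suc j)) \<Longrightarrow> \<phi> (f (Suc j) x) = \<psi> (d j x)"
      by auto
    let ?c = "\<lambda>x. \<psi> (g j x) \<ominus>\<^bsub>N\<^esub> \<phi> (h j x)"
    have phi1: "\<phi> \<in> mod_hom R (?G (Suc j)) N" using phi(1) Suc by simp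
    have c: "?c \<in> mod_hom R (?G j) N"
      by (intro G.mod_hom_diff N mod_hom_compose[OF g(1) psi(1)] mod_hom_compose[OF h(1) phi1])
    have "\<phi> x = ?c (d' j x)" if x: "x \<in> carrier (?G (Suc j))" for x
    proof -
      have 1: "\<phi> (d' (Suc j) (h (Suc j) x)) = \<zero>\<^bsub>N\<^esub>" using phi(3) hc x Suc by auto
      have "\<phi> (d' (Suc j) (h (Suc j) x)) = \<phi> (f (Suc j) (g (Suc j) x)) \<ominus>\<^bsub>N\<^esub> \<phi> x \<ominus>\<^bsub>N\<^esub> \<phi> (h j (d' j x))"
        unfolding h(3)[OF x] using x fc gc hc dc' by (simp add: mod_hom_minus[OF m N phi1] G.minus_closed)
      also have "\<phi> (f (Suc j) (g (Suc j) x)) = \<psi> (g j (d' j x))" using psi(2) gc x g(3) by simp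
      finally have 2: "\<zero>\<^bsub>N\<^esub> = \<psi> (g j (d' j x)) \<ominus>\<^bsub>N\<^esub> \<phi> x \<ominus>\<^bsub>N\<^esub> \<phi> (h j (d' j x))" using 1 by simp
      have 3: "a = b \<ominus>\<^bsub>N\<^esub> c" if "\<zero>\<^bsub>N\<^esub> = b \<ominus>\<^bsub>N\<^esub> a \<ominus>\<^bsub>N\<^esub> c"
        "a \<in> carrier N" "b \<in> carrier N" "c \<in> carrier N" for a b c
      proof -
        have "b \<ominus>\<^bsub>N\<^esub> a \<ominus>\<^bsub>N\<^esub> c = (b \<ominus>\<^bsub>N\<^esub> c) \<ominus>\<^bsub>N\<^esub> a" using that(2-) by (simp add: N.minus_eq N.a_ac)
        thus ?thesis using that N.minus_eq_zero_iff[of "b \<ominus>\<^bsub>N\<^esub> c" a] by (metis N.minus_closed)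
      qed
      show ?thesis
        by (rule 3[OF 2]) (use x Suc pc gc hc dc' mod_hom_closed[OF psi(1)] mod_hom_closed[OF phi1] in auto)
    qed
    hence "\<forall>x\<in>carrier (?G (Suc j)). \<phi> x = ?c (d' j x)" by blast
    thus ?thesis using phi(2) bexI[where P = "\<lambda>\<psi>. \<forall>x\<in>carrier (?G (Suc j)). \<phi> x = \<psi> (d' j x)", OF _ c] unfolding Suc mem_coboundaries_Suc_iff[where S = S' and d = d' and i = j, OF R.is_cring G'(2)] by blast
  qed
qed

lemma (in module) Hom_mod_abelian_group:
  assumes "module R N"
  shows "abelian_group (Hom_mod R M N)"
proof -
  interpret N: module R N by fact
  show ?thesis
  proof (rule abelian_groupI)
    fix f g assume "f \<in> carrier (Hom_mod R M N)" "g \<in> carrier (Hom_mod R M N)"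
    thus "f \<oplus>\<^bsub>Hom_mod R M N\<^esub> g \<in> carrier (Hom_mod R M N)"
      by (auto simp: Hom_mod_sel mod_hom_def Pi_iff N.a_ac N.smult_r_distr)
  next
    fix f assume f: "f \<in> carrier (Hom_mod R M N)"
    have "restrict (\<lambda>x. \<zero>\<^bsub>N\<^esub> \<ominus>\<^bsub>N\<^esub> f x) (carrier M) \<in> mod_hom R M N"
      using f by (intro restrict_mod_hom mod_hom_diff assms) (auto simp: Hom_mod_sel mod_hom_def)
    moreover have "restrict (\<lambda>x. \<zero>\<^bsub>N\<^esub> \<ominus>\<^bsub>N\<^esub> f x) (carrier M) \<oplus>\<^bsub>Hom_mod R M N\<^esub> f = \<zero>\<^bsub>Hom_mod R M N\<^esub>"
      using f mod_hom_closed[of f R M N] by (auto simp: Hom_mod_sel fun_eq_iff N.minus_eq N.l_neg)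
    ultimately show "\<exists>g\<in>carrier (Hom_mod R M N). g \<oplus>\<^bsub>Hom_mod R M N\<^esub> f = \<zero>\<^bsub>Hom_mod R M N\<^esub>"
      by (auto simp: Hom_mod_sel(1))
  qed (auto simp: Hom_mod_sel mod_hom_def Pi_iff N.a_ac fun_eq_iff extensional_def)
qed

lemma image_eq_singleton_iff: "A \<noteq> {} \<Longrightarrow> f ` A = {k} \<longleftrightarrow> (\<forall>z\<in>A. f z = k)"
  by auto

text \<open>The elements are cosets of the coboundaries and the zero is the set of coboundaries
  itself. As coboundaries form a subgroup, a coset is zero exactly when its representative is a
  coboundary.\<close>

lemma hom_cohomology_nonzero_iff:
  assumes R: "cring R" and N: "module R N"
    and d: "\<And>n. d n \<in> mod_hom R (free_mod R (S (Suc n))) (free_mod R (S n))"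
  shows "carrier (hom_cohomology R S d N i) \<noteq> {\<zero>\<^bsub>hom_cohomology R S d N i\<^esub>}
    \<longleftrightarrow> \<not> cocycles R S d N i \<subseteq> coboundaries R S d N i"
proof -
  interpret R: cring R by fact
  interpret N: module R N by fact
  let ?H = "Hom_mod R (free_mod R (S i)) N" and ?Z = "cocycles R S d N i" and ?K = "coboundaries R S d N i"
  have m: "module R (free_mod R (S n))" for n by (rule R.free_mod_module)
  interpret F: module R "free_mod R (S n)" for n by (rule m)
  interpret H: abelian_group ?H by (rule F.Hom_mod_abelian_group[OF N])
  have Z: "?Z \<subseteq> carrier ?H" by (auto simp: cocycles_def)
  have H0: "\<zero>\<^bsub>?H\<^esub> \<in> ?Z"
    using H.zero_closed mod_hom_closed[OF d] unfolding mem_cocycles_iff Hom_mod_sel(1)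
    by (simp add: Hom_mod_sel(2))
  have K: "\<zero>\<^bsub>?H\<^esub> \<in> ?K \<and> ?K \<subseteq> carrier ?H \<and> (\<forall>x\<in>?K. \<forall>y\<in>?K. x \<ominus>\<^bsub>?H\<^esub> y \<in> ?K)"
  proof (cases i)
    case 0
    thus ?thesis using H.zero_closed H.minus_eq_zero_iff[OF H.zero_closed H.zero_closed] by simp
  next
    case (Suc j)
    interpret J: abelian_group "Hom_mod R (free_mod R (S j)) N" by (rule F.Hom_mod_abelian_group[OF N])
    let ?J = "Hom_mod R (free_mod R (S j)) N"
    let ?c = "\<lambda>\<phi>. compose (carrier (free_mod R (S (Suc j)))) \<phi> (d j)"
    have cl: "?c \<phi> \<in> carrier ?H" if "\<phi> \<in> carrier ?J" for \<phi>
      using that F.restrict_mod_hom[OF mod_hom_compose[OF d], of \<phi> j N]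
      by (simp add: Hom_mod_sel compose_def Suc)
    have ad: "?c (\<phi> \<oplus>\<^bsub>?J\<^esub> \<psi>) = ?c \<phi> \<oplus>\<^bsub>?H\<^esub> ?c \<psi>" for \<phi> \<psi>
      using mod_hom_closed[OF d[of j]] by (auto simp: Hom_mod_sel compose_def Suc fun_eq_iff)
    interpret c: abelian_group_hom ?J ?H ?c
      by (intro abelian_group_homI group_hom.intro group_hom_axioms.intro homI J.a_group H.a_group)
        (auto simp: cl ad intro: J.abelian_group_axioms H.abelian_group_axioms)
    have ze: "?c \<zero>\<^bsub>?J\<^esub> = \<zero>\<^bsub>?H\<^esub>" by (rule c.hom_zero)
    have mi: "?c (\<phi> \<ominus>\<^bsub>?J\<^esub> \<psi>) = ?c \<phi> \<ominus>\<^bsub>?H\<^esub> ?c \<psi>" if "\<phi> \<in> carrier ?J" "\<psi> \<in> carrier ?J" for \<phi> \<psi>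
      using that by (simp add: a_minus_def ad)
    have K: "?K = ?c ` carrier ?J" using Suc by simp
    show ?thesis unfolding K
    proof (intro conjI ballI)
      show "\<zero>\<^bsub>?H\<^esub> \<in> ?c ` carrier ?J" by (rule image_eqI[where f = ?c and x = "\<zero>\<^bsub>?J\<^esub>"]) (simp_all add: ze)
      show "?c ` carrier ?J \<subseteq> carrier ?H" using cl by (rule image_subsetI)
    next
      fix x y assume "x \<in> ?c ` carrier ?J" "y \<in> ?c ` carrier ?J"
      then obtain \<phi> \<psi> where "\<phi> \<in> carrier ?J" "x = ?c \<phi>" "\<psi> \<in> carrier ?J" "y = ?c \<psi>" by (elim imageE)
      thus "x \<ominus>\<^bsub>?H\<^esub> y \<in> ?c ` carrier ?J"
        using mi J.minus_closed by (intro image_eqI[where f = ?c and x = "\<phi> \<ominus>\<^bsub>?J\<^esub> \<psi>"]) simp_all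
    qed
  qed
  have Kadd: "x \<oplus>\<^bsub>?H\<^esub> y \<in> ?K" if "x \<in> ?K" "y \<in> ?K" for x y
  proof -
    have "\<zero>\<^bsub>?H\<^esub> \<ominus>\<^bsub>?H\<^esub> y \<in> ?K" using K that by blast
    hence "x \<ominus>\<^bsub>?H\<^esub> (\<zero>\<^bsub>?H\<^esub> \<ominus>\<^bsub>?H\<^esub> y) \<in> ?K" using K that by blast
    thus ?thesis using that K by (simp add: H.minus_eq subset_iff)
  qed
  have coset: "?K +>\<^bsub>?H\<^esub> z = ?K \<longleftrightarrow> z \<in> ?K" if "z \<in> ?Z" for z
  proof
    have zc: "z \<in> carrier ?H" using that Z by blast
    assume "?K +>\<^bsub>?H\<^esub> z = ?K"
    moreover have "\<zero>\<^bsub>?H\<^esub> \<oplus>\<^bsub>?H\<^esub> z \<in> ?K +>\<^bsub>?H\<^esub> z" using K by (auto simp: a_r_coset_def')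
    ultimately show "z \<in> ?K" using zc by simp
  next
    assume z: "z \<in> ?K"
    show "?K +>\<^bsub>?H\<^esub> z = ?K"
    proof (intro equalityI subsetI)
      fix x assume "x \<in> ?K +>\<^bsub>?H\<^esub> z" thus "x \<in> ?K" using Kadd z by (auto simp: a_r_coset_def')
    next
      fix x assume x: "x \<in> ?K"
      have "x = (x \<ominus>\<^bsub>?H\<^esub> z) \<oplus>\<^bsub>?H\<^esub> z" using x z K by (simp add: subset_iff H.minus_eq H.a_assoc H.l_neg)
      thus "x \<in> ?K +>\<^bsub>?H\<^esub> z" using K x z by (auto simp: a_r_coset_def')
    qed
  qed
  \<comment> \<open>Cosets use addition only, so shrinking the carrier to the cocycles leaves them
    unchanged.\<close>
  have cr: "?K +>\<^bsub>?H\<lparr>carrier := ?Z\<rparr>\<^esub> z = ?K +>\<^bsub>?H\<^esub> z" for z by (simp add: a_r_coset_def')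
  have c1: "carrier (hom_cohomology R S d N i) = (\<lambda>z. ?K +>\<^bsub>?H\<^esub> z) ` ?Z"
    by (auto simp: hom_cohomology_def quot_mod_def A_RCOSETS_def' cr)
  have c2: "\<zero>\<^bsub>hom_cohomology R S d N i\<^esub> = ?K" by (simp add: hom_cohomology_def quot_mod_def)
  have "?Z \<noteq> {}" using H0 by blast
  note c3 = image_eq_singleton_iff[OF this, of "\<lambda>z. ?K +>\<^bsub>?H\<^esub> z" ?K]
  show ?thesis unfolding c1 c2 c3 using coset by blast
qed

text \<open>Vanishing passes both ways between the standard resolution and the given one, so any
  convenient resolution decides.\<close>

theorem Ext_nonzero_iff:
  assumes M: "module R M" and N: "module R N" and F: "free_resolution R M S \<epsilon> d"
  shows "carrier (Ext R i M N) \<noteq> {\<zero>\<^bsub>Ext R i M N\<^esub>} \<longleftrightarrow> \<not> cocycles R S d N i \<subseteq> coboundaries R S d N i"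
proof -
  interpret M: module R M by fact
  note G = M.std_free_resolution
  show ?thesis
    unfolding Ext_def hom_cohomology_nonzero_iff[where S = "std_basis R M" and d = "\<lambda>_. std_boundary R",
        OF M.R.is_cring N free_resolutionD(2)[OF G]]
    using M.cohomology_vanishing_transfer[OF F G N] M.cohomology_vanishing_transfer[OF G F N] by blast
qed

section \<open>Resolutions by two-by-two matrices\<close>

declare One_nat_def [simp del]

definition mat2 :: "('r, 'x) ring_scheme \<Rightarrow> 'r \<Rightarrow> 'r \<Rightarrow> 'r \<Rightarrow> 'r \<Rightarrow> (nat \<Rightarrow> 'r) \<Rightarrow> nat \<Rightarrow> 'r" where
  "mat2 R p q r s v = (\<lambda>i.
     if i = 1 then p \<otimes>\<^bsub>R\<^esub> v 1 \<oplus>\<^bsub>R\<^esub> q \<otimes>\<^bsub>R\<^esub> v 2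
     else if i = 2 then r \<otimes>\<^bsub>R\<^esub> v 1 \<oplus>\<^bsub>R\<^esub> s \<otimes>\<^bsub>R\<^esub> v 2
     else \<zero>\<^bsub>R\<^esub>)"

abbreviation free2 :: "('r, 'x) ring_scheme \<Rightarrow> ('r, nat \<Rightarrow> 'r) module" where
  "free2 R \<equiv> free_mod R {1, 2}"

lemma mem_free2_iff:
  "f \<in> carrier (free2 R) \<longleftrightarrow>
     f 1 \<in> carrier R \<and> f 2 \<in> carrier R \<and> (\<forall>x. x \<noteq> 1 \<and> x \<noteq> 2 \<longrightarrow> f x = \<zero>\<^bsub>R\<^esub>)"
proof -
  have "finite {x. f x \<noteq> \<zero>\<^bsub>R\<^esub>}" if "\<forall>x. x \<noteq> 1 \<and> x \<noteq> 2 \<longrightarrow> f x = \<zero>\<^bsub>R\<^esub>"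
    by (rule finite_subset[of _ "{1, 2}"]) (use that in auto)
  thus ?thesis unfolding free_mod_sel(4) by blast
qed

lemma free2_eqI:
  assumes "f \<in> carrier (free2 R)" "g \<in> carrier (free2 R)" "f 1 = g 1" "f 2 = g 2"
  shows "f = g"
proof
  fix x show "f x = g x" using assms unfolding mem_free2_iff by (cases "x = 1 \<or> x = 2") auto
qed

lemma (in cring) mat2_hom:
  assumes "p \<in> carrier R" "q \<in> carrier R" "r \<in> carrier R" "s \<in> carrier R"
  shows "mat2 R p q r s \<in> mod_hom R (free2 R) (free2 R)"
  unfolding mod_hom_def
proof (intro CollectI conjI funcsetI ballI)
  fix v assume "v \<in> carrier (free2 R)"
  thus "mat2 R p q r s v \<in> carrier (free2 R)"
    using assms unfolding mem_free2_iff mat2_def by (simp)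
next
  fix v w assume "v \<in> carrier (free2 R)" "w \<in> carrier (free2 R)"
  thus "mat2 R p q r s (v \<oplus>\<^bsub>free2 R\<^esub> w) = mat2 R p q r s v \<oplus>\<^bsub>free2 R\<^esub> mat2 R p q r s w"
    using assms unfolding mem_free2_iff mat2_def free_mod_sel
    by (auto simp: fun_eq_iff r_distr a_ac)
next
  fix c v assume "c \<in> carrier R" "v \<in> carrier (free2 R)"
  thus "mat2 R p q r s (c \<odot>\<^bsub>free2 R\<^esub> v) = c \<odot>\<^bsub>free2 R\<^esub> mat2 R p q r s v"
    using assms unfolding mem_free2_iff mat2_def free_mod_sel
    by (auto simp: fun_eq_iff r_distr m_ac)
qed

text \<open>The relations are those that make consecutive matrices multiply to zero; A and B are
  both instances.\<close>

locale twisted_matrices = cring R for R (structure) +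
  fixes x1 x2 x3 x4 a
  assumes closed [simp]: "x1 \<in> carrier R" "x2 \<in> carrier R" "x3 \<in> carrier R" "x4 \<in> carrier R" "a \<in> carrier R"
    and rels: "a \<otimes> x1 \<otimes> x3 \<oplus> x2 \<otimes> x3 = \<zero>" "x1 \<otimes> x4 \<oplus> x2 \<otimes> x4 = \<zero>"
      "x1 \<otimes> x1 = \<zero>" "x2 \<otimes> x2 = \<zero>" "x3 \<otimes> x4 = \<zero>"
begin

definition D :: "nat \<Rightarrow> (nat \<Rightarrow> 'a) \<Rightarrow> nat \<Rightarrow> 'a" where
  "D i = mat2 R x1 (a [^] i \<otimes> x3) x4 x2"

lemma D_hom: "D i \<in> mod_hom R (free2 R) (free2 R)"
  unfolding D_def by (rule mat2_hom) auto

text \<open>The upper right entry of the product is a^i (a x1 x3 + x2 x3): one more power of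
  \<open>a\<close> in the second matrix is what the first relation asks for. The other entries
  vanish by the remaining four relations.\<close>

lemma D_D:
  assumes "w \<in> carrier (free2 R)"
  shows "D i (D (Suc i) w) = \<zero>\<^bsub>free2 R\<^esub>"
proof (rule free2_eqI)
  interpret F: module R "free2 R" by (rule free_mod_module)
  show "D i (D (Suc i) w) \<in> carrier (free2 R)" "\<zero>\<^bsub>free2 R\<^esub> \<in> carrier (free2 R)"
    using mod_hom_closed[OF D_hom] assms F.zero_closed by auto
  define b where "b = a [^] i"
  have b: "b \<in> carrier R" by (simp add: b_def)
  have w: "w 1 \<in> carrier R" "w 2 \<in> carrier R" using assms mem_free2_iff by blast+
  have "x1 \<otimes> (x1 \<otimes> w 1 \<oplus> b \<otimes> a \<otimes> x3 \<otimes> w 2) \<oplus> b \<otimes> x3 \<otimes> (x4 \<otimes> w 1 \<oplus> x2 \<otimes> w 2)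
      = (x1 \<otimes> x1) \<otimes> w 1 \<oplus> b \<otimes> (x3 \<otimes> x4) \<otimes> w 1 \<oplus> b \<otimes> (a \<otimes> x1 \<otimes> x3 \<oplus> x2 \<otimes> x3) \<otimes> w 2"
    using w b closed by algebra
  also have "\<dots> = \<zero>" using w b by (simp add: rels)
  finally show "D i (D (Suc i) w) 1 = \<zero>\<^bsub>free2 R\<^esub> 1"
    by (simp add: D_def mat2_def b_def free_mod_sel)
  have "x4 \<otimes> (x1 \<otimes> w 1 \<oplus> b \<otimes> a \<otimes> x3 \<otimes> w 2) \<oplus> x2 \<otimes> (x4 \<otimes> w 1 \<oplus> x2 \<otimes> w 2)
      = (x1 \<otimes> x4 \<oplus> x2 \<otimes> x4) \<otimes> w 1 \<oplus> b \<otimes> a \<otimes> (x3 \<otimes> x4) \<otimes> w 2 \<oplus> (x2 \<otimes> x2) \<otimes> w 2"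
    using w b closed by algebra
  also have "\<dots> = \<zero>" using w b by (simp add: rels)
  finally show "D i (D (Suc i) w) 2 = \<zero>\<^bsub>free2 R\<^esub> 2"
    by (simp add: D_def mat2_def b_def free_mod_sel)
qed

end

locale exact_twisted_matrices = twisted_matrices +
  assumes exact: "v \<in> carrier (free2 R) \<Longrightarrow> D i v = \<zero>\<^bsub>free2 R\<^esub> \<Longrightarrow> \<exists>w\<in>carrier (free2 R). v = D (Suc i) w"
begin

lemma D_image: "D (Suc i) ` carrier (free2 R) = {v \<in> carrier (free2 R). D i v = \<zero>\<^bsub>free2 R\<^esub>}"
  using exact D_D mod_hom_closed[OF D_hom] by blast

text \<open>The augmentation has the kernel of \<open>D 0\<close>, which is the image of
  \<open>D (Suc 0)\<close>; hence the shift in the differentials.\<close>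

lemma resolution:
  assumes "\<epsilon> \<in> mod_hom R (free2 R) M" "\<epsilon> ` carrier (free2 R) = carrier M"
    "\<And>v. v \<in> carrier (free2 R) \<Longrightarrow> \<epsilon> v = \<zero>\<^bsub>M\<^esub> \<longleftrightarrow> D 0 v = \<zero>\<^bsub>free2 R\<^esub>"
  shows "free_resolution R M (\<lambda>_. {1, 2}) \<epsilon> (\<lambda>i. D (Suc i))"
  unfolding free_resolution_def using assms D_hom D_image by auto

end

text \<open>\<open>N\<close> stands for \<open>k[x]/(x\<^sup>2)\<close>, with \<open>\<tau>\<close> reading off the coefficients of \<open>1\<close> and \<open>x\<close>;
  \<open>x\<^sub>1\<close>, \<open>x\<^sub>2\<close>, \<open>x\<^sub>4\<close> act as \<open>x\<close>, and \<open>a\<^sup>i x\<^sub>3\<close> as \<open>c\<^sub>i x\<close>.\<close>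

locale dual_number_module = twisted_matrices R x1 x2 x3 x4 a + N: module R N
  for R :: "('a, 'x) ring_scheme" (structure) and N :: "('a, 'n, 'y) module_scheme" (structure) and x1 x2 x3 x4 a +
  fixes \<tau> :: "'n \<Rightarrow> 'k::field \<times> 'k" and c :: "nat \<Rightarrow> 'k"
  assumes \<tau>_bij: "bij_betw \<tau> (carrier N) UNIV"
    and \<tau>_add: "\<And>x y. x \<in> carrier N \<Longrightarrow> y \<in> carrier N \<Longrightarrow>
      \<tau> (x \<oplus>\<^bsub>N\<^esub> y) = (fst (\<tau> x) + fst (\<tau> y), snd (\<tau> x) + snd (\<tau> y))"
    and \<tau>_x: "\<And>x. x \<in> carrier N \<Longrightarrow> \<tau> (x1 \<odot>\<^bsub>N\<^esub> x) = (0, fst (\<tau> x))"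
      "\<And>x. x \<in> carrier N \<Longrightarrow> \<tau> (x2 \<odot>\<^bsub>N\<^esub> x) = (0, fst (\<tau> x))"
      "\<And>x. x \<in> carrier N \<Longrightarrow> \<tau> (x4 \<odot>\<^bsub>N\<^esub> x) = (0, fst (\<tau> x))"
      "\<And>i x. x \<in> carrier N \<Longrightarrow> \<tau> ((a [^] i \<otimes> x3) \<odot>\<^bsub>N\<^esub> x) = (0, c i * fst (\<tau> x))"
begin

lemma \<tau>_zero [simp]: "\<tau> \<zero>\<^bsub>N\<^esub> = (0, 0)"
  using \<tau>_add[of "\<zero>\<^bsub>N\<^esub>" "\<zero>\<^bsub>N\<^esub>"] by (metis N.zero_closed N.l_zero add_cancel_left_left fst_conv prod.collapse snd_conv)

text \<open>The simplifier splits \<open>a [^] Suc i\<close> into a product, so the action is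
  recorded in that form too.\<close>

lemma \<tau>_pow_Suc: "x \<in> carrier N \<Longrightarrow> \<tau> ((a [^] i \<otimes> a \<otimes> x3) \<odot>\<^bsub>N\<^esub> x) = (0, c (Suc i) * fst (\<tau> x))"
  using \<tau>_x(4)[of x "Suc i"] by simp

lemma \<tau>_eq_iff: "x \<in> carrier N \<Longrightarrow> y \<in> carrier N \<Longrightarrow> x = y \<longleftrightarrow> \<tau> x = \<tau> y"
  using \<tau>_bij by (auto simp: bij_betw_def inj_on_def)

lemma ex_\<tau>: "\<exists>n\<in>carrier N. \<tau> n = z"
  using \<tau>_bij unfolding bij_betw_def by (metis UNIV_I image_iff)

text \<open>The identification of N^2 with Hom(R^2, N).\<close>

definition pair_hom :: "'n \<Rightarrow> 'n \<Rightarrow> (nat \<Rightarrow> 'a) \<Rightarrow> 'n" where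
  "pair_hom n1 n2 f = f 1 \<odot>\<^bsub>N\<^esub> n1 \<oplus>\<^bsub>N\<^esub> f 2 \<odot>\<^bsub>N\<^esub> n2"

lemma pair_hom:
  assumes "n1 \<in> carrier N" "n2 \<in> carrier N"
  shows "pair_hom n1 n2 \<in> mod_hom R (free2 R) N"
  using assms unfolding mod_hom_def mem_free2_iff pair_hom_def free_mod_sel
  by (auto simp: mem_free2_iff N.smult_l_distr N.smult_r_distr N.smult_assoc1 N.a_ac)

lemma hom_eq_pair_hom:
  assumes "\<phi> \<in> mod_hom R (free2 R) N" "f \<in> carrier (free2 R)"
  shows "\<phi> f = pair_hom (\<phi> (basis_vec R 1)) (\<phi> (basis_vec R 2)) f"
proof -
  have "\<phi> (basis_vec R 1) \<in> carrier N" "\<phi> (basis_vec R 2) \<in> carrier N"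
    using assms(1) by (auto intro!: mod_hom_closed[OF assms(1)] basis_vec_closed)
  thus ?thesis using pair_hom
    by (intro N.free_mod_hom_eqI[OF assms(1) pair_hom _ assms(2)])
      (auto simp: pair_hom_def basis_vec_def)
qed

text \<open>Precomposition with a matrix acts on the pair of values by the transposed
  matrix.\<close>

lemma pair_hom_D:
  assumes "n1 \<in> carrier N" "n2 \<in> carrier N" "f \<in> carrier (free2 R)"
  shows "pair_hom n1 n2 (D i f)
    = pair_hom (x1 \<odot>\<^bsub>N\<^esub> n1 \<oplus>\<^bsub>N\<^esub> x4 \<odot>\<^bsub>N\<^esub> n2) ((a [^] i \<otimes> x3) \<odot>\<^bsub>N\<^esub> n1 \<oplus>\<^bsub>N\<^esub> x2 \<odot>\<^bsub>N\<^esub> n2) f"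
proof -
  have f: "f 1 \<in> carrier R" "f 2 \<in> carrier R" using assms mem_free2_iff by blast+
  have b: "a [^] i \<otimes> x3 \<in> carrier R" by simp
  show ?thesis using f b assms
    by (simp add: pair_hom_def D_def mat2_def N.smult_l_distr N.smult_r_distr N.smult_assoc1[symmetric]
      m_comm N.a_ac)
qed

lemma pair_hom_basis:
  assumes "n1 \<in> carrier N" "n2 \<in> carrier N"
  shows "pair_hom n1 n2 (basis_vec R 1) = n1" "pair_hom n1 n2 (basis_vec R 2) = n2"
  using assms by (simp_all add: pair_hom_def basis_vec_def)

text \<open>After \<open>D (Suc i)\<close> all values are multiples of x whose coefficients depend
  only on the constant terms of \<phi>. So the condition is that a scalar matrix annihilates the
  pair of constant terms.\<close>

lemma mem_cocycles_D_iff: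
  assumes "\<phi> \<in> mod_hom R (free2 R) N" "\<phi> \<in> extensional (carrier (free2 R))"
  defines "s \<equiv> \<lambda>j. fst (\<tau> (\<phi> (basis_vec R j)))"
  shows "\<phi> \<in> cocycles R (\<lambda>_. {1, 2}) (\<lambda>i. D (Suc i)) N i \<longleftrightarrow> s 1 + s 2 = 0 \<and> c (Suc i) * s 1 + s 2 = 0"
proof -
  let ?n1 = "\<phi> (basis_vec R 1)" and ?n2 = "\<phi> (basis_vec R 2)"
  let ?m1 = "x1 \<odot>\<^bsub>N\<^esub> ?n1 \<oplus>\<^bsub>N\<^esub> x4 \<odot>\<^bsub>N\<^esub> ?n2"
    and ?m2 = "(a [^] Suc i \<otimes> x3) \<odot>\<^bsub>N\<^esub> ?n1 \<oplus>\<^bsub>N\<^esub> x2 \<odot>\<^bsub>N\<^esub> ?n2"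
  have bv: "basis_vec R 1 \<in> carrier (free2 R)" "basis_vec R 2 \<in> carrier (free2 R)"
    by (auto intro!: basis_vec_closed)
  have n: "?n1 \<in> carrier N" "?n2 \<in> carrier N" using mod_hom_closed[OF assms(1)] bv by auto
  have m: "?m1 \<in> carrier N" "?m2 \<in> carrier N" using n by auto
  have eq: "\<phi> (D (Suc i) f) = pair_hom ?m1 ?m2 f" if "f \<in> carrier (free2 R)" for f
    using hom_eq_pair_hom[OF assms(1) mod_hom_closed[OF D_hom that]] pair_hom_D[OF n that] by metis
  have "(\<forall>f\<in>carrier (free2 R). \<phi> (D (Suc i) f) = \<zero>\<^bsub>N\<^esub>) \<longleftrightarrow> ?m1 = \<zero>\<^bsub>N\<^esub> \<and> ?m2 = \<zero>\<^bsub>N\<^esub>"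
  proof
    assume "\<forall>f\<in>carrier (free2 R). \<phi> (D (Suc i) f) = \<zero>\<^bsub>N\<^esub>"
    thus "?m1 = \<zero>\<^bsub>N\<^esub> \<and> ?m2 = \<zero>\<^bsub>N\<^esub>" using bv eq pair_hom_basis[OF m] by metis
  next
    assume z: "?m1 = \<zero>\<^bsub>N\<^esub> \<and> ?m2 = \<zero>\<^bsub>N\<^esub>"
    have "pair_hom \<zero>\<^bsub>N\<^esub> \<zero>\<^bsub>N\<^esub> f = \<zero>\<^bsub>N\<^esub>" if "f \<in> carrier (free2 R)" for f
      using that unfolding mem_free2_iff by (simp add: pair_hom_def)
    thus "\<forall>f\<in>carrier (free2 R). \<phi> (D (Suc i) f) = \<zero>\<^bsub>N\<^esub>" using eq z by metis
  qed
  also have "\<dots> \<longleftrightarrow> s 1 + s 2 = 0 \<and> c (Suc i) * s 1 + s 2 = 0"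
    using n m by (simp add: \<tau>_eq_iff \<tau>_add \<tau>_x \<tau>_pow_Suc s_def)
  finally show ?thesis using assms(1,2) unfolding mem_cocycles_iff by blast
qed

text \<open>Write the pair of values of \<phi> as s + t x with s, t pairs of scalars. Cocycles have
  s in the kernel of the scalar matrix with entry c_(i+1); for i > 0, coboundaries have s = 0 and t
  in the image of the matrix with entry c_i. Each matrix is invertible unless its c equals
  1.\<close>

lemma cohomology_nonzero_iff:
  "\<not> cocycles R (\<lambda>_. {1, 2}) (\<lambda>i. D (Suc i)) N i \<subseteq> coboundaries R (\<lambda>_. {1, 2}) (\<lambda>i. D (Suc i)) N i
     \<longleftrightarrow> i = 0 \<or> c i = 1 \<or> c (Suc i) = 1"
proof -
  interpret F: module R "free2 R" by (rule free_mod_module)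
  let ?Z = "cocycles R (\<lambda>_. {1, 2}) (\<lambda>i. D (Suc i)) N" and ?B = "coboundaries R (\<lambda>_. {1, 2}) (\<lambda>i. D (Suc i)) N"
  let ?r = "\<lambda>n1 n2. restrict (pair_hom n1 n2) (carrier (free2 R))"
  have bv: "basis_vec R 1 \<in> carrier (free2 R)" "basis_vec R 2 \<in> carrier (free2 R)"
    by (auto intro!: basis_vec_closed)
  have Z: "?r n1 n2 \<in> ?Z i \<longleftrightarrow> fst (\<tau> n1) + fst (\<tau> n2) = 0 \<and> c (Suc i) * fst (\<tau> n1) + fst (\<tau> n2) = 0"
    if "n1 \<in> carrier N" "n2 \<in> carrier N" for n1 n2
    using that bv pair_hom_basis[OF that]
    by (subst mem_cocycles_D_iff) (auto intro: F.restrict_mod_hom pair_hom)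
  have Bsuc: "\<exists>m1\<in>carrier N. \<exists>m2\<in>carrier N. \<tau> (\<phi> (basis_vec R 1)) = (0, fst (\<tau> m1) + fst (\<tau> m2)) \<and>
      \<tau> (\<phi> (basis_vec R 2)) = (0, c (Suc j) * fst (\<tau> m1) + fst (\<tau> m2))" if "\<phi> \<in> ?B (Suc j)" for \<phi> j
  proof -
    obtain \<psi> where p: "\<psi> \<in> mod_hom R (free2 R) N" "\<And>x. x \<in> carrier (free2 R) \<Longrightarrow> \<phi> x = \<psi> (D (Suc j) x)"
      using \<open>\<phi> \<in> ?B (Suc j)\<close> unfolding
      mem_coboundaries_Suc_iff[where S = "\<lambda>_. {1, 2}" and d = "\<lambda>i. D (Suc i)" and i = j, OF is_cring D_hom]
      by blast
    let ?m1 = "\<psi> (basis_vec R 1)" and ?m2 = "\<psi> (basis_vec R 2)"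
    have m: "?m1 \<in> carrier N" "?m2 \<in> carrier N" using mod_hom_closed[OF p(1)] bv by auto
    have "\<phi> f = pair_hom (x1 \<odot>\<^bsub>N\<^esub> ?m1 \<oplus>\<^bsub>N\<^esub> x4 \<odot>\<^bsub>N\<^esub> ?m2) ((a [^] Suc j \<otimes> x3) \<odot>\<^bsub>N\<^esub> ?m1 \<oplus>\<^bsub>N\<^esub> x2 \<odot>\<^bsub>N\<^esub> ?m2) f"
      if "f \<in> carrier (free2 R)" for f
      using p(2)[OF that] hom_eq_pair_hom[OF p(1) mod_hom_closed[OF D_hom that]] pair_hom_D[OF m that] by metis
    hence "\<tau> (\<phi> (basis_vec R 1)) = (0, fst (\<tau> ?m1) + fst (\<tau> ?m2)) \<and>
      \<tau> (\<phi> (basis_vec R 2)) = (0, c (Suc j) * fst (\<tau> ?m1) + fst (\<tau> ?m2))"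
      using bv m by (simp add: pair_hom_basis \<tau>_add \<tau>_x \<tau>_pow_Suc)
    thus ?thesis using m by blast
  qed
  show ?thesis
  proof
    assume "i = 0 \<or> c i = 1 \<or> c (Suc i) = 1"
    then consider "i = 0" | j where "i = Suc j" "c i = 1" | j where "i = Suc j" "c (Suc i) = 1"
      by (cases i) auto
    thus "\<not> ?Z i \<subseteq> ?B i"
    proof cases
      \<comment> \<open>In degree 0 only zero is a coboundary, while the map with values x, 0 is a
        cocycle because x acts on x as zero.\<close>
      case 1
      obtain n1 where n1: "n1 \<in> carrier N" "\<tau> n1 = (0, 1)" using ex_\<tau> by blast
      have "?r n1 \<zero>\<^bsub>N\<^esub> \<in> ?Z i" using n1 by (simp add: Z)
      moreover have "?r n1 \<zero>\<^bsub>N\<^esub> \<notin> ?B i"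
      proof
        assume "?r n1 \<zero>\<^bsub>N\<^esub> \<in> ?B i"
        hence "n1 = \<zero>\<^bsub>N\<^esub>" using bv pair_hom_basis[OF n1(1)] unfolding 1 mem_coboundaries_0_iff by auto
        thus False using n1 by simp
      qed
      ultimately show ?thesis by blast
    next
      \<comment> \<open>With c_i = 1 both x-coefficients of a coboundary agree, so the values x, 0
        do not come from one.\<close>
      case (2 j)
      obtain n1 where n1: "n1 \<in> carrier N" "\<tau> n1 = (0, 1)" using ex_\<tau> by blast
      have "?r n1 \<zero>\<^bsub>N\<^esub> \<in> ?Z i" using n1 by (simp add: Z)
      moreover have "?r n1 \<zero>\<^bsub>N\<^esub> \<notin> ?B (Suc j)"
        using Bsuc[of "?r n1 \<zero>\<^bsub>N\<^esub>" j] bv pair_hom_basis[OF n1(1)] n1 2 by auto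
      ultimately show ?thesis using 2 by blast
    next
      \<comment> \<open>With c_(i+1) = 1 the values 1, -1 give a cocycle, and its constant terms do
        not vanish as those of a coboundary do.\<close>
      case (3 j)
      obtain n1 n2 where n: "n1 \<in> carrier N" "n2 \<in> carrier N" "\<tau> n1 = (1, 0)" "\<tau> n2 = (-1, 0)" using ex_\<tau> by blast
      have "?r n1 n2 \<in> ?Z i" using n 3(2) by (simp add: Z)
      moreover have "?r n1 n2 \<notin> ?B (Suc j)"
        using Bsuc[of "?r n1 n2" j] bv pair_hom_basis[OF n(1,2)] n 3 by auto
      ultimately show ?thesis using 3 by blast
    qed
  next
    assume "\<not> ?Z i \<subseteq> ?B i"
    then obtain \<phi> where phi: "\<phi> \<in> ?Z i" "\<phi> \<notin> ?B i" by blast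
    show "i = 0 \<or> c i = 1 \<or> c (Suc i) = 1"
    proof (rule ccontr)
      assume "\<not> (i = 0 \<or> c i = 1 \<or> c (Suc i) = 1)"
      then obtain j where j: "i = Suc j" and c: "c i \<noteq> 1" "c (Suc i) \<noteq> 1" by (cases i) auto
      have h: "\<phi> \<in> mod_hom R (free2 R) N" "\<phi> \<in> extensional (carrier (free2 R))"
        using phi(1) unfolding mem_cocycles_iff by blast+
      let ?n1 = "\<phi> (basis_vec R 1)" and ?n2 = "\<phi> (basis_vec R 2)"
      have n: "?n1 \<in> carrier N" "?n2 \<in> carrier N" using mod_hom_closed[OF h(1)] bv by auto
      have "fst (\<tau> ?n1) + fst (\<tau> ?n2) = 0" "c (Suc i) * fst (\<tau> ?n1) + fst (\<tau> ?n2) = 0"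
        using phi(1) unfolding mem_cocycles_D_iff[OF h] by blast+
      moreover have "x = 0 \<and> y = 0" if "x + y = 0" "C * x + y = 0" "C \<noteq> 1" for C x y :: 'k
      proof -
        have "(C - 1) * x = (C * x + y) - (x + y)" by (simp add: algebra_simps)
        hence "(C - 1) * x = 0" using that by simp
        thus ?thesis using that by simp
      qed
      ultimately have s: "fst (\<tau> ?n1) = 0" "fst (\<tau> ?n2) = 0" using c(2) by blast+
      define t1 t2 where "t1 = snd (\<tau> ?n1)" "t2 = snd (\<tau> ?n2)"
      \<comment> \<open>Solves u + w = t1 and c_i u + w = t2, with w = t1 - u.\<close>
      define u where "u = (t2 - t1) / (c i - 1)"
      have "(c i - 1) * u = t2 - t1" using c by (simp add: u_def)
      hence u: "c i * u + (t1 - u) = t2" by (simp add: algebra_simps)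
      obtain m1 m2 where m: "m1 \<in> carrier N" "m2 \<in> carrier N" "\<tau> m1 = (u, 0)" "\<tau> m2 = (t1 - u, 0)"
        using ex_\<tau> by blast
      have e1: "x1 \<odot>\<^bsub>N\<^esub> m1 \<oplus>\<^bsub>N\<^esub> x4 \<odot>\<^bsub>N\<^esub> m2 = ?n1"
        using m n s by (subst \<tau>_eq_iff) (auto simp: \<tau>_add \<tau>_x t1_t2_def prod_eq_iff)
      have e2: "(a [^] i \<otimes> x3) \<odot>\<^bsub>N\<^esub> m1 \<oplus>\<^bsub>N\<^esub> x2 \<odot>\<^bsub>N\<^esub> m2 = ?n2"
        using m n s u by (subst \<tau>_eq_iff) (auto simp: \<tau>_add \<tau>_x t1_t2_def prod_eq_iff)
      have "\<phi> f = pair_hom m1 m2 (D i f)" if "f \<in> carrier (free2 R)" for f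
        using hom_eq_pair_hom[OF h(1) that] pair_hom_D[OF m(1,2) that, of i] e1 e2 by metis
      hence "\<phi> \<in> ?B (Suc j)" using h(2) pair_hom[OF m(1,2)] j unfolding
        mem_coboundaries_Suc_iff[where S = "\<lambda>_. {1, 2}" and d = "\<lambda>i. D (Suc i)" and i = j, OF is_cring D_hom]
        by blast
      thus False using phi j by blast
    qed
  qed
qed

end

section \<open>Coordinates on the ring \<open>A\<close>\<close>

text \<open>There are 1, 5, 5, 1 basis monomials in degrees 0 to 3. For tuples independence is
  automatic; what has to be shown is that the multiplication table is consistent.\<close>

datatype 'k vec12 = Vec (c0: 'k) (c1: 'k) (c2: 'k) (c3: 'k) (c4: 'k) (c5: 'k)
  (c12: 'k) (c13: 'k) (c14: 'k) (c15: 'k) (c25: 'k) (c125: 'k)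

lemma vec12_eq_iff:
  "u = v \<longleftrightarrow> c0 u = c0 v \<and> c1 u = c1 v \<and> c2 u = c2 v \<and> c3 u = c3 v \<and> c4 u = c4 v \<and> c5 u = c5 v \<and>
     c12 u = c12 v \<and> c13 u = c13 v \<and> c14 u = c14 v \<and> c15 u = c15 v \<and> c25 u = c25 v \<and> c125 u = c125 v"
  by (cases u; cases v) simp

instantiation vec12 :: (ab_group_add) ab_group_add
begin

definition "0 = Vec 0 0 0 0 0 0 0 0 0 0 0 0"

definition "u + v = Vec (c0 u + c0 v) (c1 u + c1 v) (c2 u + c2 v) (c3 u + c3 v) (c4 u + c4 v) (c5 u + c5 v)
  (c12 u + c12 v) (c13 u + c13 v) (c14 u + c14 v) (c15 u + c15 v) (c25 u + c25 v) (c125 u + c125 v)"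

definition "- u = Vec (- c0 u) (- c1 u) (- c2 u) (- c3 u) (- c4 u) (- c5 u)
  (- c12 u) (- c13 u) (- c14 u) (- c15 u) (- c25 u) (- c125 u)"

definition minus_vec12 :: "'a vec12 \<Rightarrow> 'a vec12 \<Rightarrow> 'a vec12" where "minus_vec12 u v = u + - v"

instance
  by standard (simp_all add: zero_vec12_def plus_vec12_def uminus_vec12_def minus_vec12_def vec12_eq_iff add_ac)

end

lemma vec12_sel [simp]:
  "c0 0 = 0" "c1 0 = 0" "c2 0 = 0" "c3 0 = 0" "c4 0 = 0" "c5 0 = 0"
  "c12 0 = 0" "c13 0 = 0" "c14 0 = 0" "c15 0 = 0" "c25 0 = 0" "c125 0 = 0"
  "c0 (u + v) = c0 u + c0 v" "c1 (u + v) = c1 u + c1 v" "c2 (u + v) = c2 u + c2 v"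
  "c3 (u + v) = c3 u + c3 v" "c4 (u + v) = c4 u + c4 v" "c5 (u + v) = c5 u + c5 v"
  "c12 (u + v) = c12 u + c12 v" "c13 (u + v) = c13 u + c13 v" "c14 (u + v) = c14 u + c14 v"
  "c15 (u + v) = c15 u + c15 v" "c25 (u + v) = c25 u + c25 v" "c125 (u + v) = c125 u + c125 v"
  "c0 (- u) = - c0 u" "c1 (- u) = - c1 u" "c2 (- u) = - c2 u"
  "c3 (- u) = - c3 u" "c4 (- u) = - c4 u" "c5 (- u) = - c5 u"
  "c12 (- u) = - c12 u" "c13 (- u) = - c13 u" "c14 (- u) = - c14 u"
  "c15 (- u) = - c15 u" "c25 (- u) = - c25 u" "c125 (- u) = - c125 u"
  "c0 (u - v) = c0 u - c0 v" "c1 (u - v) = c1 u - c1 v" "c2 (u - v) = c2 u - c2 v"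
 "c3 (u - v) = c3 u - c3 v" "c4 (u - v) = c4 u - c4 v" "c5 (u - v) = c5 u - c5 v"
 "c12 (u - v) = c12 u - c12 v" "c13 (u - v) = c13 u - c13 v" "c14 (u - v) = c14 u - c14 v"
 "c15 (u - v) = c15 u - c15 v" "c25 (u - v) = c25 u - c25 v" "c125 (u - v) = c125 u - c125 v"
  by (simp_all add: zero_vec12_def plus_vec12_def uminus_vec12_def minus_vec12_def)

definition scalar :: "'k::field \<Rightarrow> 'k vec12" where
  "scalar c = Vec c 0 0 0 0 0 0 0 0 0 0 0"

fun gen :: "var \<Rightarrow> 'k::field vec12" where
  "gen V1 = Vec 0 1 0 0 0 0 0 0 0 0 0 0"
| "gen V2 = Vec 0 0 1 0 0 0 0 0 0 0 0 0"
| "gen V3 = Vec 0 0 0 1 0 0 0 0 0 0 0 0"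
| "gen V4 = Vec 0 0 0 0 1 0 0 0 0 0 0 0"
| "gen V5 = Vec 0 0 0 0 0 1 0 0 0 0 0 0"

text \<open>The coordinate \<open>c\<^sub>i\<^sub>j\<^sub>k\<close> belongs to the monomial \<open>x\<^sub>i x\<^sub>j x\<^sub>k\<close>. The remaining products of generators are
  \<open>x\<^sub>2x\<^sub>3 = - \<alpha> x\<^sub>1x\<^sub>3\<close>, \<open>x\<^sub>2x\<^sub>4 = - x\<^sub>1x\<^sub>4\<close>, \<open>x\<^sub>3\<^sup>2 = x\<^sub>2x\<^sub>5 - \<alpha> x\<^sub>1x\<^sub>5\<close>, \<open>x\<^sub>4\<^sup>2 = x\<^sub>2x\<^sub>5 - x\<^sub>1x\<^sub>5\<close>
  and zeros; the only nonzero products in degree three are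
  \<open>x\<^sub>1 \<cdot> x\<^sub>2x\<^sub>5 = x\<^sub>2 \<cdot> x\<^sub>1x\<^sub>5 = x\<^sub>5 \<cdot> x\<^sub>1x\<^sub>2 = x\<^sub>3 \<cdot> x\<^sub>1x\<^sub>3 = x\<^sub>4 \<cdot> x\<^sub>1x\<^sub>4\<close>.\<close>

definition vmul :: "'k::field \<Rightarrow> 'k vec12 \<Rightarrow> 'k vec12 \<Rightarrow> 'k vec12" where
  "vmul \<alpha> u v = Vec (c0 u * c0 v)
     (c0 u * c1 v + c1 u * c0 v) (c0 u * c2 v + c2 u * c0 v) (c0 u * c3 v + c3 u * c0 v)
     (c0 u * c4 v + c4 u * c0 v) (c0 u * c5 v + c5 u * c0 v)
     (c0 u * c12 v + c12 u * c0 v + c1 u * c2 v + c2 u * c1 v)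
     (c0 u * c13 v + c13 u * c0 v + c1 u * c3 v + c3 u * c1 v - \<alpha> * (c2 u * c3 v + c3 u * c2 v))
     (c0 u * c14 v + c14 u * c0 v + c1 u * c4 v + c4 u * c1 v - (c2 u * c4 v + c4 u * c2 v))
     (c0 u * c15 v + c15 u * c0 v + c1 u * c5 v + c5 u * c1 v - \<alpha> * (c3 u * c3 v) - c4 u * c4 v)
     (c0 u * c25 v + c25 u * c0 v + c2 u * c5 v + c5 u * c2 v + c3 u * c3 v + c4 u * c4 v)
     (c0 u * c125 v + c125 u * c0 v + c1 u * c25 v + c25 u * c1 v + c2 u * c15 v + c15 u * c2 v
       + c5 u * c12 v + c12 u * c5 v + c3 u * c13 v + c13 u * c3 v + c4 u * c14 v + c14 u * c4 v)"

text \<open>This expansion is where it is shown that the relations cause no collapse: it makes the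
  table an algebra in which polynomials can be evaluated.\<close>

lemma vmul_assoc: "vmul \<alpha> (vmul \<alpha> u v) w = vmul \<alpha> u (vmul \<alpha> v w)"
  unfolding vec12_eq_iff by (intro conjI) (simp_all add: vmul_def algebra_simps)

lemma vmul_comm: "vmul \<alpha> u v = vmul \<alpha> v u"
  unfolding vec12_eq_iff by (intro conjI) (simp_all add: vmul_def algebra_simps)

lemma vmul_add: "vmul \<alpha> (u + v) w = vmul \<alpha> u w + vmul \<alpha> v w"
  unfolding vec12_eq_iff by (intro conjI) (simp_all add: vmul_def algebra_simps)

lemma vmul_scalar_1 [simp]: "vmul \<alpha> (scalar 1) u = u"
  unfolding vec12_eq_iff by (simp add: vmul_def scalar_def)

lemma vmul_zero [simp]: "vmul \<alpha> 0 u = 0"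
  unfolding vec12_eq_iff by (simp add: vmul_def)

lemma scalar_mult: "vmul \<alpha> (scalar c) (scalar d) = scalar (c * d)"
  unfolding vec12_eq_iff by (simp add: vmul_def scalar_def)

lemma vmul_scalar:
  "vmul \<alpha> (scalar c) u = Vec (c * c0 u) (c * c1 u) (c * c2 u) (c * c3 u) (c * c4 u) (c * c5 u)
     (c * c12 u) (c * c13 u) (c * c14 u) (c * c15 u) (c * c25 u) (c * c125 u)"
  by (simp add: vmul_def scalar_def)

lemma vmul_gen:
  "vmul \<alpha> (gen V1) u = Vec 0 (c0 u) 0 0 0 0 (c2 u) (c3 u) (c4 u) (c5 u) 0 (c25 u)"
  "vmul \<alpha> (gen V2) u = Vec 0 0 (c0 u) 0 0 0 (c1 u) (- \<alpha> * c3 u) (- c4 u) 0 (c5 u) (c15 u)"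
  "vmul \<alpha> (gen V3) u = Vec 0 0 0 (c0 u) 0 0 0 (c1 u - \<alpha> * c2 u) 0 (- \<alpha> * c3 u) (c3 u) (c13 u)"
  "vmul \<alpha> (gen V4) u = Vec 0 0 0 0 (c0 u) 0 0 0 (c1 u - c2 u) (- c4 u) (c4 u) (c14 u)"
  "vmul \<alpha> (gen V5) u = Vec 0 0 0 0 0 (c0 u) 0 0 0 (c1 u) (c2 u) (c12 u)"
  by (simp_all add: vmul_def)

definition model :: "'k::field \<Rightarrow> 'k vec12 ring" where
  "model \<alpha> = \<lparr>carrier = UNIV, monoid.mult = vmul \<alpha>, one = scalar 1, ring.zero = 0, add = (+)\<rparr>"

lemma model_simps [simp]:
  "carrier (model \<alpha>) = UNIV" "u \<otimes>\<^bsub>model \<alpha>\<^esub> v = vmul \<alpha> u v" "\<one>\<^bsub>model \<alpha>\<^esub> = scalar 1"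
  "\<zero>\<^bsub>model \<alpha>\<^esub> = 0" "u \<oplus>\<^bsub>model \<alpha>\<^esub> v = u + v"
  by (simp_all add: model_def)

lemma model_cring: "cring (model \<alpha>)"
proof (rule cringI)
  have "\<exists>v. v + u = 0" for u :: "'a vec12" by (rule exI[of _ "- u"]) simp
  thus "abelian_group (model \<alpha>)" by (intro abelian_groupI) (auto simp: add_ac)
  show "comm_monoid (model \<alpha>)" by (intro comm_monoidI) (simp_all add: vmul_assoc, rule vmul_comm)
qed (simp add: vmul_add)

section \<open>Evaluation of polynomials in the model algebra\<close>

definition monom_val :: "'k::field \<Rightarrow> (var \<Rightarrow>\<^sub>0 nat) \<Rightarrow> 'k vec12" where
  "monom_val \<alpha> m = (let x = (\<lambda>v. gen v [^]\<^bsub>model \<alpha>\<^esub> Poly_Mapping.lookup m v) in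
     vmul \<alpha> (x V1) (vmul \<alpha> (x V2) (vmul \<alpha> (x V3) (vmul \<alpha> (x V4) (x V5)))))"

definition ev :: "'k::field \<Rightarrow> 'k poly5 \<Rightarrow> 'k vec12" where
  "ev \<alpha> p = (\<Sum>m\<in>Poly_Mapping.keys p. vmul \<alpha> (scalar (Poly_Mapping.lookup p m)) (monom_val \<alpha> m))"

lemma vmul_left_comm: "vmul \<alpha> u (vmul \<alpha> v w) = vmul \<alpha> v (vmul \<alpha> u w)"
  by (metis vmul_assoc vmul_comm)

lemmas vmul_ac = vmul_assoc vmul_comm vmul_left_comm

lemma monom_val_add: "monom_val \<alpha> (m + n) = vmul \<alpha> (monom_val \<alpha> m) (monom_val \<alpha> n)"
proof -
  interpret cring "model \<alpha>" by (rule model_cring)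
  have "gen v [^]\<^bsub>model \<alpha>\<^esub> (i + j) = vmul \<alpha> (gen v [^]\<^bsub>model \<alpha>\<^esub> i) (gen v [^]\<^bsub>model \<alpha>\<^esub> j)" for v and i j :: nat
    using nat_pow_mult[of "gen v" i j] by simp
  thus ?thesis by (simp add: monom_val_def lookup_add vmul_ac)
qed

lemma scalar_zero [simp]: "scalar 0 = 0"
  unfolding vec12_eq_iff by (simp add: scalar_def)

lemma scalar_add: "scalar (c + d) = scalar c + scalar d"
  unfolding vec12_eq_iff by (simp add: scalar_def)

lemma ev_zero [simp]: "ev \<alpha> 0 = 0"
  by (simp add: ev_def)

lemma ev_superset:
  assumes "finite S" "Poly_Mapping.keys p \<subseteq> S"
  shows "ev \<alpha> p = (\<Sum>m\<in>S. vmul \<alpha> (scalar (Poly_Mapping.lookup p m)) (monom_val \<alpha> m))"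
  unfolding ev_def using assms by (intro sum.mono_neutral_left) (auto simp: in_keys_iff)

lemma ev_add: "ev \<alpha> (p + q) = ev \<alpha> p + ev \<alpha> q"
proof -
  let ?S = "Poly_Mapping.keys p \<union> Poly_Mapping.keys q"
  have S: "finite ?S" "Poly_Mapping.keys p \<subseteq> ?S" "Poly_Mapping.keys q \<subseteq> ?S" "Poly_Mapping.keys (p + q) \<subseteq> ?S" by (auto dest: keys_add[THEN subsetD])
  show ?thesis
    by (simp add: ev_superset[OF S(1,2)] ev_superset[OF S(1,3)] ev_superset[OF S(1,4)] lookup_add
        scalar_add vmul_add sum.distrib)
qed

lemma ev_single: "ev \<alpha> (Poly_Mapping.single m c) = vmul \<alpha> (scalar c) (monom_val \<alpha> m)"
  by (subst ev_superset[of "{m}"]) (auto simp: lookup_single)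

lemma poly_mapping_induct [case_names zero single add]:
  fixes p :: "'a \<Rightarrow>\<^sub>0 'b::monoid_add"
  assumes "P 0" "\<And>m c. P (Poly_Mapping.single m c)" "\<And>p q. P p \<Longrightarrow> P q \<Longrightarrow> P (p + q)"
  shows "P p"
proof (induction p rule: update_induct)
  case (update f a b)
  have "Poly_Mapping.update a b f = f + Poly_Mapping.single a b"
    using update.hyps by (intro poly_mapping_eqI) (auto simp: lookup_update lookup_add lookup_single in_keys_iff)
  thus ?case using assms update by simp
qed (rule assms)

text \<open>Both sides are additive in each factor, which reduces the claim to single terms, where
  exponents add.\<close>

lemma ev_mult: "ev \<alpha> (p * q) = vmul \<alpha> (ev \<alpha> p) (ev \<alpha> q)"
proof (induction p rule: poly_mapping_induct)
  case (single m c)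
  show ?case
  proof (induction q rule: poly_mapping_induct)
    case (single n d)
    have "vmul \<alpha> (scalar (c * d)) w = vmul \<alpha> (scalar c) (vmul \<alpha> (scalar d) w)" for w
      by (simp add: vmul_assoc[symmetric] scalar_mult)
    thus ?case by (simp add: mult_single ev_single monom_val_add vmul_ac)
  next
    case (add p q)
    thus ?case by (simp add: distrib_left ev_add) (metis vmul_add vmul_comm)
  qed (simp add: vmul_comm[of \<alpha> _ 0])
qed (simp_all add: distrib_right ev_add vmul_add)

lemma monom_val_zero: "monom_val \<alpha> 0 = scalar 1"
  by (simp add: monom_val_def)

lemma ev_pconst [simp]: "ev \<alpha> (pconst c) = scalar c"
  by (simp add: pconst_def ev_single monom_val_zero scalar_mult)

lemma ev_pvar [simp]: "ev \<alpha> (pvar v) = gen v"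
proof -
  have "gen w [^]\<^bsub>model \<alpha>\<^esub> (1 :: nat) = gen w" for w
    by (intro monoid.nat_pow_eone ring.is_monoid cring.axioms(1) model_cring) simp
  thus ?thesis unfolding pvar_def
    by (cases v) (simp_all add: ev_single monom_val_def Let_def lookup_single when_def vmul_comm[of \<alpha> _ "scalar 1"] del: gen.simps)
qed

lemma ev_one [simp]: "ev \<alpha> 1 = scalar 1"
  using ev_pconst[of \<alpha> 1] by (simp add: pconst_def)

lemma ev_minus: "ev \<alpha> (p - q) = ev \<alpha> p - ev \<alpha> q"
  using ev_add[of \<alpha> "p - q" q] by (simp add: algebra_simps)

lemma pconst_simps:
  "pconst (c + d) = pconst c + pconst d" "pconst (c - d) = pconst c - pconst d"
  "pconst (- c) = - pconst c" "pconst (c * d) = pconst c * pconst d" "pconst 0 = 0" "pconst 1 = 1"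
  by (simp_all add: pconst_def single_add single_diff single_uminus mult_single)

lemma P5_simps [simp]:
  "carrier P5 = UNIV" "p \<otimes>\<^bsub>P5\<^esub> q = p * q" "\<one>\<^bsub>P5\<^esub> = 1" "\<zero>\<^bsub>P5\<^esub> = 0" "p \<oplus>\<^bsub>P5\<^esub> q = p + q"
  by (simp_all add: ring_of_type_algebra_def)

lemma ev_hom: "ring_hom_ring P5 (model \<alpha>) (ev \<alpha>)"
  using cring.axioms(1)[OF model_cring]
  by (intro ring_hom_ringI) (auto simp: ev_mult ev_add)

lemma I_ideal_ideal: "ideal (I_ideal \<alpha>) P5"
  unfolding I_ideal_def by (intro ring.genideal_ideal) auto

lemma mem_ev_kernel: "p \<in> a_kernel P5 (model \<alpha>) (ev \<alpha>) \<longleftrightarrow> ev \<alpha> p = 0"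
  unfolding a_kernel_def' by simp

text \<open>The ten generators evaluate to zero and the kernel is an ideal, so it contains the ideal
  they generate.\<close>

lemma ev_I_ideal:
  assumes "p \<in> I_ideal \<alpha>"
  shows "ev \<alpha> p = 0"
proof -
  interpret ev: ring_hom_ring P5 "model \<alpha>" "ev \<alpha>" by (rule ev_hom)
  have gens: "ev \<alpha> (pconst \<alpha> * pvar V1 * pvar V3 + pvar V2 * pvar V3) = 0"
    "ev \<alpha> (pvar V1 * pvar V4 + pvar V2 * pvar V4) = 0"
    "ev \<alpha> (pvar V3 ^ 2 + pconst \<alpha> * pvar V1 * pvar V5 - pvar V2 * pvar V5) = 0"
    "ev \<alpha> (pvar V4 ^ 2 + pvar V1 * pvar V5 - pvar V2 * pvar V5) = 0"
    "ev \<alpha> (pvar V1 ^ 2) = 0"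
    "ev \<alpha> (pvar V2 ^ 2) = 0"
    "ev \<alpha> (pvar V3 * pvar V4) = 0"
    "ev \<alpha> (pvar V3 * pvar V5) = 0"
    "ev \<alpha> (pvar V4 * pvar V5) = 0"
    "ev \<alpha> (pvar V5 ^ 2) = 0"
    unfolding ev_add ev_minus ev_mult power2_eq_square ev_pvar ev_pconst vmul_assoc
    by (simp_all add: vmul_scalar vmul_gen del: gen.simps) (simp_all add: vec12_eq_iff)
  have "I_ideal \<alpha> \<subseteq> a_kernel P5 (model \<alpha>) (ev \<alpha>)"
    unfolding I_ideal_def
  proof (rule ev.R.genideal_minimal[OF ev.kernel_is_ideal])
    show "{pconst \<alpha> * pvar V1 * pvar V3 + pvar V2 * pvar V3,
      pvar V1 * pvar V4 + pvar V2 * pvar V4,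
      pvar V3 ^ 2 + pconst \<alpha> * pvar V1 * pvar V5 - pvar V2 * pvar V5,
      pvar V4 ^ 2 + pvar V1 * pvar V5 - pvar V2 * pvar V5,
      pvar V1 ^ 2, pvar V2 ^ 2, pvar V3 * pvar V4, pvar V3 * pvar V5, pvar V4 * pvar V5, pvar V5 ^ 2}
      \<subseteq> a_kernel P5 (model \<alpha>) (ev \<alpha>)"
      by (intro insert_subsetI empty_subsetI mem_ev_kernel[THEN iffD2] gens)
  qed
  thus ?thesis using assms mem_ev_kernel by blast
qed

section \<open>Normal forms modulo the defining ideal\<close>

definition nf :: "'k::field vec12 \<Rightarrow> 'k poly5" where
  "nf u = pconst (c0 u) + pconst (c1 u) * pvar V1 + pconst (c2 u) * pvar V2 + pconst (c3 u) * pvar V3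
    + pconst (c4 u) * pvar V4 + pconst (c5 u) * pvar V5
    + pconst (c12 u) * pvar V1 * pvar V2 + pconst (c13 u) * pvar V1 * pvar V3 + pconst (c14 u) * pvar V1 * pvar V4
    + pconst (c15 u) * pvar V1 * pvar V5 + pconst (c25 u) * pvar V2 * pvar V5
    + pconst (c125 u) * pvar V1 * pvar V2 * pvar V5"

lemma ev_nf [simp]: "ev \<alpha> (nf u) = u"
  unfolding vec12_eq_iff nf_def by (simp add: ev_add ev_mult vmul_def scalar_def)

lemma nf_add: "nf (u + v) = nf u + nf v"
  by (simp add: nf_def pconst_simps algebra_simps)

lemma I_ideal_add: "p \<in> I_ideal \<alpha> \<Longrightarrow> q \<in> I_ideal \<alpha> \<Longrightarrow> p + q \<in> I_ideal \<alpha>"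
  using additive_subgroup.a_closed[OF ideal.axioms(1)[OF I_ideal_ideal]] by fastforce

lemma I_ideal_mult: "p \<in> I_ideal \<alpha> \<Longrightarrow> r * p \<in> I_ideal \<alpha>"
  using ideal.I_l_closed[OF I_ideal_ideal] by fastforce

lemma I_ideal_diff: "p \<in> I_ideal \<alpha> \<Longrightarrow> q \<in> I_ideal \<alpha> \<Longrightarrow> p - q \<in> I_ideal \<alpha>"
  using I_ideal_add[of p \<alpha> "- 1 * q"] I_ideal_mult[of q \<alpha> "- 1"] by simp

lemma I_ideal_gens:
  "pconst \<alpha> * pvar V1 * pvar V3 + pvar V2 * pvar V3 \<in> I_ideal \<alpha>"
  "pvar V1 * pvar V4 + pvar V2 * pvar V4 \<in> I_ideal \<alpha>"
  "pvar V3 ^ 2 + pconst \<alpha> * pvar V1 * pvar V5 - pvar V2 * pvar V5 \<in> I_ideal \<alpha>"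
  "pvar V4 ^ 2 + pvar V1 * pvar V5 - pvar V2 * pvar V5 \<in> I_ideal \<alpha>"
  "pvar V1 ^ 2 \<in> I_ideal \<alpha>" "pvar V2 ^ 2 \<in> I_ideal \<alpha>" "pvar V3 * pvar V4 \<in> I_ideal \<alpha>"
  "pvar V3 * pvar V5 \<in> I_ideal \<alpha>" "pvar V4 * pvar V5 \<in> I_ideal \<alpha>" "pvar V5 ^ 2 \<in> I_ideal \<alpha>"
proof -
  have "ring (P5 :: 'a poly5 ring)" by auto
  note sub = ring.genideal_self[OF this]
  show
    "pconst \<alpha> * pvar V1 * pvar V3 + pvar V2 * pvar V3 \<in> I_ideal \<alpha>"
    "pvar V1 * pvar V4 + pvar V2 * pvar V4 \<in> I_ideal \<alpha>"
    "pvar V3 ^ 2 + pconst \<alpha> * pvar V1 * pvar V5 - pvar V2 * pvar V5 \<in> I_ideal \<alpha>"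
    "pvar V4 ^ 2 + pvar V1 * pvar V5 - pvar V2 * pvar V5 \<in> I_ideal \<alpha>"
    "pvar V1 ^ 2 \<in> I_ideal \<alpha>" "pvar V2 ^ 2 \<in> I_ideal \<alpha>" "pvar V3 * pvar V4 \<in> I_ideal \<alpha>"
    "pvar V3 * pvar V5 \<in> I_ideal \<alpha>" "pvar V4 * pvar V5 \<in> I_ideal \<alpha>" "pvar V5 ^ 2 \<in> I_ideal \<alpha>"
    unfolding I_ideal_def by (rule subsetD[OF sub], simp, (rule insertI1 | rule insertI2)+)+
qed

text \<open>Each case displays the difference as an explicit combination of generators, obtained by
  rewriting every product of the variable with a basis monomial. This single step is all that the
  reduction of arbitrary polynomials needs.\<close>

lemma nf_pvar_mult: "pvar v * nf u - nf (vmul \<alpha> (gen v) u) \<in> I_ideal \<alpha>"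
proof (cases v)
  case V1
  let ?X = pvar and ?k = pconst
  have "pvar v * nf u - nf (vmul \<alpha> (gen v) u) =
    (?k (c1 u) + ?k (c12 u) * ?X V2 + ?k (c13 u) * ?X V3 + ?k (c14 u) * ?X V4 + ?k (c15 u) * ?X V5
     + ?k (c125 u) * ?X V2 * ?X V5) * ?X V1 ^ 2"
    by (simp add: V1 nf_def vmul_def pconst_simps power2_eq_square algebra_simps)
  thus ?thesis by (simp only: I_ideal_mult I_ideal_gens)
next
  case V2
  let ?X = pvar and ?k = pconst
  let ?g1 = "?k \<alpha> * ?X V1 * ?X V3 + ?X V2 * ?X V3" and ?g2 = "?X V1 * ?X V4 + ?X V2 * ?X V4"
  \<comment> \<open>The correction with X_1^2 comes from products such as X_2 X_1 X_3 = X_1 g1 -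
    \<alpha> X_1^2 X_3, where the rewritten factor brings in a second X_1.\<close>
  have "pvar v * nf u - nf (vmul \<alpha> (gen v) u) =
    (?k (c2 u) + ?k (c12 u) * ?X V1 + ?k (c25 u) * ?X V5 + ?k (c125 u) * ?X V1 * ?X V5) * ?X V2 ^ 2
    + (?k (c3 u) + ?k (c13 u) * ?X V1) * ?g1 + (?k (c4 u) + ?k (c14 u) * ?X V1) * ?g2
    - (?k (c13 u) * ?k \<alpha> * ?X V3 + ?k (c14 u) * ?X V4) * ?X V1 ^ 2"
    by (simp add: V2 nf_def vmul_def pconst_simps power2_eq_square algebra_simps)
  thus ?thesis by (simp only: I_ideal_mult I_ideal_gens I_ideal_add I_ideal_diff)
next
  case V3
  let ?X = pvar and ?k = pconst
  let ?g1 = "?k \<alpha> * ?X V1 * ?X V3 + ?X V2 * ?X V3"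
    and ?g3 = "?X V3 ^ 2 + ?k \<alpha> * ?X V1 * ?X V5 - ?X V2 * ?X V5"
  have "pvar v * nf u - nf (vmul \<alpha> (gen v) u) =
    (?k (c2 u) + ?k (c12 u) * ?X V1) * ?g1 + (?k (c3 u) + ?k (c13 u) * ?X V1) * ?g3
    + (?k (c4 u) + ?k (c14 u) * ?X V1) * (?X V3 * ?X V4)
    + (?k (c5 u) + ?k (c15 u) * ?X V1 + ?k (c25 u) * ?X V2 + ?k (c125 u) * ?X V1 * ?X V2) * (?X V3 * ?X V5)
    - (?k (c12 u) * ?k \<alpha> * ?X V3 + ?k (c13 u) * ?k \<alpha> * ?X V5) * ?X V1 ^ 2"
    by (simp add: V3 nf_def vmul_def pconst_simps power2_eq_square algebra_simps)
  thus ?thesis by (simp only: I_ideal_mult I_ideal_gens I_ideal_add I_ideal_diff)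
next
  case V4
  let ?X = pvar and ?k = pconst
  let ?g2 = "?X V1 * ?X V4 + ?X V2 * ?X V4"
    and ?g4 = "?X V4 ^ 2 + ?X V1 * ?X V5 - ?X V2 * ?X V5"
  have "pvar v * nf u - nf (vmul \<alpha> (gen v) u) =
    (?k (c2 u) + ?k (c12 u) * ?X V1) * ?g2 + (?k (c4 u) + ?k (c14 u) * ?X V1) * ?g4
    + (?k (c3 u) + ?k (c13 u) * ?X V1) * (?X V3 * ?X V4)
    + (?k (c5 u) + ?k (c15 u) * ?X V1 + ?k (c25 u) * ?X V2 + ?k (c125 u) * ?X V1 * ?X V2) * (?X V4 * ?X V5)
    - (?k (c12 u) * ?X V4 + ?k (c14 u) * ?X V5) * ?X V1 ^ 2"
    by (simp add: V4 nf_def vmul_def pconst_simps power2_eq_square algebra_simps)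
  thus ?thesis by (simp only: I_ideal_mult I_ideal_gens I_ideal_add I_ideal_diff)
next
  case V5
  let ?X = pvar and ?k = pconst
  have "pvar v * nf u - nf (vmul \<alpha> (gen v) u) =
    (?k (c3 u) + ?k (c13 u) * ?X V1) * (?X V3 * ?X V5) + (?k (c4 u) + ?k (c14 u) * ?X V1) * (?X V4 * ?X V5)
    + (?k (c5 u) + ?k (c15 u) * ?X V1 + ?k (c25 u) * ?X V2 + ?k (c125 u) * ?X V1 * ?X V2) * ?X V5 ^ 2"
    by (simp add: V5 nf_def vmul_def pconst_simps power2_eq_square algebra_simps)
  thus ?thesis by (simp only: I_ideal_mult I_ideal_gens I_ideal_add I_ideal_diff)
qed

text \<open>Tailored to reduction: a monomial arises from a constant by multiplying with one
  variable at a time, which matches \<open>nf_pvar_mult\<close>.\<close>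

lemma poly5_induct [case_names const var add]:
  fixes p :: "'k::field poly5"
  assumes const: "\<And>c. P (pconst c)" and var: "\<And>v p. P p \<Longrightarrow> P (pvar v * p)"
    and add: "\<And>p q. P p \<Longrightarrow> P q \<Longrightarrow> P (p + q)"
  shows "P p"
proof (induction p rule: poly_mapping_induct)
  case zero
  show ?case using const[of 0] by (simp add: pconst_def)
next
  case (single m c)
  have pow: "Q (pvar v ^ n * p)" if "Q p" "\<And>v p. Q p \<Longrightarrow> Q (pvar v * p)"
    for Q :: "'k poly5 \<Rightarrow> bool" and n v p
    using that by (induction n) (auto simp: mult.assoc)
  have pvar_pow: "pvar v ^ n = Poly_Mapping.single (Poly_Mapping.single v n) (1 :: 'k)" for v n
  proof (induction n)
    case (Suc n)
    thus ?case by (simp add: pvar_def mult_single single_add[symmetric] One_nat_def)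
  qed simp
  have "m = Poly_Mapping.single V1 (Poly_Mapping.lookup m V1) + (Poly_Mapping.single V2 (Poly_Mapping.lookup m V2)
    + (Poly_Mapping.single V3 (Poly_Mapping.lookup m V3) + (Poly_Mapping.single V4 (Poly_Mapping.lookup m V4) + Poly_Mapping.single V5 (Poly_Mapping.lookup m V5))))"
    (is "m = ?m")
  proof (rule poly_mapping_eqI)
    fix v show "Poly_Mapping.lookup m v = Poly_Mapping.lookup ?m v" by (cases v) (simp_all add: lookup_add lookup_single)
  qed
  hence "Poly_Mapping.single m c = pvar V1 ^ Poly_Mapping.lookup m V1 * (pvar V2 ^ Poly_Mapping.lookup m V2 * (pvar V3 ^ Poly_Mapping.lookup m V3
    * (pvar V4 ^ Poly_Mapping.lookup m V4 * (pvar V5 ^ Poly_Mapping.lookup m V5 * pconst c))))"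
    by (simp add: pvar_pow pconst_def mult_single)
  moreover have "P (pvar V1 ^ Poly_Mapping.lookup m V1 * (pvar V2 ^ Poly_Mapping.lookup m V2 * (pvar V3 ^ Poly_Mapping.lookup m V3
    * (pvar V4 ^ Poly_Mapping.lookup m V4 * (pvar V5 ^ Poly_Mapping.lookup m V5 * pconst c)))))"
    by (intro pow[of P] var const)
  ultimately show ?case by simp
next
  case (add p q)
  thus ?case by (rule assms(3))
qed

lemma nf_ev: "p - nf (ev \<alpha> p) \<in> I_ideal \<alpha>"
proof (induction p rule: poly5_induct)
  case (const c)
  have "nf (scalar c) = pconst c" by (simp add: nf_def scalar_def pconst_simps)
  thus ?case using I_ideal_mult[OF I_ideal_gens(5), of 0 \<alpha>] by simp
next
  case (var v p)
  have "pvar v * p - nf (ev \<alpha> (pvar v * p)) =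
    pvar v * (p - nf (ev \<alpha> p)) + (pvar v * nf (ev \<alpha> p) - nf (vmul \<alpha> (gen v) (ev \<alpha> p)))"
    by (simp add: ev_mult right_diff_distrib)
  thus ?case using var nf_pvar_mult I_ideal_add I_ideal_mult by metis
next
  case (add p q)
  have "p + q - nf (ev \<alpha> (p + q)) = (p - nf (ev \<alpha> p)) + (q - nf (ev \<alpha> q))"
    by (simp add: ev_add nf_add algebra_simps)
  thus ?case using add I_ideal_add by metis
qed

text \<open>A polynomial of value zero differs from \<open>nf 0\<close>, which is 0, by an element
  of the ideal; the other inclusion is the evaluation of the generators. From here on A is the model
  algebra.\<close>

lemma I_ideal_eq: "I_ideal \<alpha> = {p. ev \<alpha> p = 0}"
proof -
  have "nf 0 = (0 :: 'a poly5)" by (simp add: nf_def pconst_simps)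
  hence "p \<in> I_ideal \<alpha>" if "ev \<alpha> p = 0" for p using nf_ev[of p \<alpha>] that by simp
  thus ?thesis using ev_I_ideal by auto
qed

section \<open>The ring \<open>A\<close>\<close>

text \<open>The isomorphism from the model algebra onto A, through which later computations in A are
  carried out.\<close>

definition emb :: "'k::field \<Rightarrow> 'k vec12 \<Rightarrow> 'k poly5 set" where
  "emb \<alpha> u = cls \<alpha> (nf u)"

lemma A_cring: "cring (A_ring \<alpha>)"
  unfolding A_ring_def by (intro ideal.quotient_is_cring[OF I_ideal_ideal]) auto

lemma cls_hom: "cls \<alpha> \<in> ring_hom P5 (A_ring \<alpha>)"
  using ideal.rcos_ring_hom[OF I_ideal_ideal] unfolding A_ring_def cls_def[abs_def] .

lemma carrier_A: "carrier (A_ring \<alpha>) = range (cls \<alpha>)"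
  by (auto simp: A_ring_def FactRing_def A_RCOSETS_def' cls_def[abs_def])

lemma cls_eq_iff: "cls \<alpha> p = cls \<alpha> q \<longleftrightarrow> ev \<alpha> p = ev \<alpha> q"
proof -
  have cls: "cls \<alpha> p = {r. ev \<alpha> r = ev \<alpha> p}" for p
  proof -
    have "r \<in> cls \<alpha> p \<longleftrightarrow> r - p \<in> I_ideal \<alpha>" for r
      by (auto simp: cls_def a_r_coset_def' intro: bexI[of _ "r - p"])
    thus ?thesis by (auto simp: I_ideal_eq ev_minus)
  qed
  show ?thesis by (auto simp: cls)
qed

lemma cls_eq_emb: "cls \<alpha> p = emb \<alpha> (ev \<alpha> p)"
  by (simp add: emb_def cls_eq_iff)

lemma emb_inj [simp]: "emb \<alpha> u = emb \<alpha> v \<longleftrightarrow> u = v"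
  by (simp add: emb_def cls_eq_iff)

lemma emb_hom: "emb \<alpha> \<in> ring_hom (model \<alpha>) (A_ring \<alpha>)"
proof (rule ring_hom_memI)
  fix u v
  show "emb \<alpha> (u \<otimes>\<^bsub>model \<alpha>\<^esub> v) = emb \<alpha> u \<otimes>\<^bsub>A_ring \<alpha>\<^esub> emb \<alpha> v"
    using ring_hom_mult[OF cls_hom, of "nf u" "nf v" \<alpha>] by (simp add: cls_eq_emb ev_mult)
  show "emb \<alpha> (u \<oplus>\<^bsub>model \<alpha>\<^esub> v) = emb \<alpha> u \<oplus>\<^bsub>A_ring \<alpha>\<^esub> emb \<alpha> v"
    using ring_hom_add[OF cls_hom, of "nf u" "nf v" \<alpha>] by (simp add: cls_eq_emb ev_add)
  show "emb \<alpha> \<one>\<^bsub>model \<alpha>\<^esub> = \<one>\<^bsub>A_ring \<alpha>\<^esub>"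
    using ring_hom_one[OF cls_hom, of \<alpha>] by (simp add: cls_eq_emb)
qed (simp add: carrier_A emb_def)

lemma carrier_A_emb: "carrier (A_ring \<alpha>) = range (emb \<alpha>)"
  unfolding carrier_A by (auto simp: cls_eq_emb) (metis ev_nf rangeI)

lemma xA_eq: "xA \<alpha> v = emb \<alpha> (gen v)"
  by (simp add: cls_eq_emb)

lemma cls_pconst: "cls \<alpha> (pconst c) = emb \<alpha> (scalar c)"
  by (simp add: cls_eq_emb)

section \<open>Quotient modules and base change\<close>

text \<open>Scalar multiplication on quotients is a union over representatives; when all of them
  yield the same coset, the union is that coset.\<close>

lemma UN_eq_const: "x \<in> A \<Longrightarrow> (\<And>y. y \<in> A \<Longrightarrow> f y = c) \<Longrightarrow> (\<Union>y\<in>A. f y) = c"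
  by auto

lemma (in module) smult_minus_distr:
  assumes "r \<in> carrier R" "x \<in> carrier M" "y \<in> carrier M"
  shows "r \<odot>\<^bsub>M\<^esub> (x \<ominus>\<^bsub>M\<^esub> y) = r \<odot>\<^bsub>M\<^esub> x \<ominus>\<^bsub>M\<^esub> r \<odot>\<^bsub>M\<^esub> y"
  using assms by (simp add: a_minus_def smult_r_distr smult_r_minus)

locale module_quotient = module R M for R (structure) and M (structure) +
  fixes K
  assumes K: "submodule K R M"
begin

lemma K_abelian: "abelian_subgroup K M"
  using submodule.axioms(1)[OF K] by (intro abelian_subgroupI3 additive_subgroup.intro M.abelian_group_axioms)

sublocale K: abelian_subgroup K M by (rule K_abelian)

definition proj :: "'c \<Rightarrow> 'c set" where "proj x = K +>\<^bsub>M\<^esub> x"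

lemma proj_eq_iff:
  assumes "x \<in> carrier M" "y \<in> carrier M"
  shows "proj x = proj y \<longleftrightarrow> x \<ominus>\<^bsub>M\<^esub> y \<in> K"
proof -
  have "x \<ominus>\<^bsub>M\<^esub> y \<in> K \<longleftrightarrow> x \<in> K +>\<^bsub>M\<^esub> y" using K.a_rcos_module[OF assms(2,1)] by (simp add: a_minus_def)
  also have "\<dots> \<longleftrightarrow> K +>\<^bsub>M\<^esub> x = K +>\<^bsub>M\<^esub> y"
    using K.a_rcos_self[OF assms(1)] M.a_repr_independence[OF _ assms(2) submodule.axioms(1)[OF K]] by blast
  finally show ?thesis by (simp add: proj_def)
qed

lemma proj_eq_zero_iff: "x \<in> carrier M \<Longrightarrow> proj x = K \<longleftrightarrow> x \<in> K"
  using M.a_coset_join2[OF _ submodule.axioms(1)[OF K]] K.a_rcos_self unfolding proj_def by blast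

lemma mem_proj: "x \<in> carrier M \<Longrightarrow> y \<in> proj x \<Longrightarrow> y \<in> carrier M \<and> proj y = proj x"
  using M.a_repr_independence[OF _ _ submodule.axioms(1)[OF K]] K.a_elemrcos_carrier unfolding proj_def by blast

lemma quot_carrier: "carrier (quot_mod M K) = proj ` carrier M"
  by (auto simp: quot_mod_def A_RCOSETS_def' proj_def)

lemma quot_zero: "\<zero>\<^bsub>quot_mod M K\<^esub> = K"
  by (simp add: quot_mod_def)

lemma quot_add: "x \<in> carrier M \<Longrightarrow> y \<in> carrier M \<Longrightarrow> proj x \<oplus>\<^bsub>quot_mod M K\<^esub> proj y = proj (x \<oplus>\<^bsub>M\<^esub> y)"
  by (simp add: quot_mod_def proj_def K.a_rcos_sum)

lemma quot_smult:
  assumes "r \<in> carrier R" "x \<in> carrier M"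
  shows "r \<odot>\<^bsub>quot_mod M K\<^esub> proj x = proj (r \<odot>\<^bsub>M\<^esub> x)"
proof -
  have "K +>\<^bsub>M\<^esub> (r \<odot>\<^bsub>M\<^esub> y) = proj (r \<odot>\<^bsub>M\<^esub> x)" if y: "y \<in> proj x" for y
  proof -
    have yc: "y \<in> carrier M" and "y \<ominus>\<^bsub>M\<^esub> x \<in> K" using mem_proj[OF assms(2) y] proj_eq_iff assms by auto
    hence "r \<odot>\<^bsub>M\<^esub> (y \<ominus>\<^bsub>M\<^esub> x) \<in> K" using submodule.smult_closed[OF K assms(1)] by blast
    thus ?thesis using assms yc unfolding proj_def[symmetric] by (subst proj_eq_iff) (auto simp: smult_minus_distr)
  qed
  moreover have "x \<in> proj x" using K.a_rcos_self[OF assms(2)] by (simp add: proj_def)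
  ultimately have "(\<Union>y\<in>proj x. K +>\<^bsub>M\<^esub> (r \<odot>\<^bsub>M\<^esub> y)) = proj (r \<odot>\<^bsub>M\<^esub> x)" by (intro UN_eq_const)
  thus ?thesis by (simp add: quot_mod_def)
qed

lemma quot_module: "module R (quot_mod M K)"
proof (rule moduleI)
  show "abelian_group (quot_mod M K)"
  proof (rule abelian_groupI)
    show "\<zero>\<^bsub>quot_mod M K\<^esub> \<in> carrier (quot_mod M K)"
      using proj_eq_zero_iff[of "\<zero>\<^bsub>M\<^esub>"] by (auto simp: quot_carrier quot_zero)
  next
    fix x assume "x \<in> carrier (quot_mod M K)"
    then obtain u where u: "u \<in> carrier M" "x = proj u" by (auto simp: quot_carrier)
    have z: "proj \<zero>\<^bsub>M\<^esub> = K" using proj_eq_zero_iff[of "\<zero>\<^bsub>M\<^esub>"] by simp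
    show "\<zero>\<^bsub>quot_mod M K\<^esub> \<oplus>\<^bsub>quot_mod M K\<^esub> x = x"
      using quot_add[OF M.zero_closed u(1)] u by (simp add: quot_zero z)
    show "\<exists>y\<in>carrier (quot_mod M K). y \<oplus>\<^bsub>quot_mod M K\<^esub> x = \<zero>\<^bsub>quot_mod M K\<^esub>"
      using u by (intro bexI[of _ "proj (\<ominus>\<^bsub>M\<^esub> u)"]) (auto simp: quot_add quot_carrier M.l_neg quot_zero z)
  next
    fix x y assume "x \<in> carrier (quot_mod M K)" "y \<in> carrier (quot_mod M K)"
    then obtain u v where "u \<in> carrier M" "x = proj u" "v \<in> carrier M" "y = proj v" by (auto simp: quot_carrier)
    thus "x \<oplus>\<^bsub>quot_mod M K\<^esub> y \<in> carrier (quot_mod M K)"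
      "x \<oplus>\<^bsub>quot_mod M K\<^esub> y = y \<oplus>\<^bsub>quot_mod M K\<^esub> x"
      by (simp_all add: quot_carrier quot_add M.a_comm)
  next
    fix x y z assume "x \<in> carrier (quot_mod M K)" "y \<in> carrier (quot_mod M K)" "z \<in> carrier (quot_mod M K)"
    then obtain u v w where "u \<in> carrier M" "x = proj u" "v \<in> carrier M" "y = proj v" "w \<in> carrier M" "z = proj w"
      by (auto simp: quot_carrier)
    thus "x \<oplus>\<^bsub>quot_mod M K\<^esub> y \<oplus>\<^bsub>quot_mod M K\<^esub> z = x \<oplus>\<^bsub>quot_mod M K\<^esub> (y \<oplus>\<^bsub>quot_mod M K\<^esub> z)"
      by (simp add: quot_add M.a_assoc)
  qed
next
  fix a b x y assume *: "a \<in> carrier R" "b \<in> carrier R" "x \<in> carrier (quot_mod M K)" "y \<in> carrier (quot_mod M K)"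
  then obtain u v where "u \<in> carrier M" "x = proj u" "v \<in> carrier M" "y = proj v" by (auto simp: quot_carrier)
  with * show "(a \<oplus> b) \<odot>\<^bsub>quot_mod M K\<^esub> x = a \<odot>\<^bsub>quot_mod M K\<^esub> x \<oplus>\<^bsub>quot_mod M K\<^esub> b \<odot>\<^bsub>quot_mod M K\<^esub> x"
    "a \<odot>\<^bsub>quot_mod M K\<^esub> (x \<oplus>\<^bsub>quot_mod M K\<^esub> y) = a \<odot>\<^bsub>quot_mod M K\<^esub> x \<oplus>\<^bsub>quot_mod M K\<^esub> a \<odot>\<^bsub>quot_mod M K\<^esub> y"
    "(a \<otimes> b) \<odot>\<^bsub>quot_mod M K\<^esub> x = a \<odot>\<^bsub>quot_mod M K\<^esub> (b \<odot>\<^bsub>quot_mod M K\<^esub> x)"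
    by (simp_all add: quot_add quot_smult smult_l_distr smult_r_distr smult_assoc1)
next
  show "cring R" by (rule R.is_cring)
next
  fix a x assume "a \<in> carrier R" "x \<in> carrier (quot_mod M K)"
  thus "a \<odot>\<^bsub>quot_mod M K\<^esub> x \<in> carrier (quot_mod M K)" by (auto simp: quot_carrier quot_smult)
next
  fix x assume "x \<in> carrier (quot_mod M K)"
  thus "\<one> \<odot>\<^bsub>quot_mod M K\<^esub> x = x" by (auto simp: quot_carrier quot_smult)
qed

lemma proj_hom: "proj \<in> mod_hom R M (quot_mod M K)"
  by (auto simp: mod_hom_def quot_carrier quot_add quot_smult)

end

lemma mod_span_submodule:
  assumes "module R M" "C \<subseteq> carrier M"
  shows "submodule (mod_span R M C) R M"
proof -
  interpret module R M by fact
  have *: "submodule (carrier M) R M" by (rule carrier_is_submodule)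
  show ?thesis
  proof (rule submoduleI)
    show "mod_span R M C \<subseteq> carrier M" unfolding mod_span_def using * assms(2) by blast
    show "\<zero>\<^bsub>M\<^esub> \<in> mod_span R M C" unfolding mod_span_def
      using subgroup.one_closed[OF submodule.axioms(1)] by fastforce
  qed (auto simp: mod_span_def dest: submoduleE)
qed

lemma mod_span_minimal: "submodule H R M \<Longrightarrow> C \<subseteq> H \<Longrightarrow> mod_span R M C \<subseteq> H"
  unfolding mod_span_def by blast

lemma mod_span_incl: "C \<subseteq> mod_span R M C"
  unfolding mod_span_def by blast

lemma regular_mod_sel [simp]:
  "carrier (regular_mod R) = carrier R" "\<zero>\<^bsub>regular_mod R\<^esub> = \<zero>\<^bsub>R\<^esub>"
  "x \<oplus>\<^bsub>regular_mod R\<^esub> y = x \<oplus>\<^bsub>R\<^esub> y" "x \<odot>\<^bsub>regular_mod R\<^esub> y = x \<otimes>\<^bsub>R\<^esub> y"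
  by (simp_all add: regular_mod_def)

lemma (in cring) regular_mod_module: "module R (regular_mod R)"
proof (rule moduleI)
  show "abelian_group (regular_mod R)"
  proof (rule abelian_groupI)
    fix x assume "x \<in> carrier (regular_mod R)"
    thus "\<exists>y\<in>carrier (regular_mod R). y \<oplus>\<^bsub>regular_mod R\<^esub> x = \<zero>\<^bsub>regular_mod R\<^esub>"
      by (intro bexI[of _ "\<ominus> x"]) (auto simp: l_neg)
  qed (auto simp: a_ac)
qed (auto simp: l_distr r_distr m_assoc is_cring)

text \<open>Makes T_q, and also R/I as a factor of the tensor product, instances of
  \<open>module_quotient\<close>.\<close>

lemma (in cring) regular_quotient:
  assumes "ideal J R"
  shows "module_quotient R (regular_mod R) J"
proof -
  interpret J: ideal J R by fact
  interpret N: module R "regular_mod R" by (rule regular_mod_module)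
  have neg: "\<ominus>\<^bsub>regular_mod R\<^esub> x = \<ominus> x" if "x \<in> carrier R" for x
    using that N.minus_equality[of "\<ominus> x" x] by (simp add: l_neg)
  have "submodule J R (regular_mod R)"
  proof (rule N.submoduleI)
    fix a assume "a \<in> J"
    thus "\<ominus>\<^bsub>regular_mod R\<^esub> a \<in> J" using J.a_inv_closed neg J.a_Hcarr by auto
  qed (auto simp: J.I_l_closed)
  thus ?thesis by (rule module_quotient.intro[OF N.module_axioms module_quotient_axioms.intro])
qed

text \<open>The chosen element of the coset differs from \<open>r\<close> by an element of
  \<open>I\<close>, which acts as zero.\<close>

lemma quot_scalars_smult:
  assumes "cring R" "ideal I R" "module R N" "\<And>r n. r \<in> I \<Longrightarrow> n \<in> carrier N \<Longrightarrow> r \<odot>\<^bsub>N\<^esub> n = \<zero>\<^bsub>N\<^esub>"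
    "r \<in> carrier R" "n \<in> carrier N"
  shows "(I +>\<^bsub>R\<^esub> r) \<odot>\<^bsub>quot_scalars N\<^esub> n = r \<odot>\<^bsub>N\<^esub> n"
proof -
  interpret R: cring R by fact
  interpret I: ideal I R by fact
  interpret N: module R N by fact
  let ?s = "SOME s. s \<in> I +>\<^bsub>R\<^esub> r"
  have "?s \<in> I +>\<^bsub>R\<^esub> r" using I.a_rcos_self[OF assms(5)] by (rule someI)
  then obtain k where k: "k \<in> I" "?s = k \<oplus>\<^bsub>R\<^esub> r" by (auto simp: a_r_coset_def')
  have "?s \<odot>\<^bsub>N\<^esub> n = k \<odot>\<^bsub>N\<^esub> n \<oplus>\<^bsub>N\<^esub> r \<odot>\<^bsub>N\<^esub> n"
    unfolding k(2) using k(1) assms(5,6) I.a_Hcarr by (simp add: N.smult_l_distr)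
  also have "\<dots> = r \<odot>\<^bsub>N\<^esub> n" using assms(4)[OF k(1) assms(6)] assms(5,6) by simp
  finally show ?thesis by (simp add: quot_scalars_def)
qed

lemma Quot_carrier: "carrier (R Quot I) = (\<lambda>r. I +>\<^bsub>R\<^esub> r) ` carrier R"
  by (auto simp: FactRing_def A_RCOSETS_def')

lemma quot_scalars_module:
  assumes R: "cring R" and I: "ideal I R" and N: "module R N"
    and ann: "\<And>r n. r \<in> I \<Longrightarrow> n \<in> carrier N \<Longrightarrow> r \<odot>\<^bsub>N\<^esub> n = \<zero>\<^bsub>N\<^esub>"
  shows "module (R Quot I) (quot_scalars N)"
proof -
  interpret R: cring R by fact
  interpret I: ideal I R by fact
  interpret N: module R N by fact
  note smult = quot_scalars_smult[OF R I N ann]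
  note hom = I.rcos_ring_hom
  note homs = ring_hom_add[OF hom, symmetric] ring_hom_mult[OF hom, symmetric] ring_hom_one[OF hom, symmetric]
  have cr: "carrier (quot_scalars N) = carrier N" "add (quot_scalars N) = add N" "\<zero>\<^bsub>quot_scalars N\<^esub> = \<zero>\<^bsub>N\<^esub>"
    by (simp_all add: quot_scalars_def)
  show ?thesis
  proof (rule moduleI)
    show "cring (R Quot I)" by (rule I.quotient_is_cring[OF R])
    show "abelian_group (quot_scalars N)"
    proof (rule abelian_groupI)
      fix x assume "x \<in> carrier (quot_scalars N)"
      thus "\<exists>y\<in>carrier (quot_scalars N). y \<oplus>\<^bsub>quot_scalars N\<^esub> x = \<zero>\<^bsub>quot_scalars N\<^esub>"
        by (intro bexI[of _ "\<ominus>\<^bsub>N\<^esub> x"]) (auto simp: cr N.l_neg)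
    qed (auto simp: cr N.a_ac)
  qed (auto simp: Quot_carrier cr smult homs N.smult_l_distr N.smult_r_distr N.smult_assoc1)
qed

text \<open>\<open>M'\<close> receives \<open>M \<otimes> R/I\<close> through \<open>red\<close>; the map is injective because, by the last assumption,
  relations between the images of the two generators of \<open>M\<close> lift to relations in \<open>M\<close>.\<close>

locale base_change = R: cring R + I: ideal I R + M: module R M + M': module "R Quot I" M'
  for R :: "('r, 'x) ring_scheme" (structure) and I and M :: "('r, 'm, 'y) module_scheme" (structure)
    and M' :: "('r set, 'n, 'z) module_scheme" +
  fixes red :: "'m \<Rightarrow> 'n" and m1 m2 :: 'm
  assumes red_closed: "m \<in> carrier M \<Longrightarrow> red m \<in> carrier M'"
    and red_add: "m \<in> carrier M \<Longrightarrow> m' \<in> carrier M \<Longrightarrow> red (m \<oplus>\<^bsub>M\<^esub> m') = red m \<oplus>\<^bsub>M'\<^esub> red m'"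
    and red_smult: "r \<in> carrier R \<Longrightarrow> m \<in> carrier M \<Longrightarrow> red (r \<odot>\<^bsub>M\<^esub> m) = (I +> r) \<odot>\<^bsub>M'\<^esub> red m"
    and m12: "m1 \<in> carrier M" "m2 \<in> carrier M"
    and generate: "m \<in> carrier M \<Longrightarrow> \<exists>r1\<in>carrier R. \<exists>r2\<in>carrier R. m = r1 \<odot>\<^bsub>M\<^esub> m1 \<oplus>\<^bsub>M\<^esub> r2 \<odot>\<^bsub>M\<^esub> m2"
    and lift_relation: "r1 \<in> carrier R \<Longrightarrow> r2 \<in> carrier R \<Longrightarrow>
      (I +> r1) \<odot>\<^bsub>M'\<^esub> red m1 \<oplus>\<^bsub>M'\<^esub> (I +> r2) \<odot>\<^bsub>M'\<^esub> red m2 = \<zero>\<^bsub>M'\<^esub> \<Longrightarrow>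
      \<exists>s1\<in>carrier R. \<exists>s2\<in>carrier R. I +> s1 = I +> r1 \<and> I +> s2 = I +> r2 \<and>
        s1 \<odot>\<^bsub>M\<^esub> m1 \<oplus>\<^bsub>M\<^esub> s2 \<odot>\<^bsub>M\<^esub> m2 = \<zero>\<^bsub>M\<^esub>"
begin

abbreviation "N \<equiv> quot_mod (regular_mod R) I"
abbreviation "B \<equiv> R Quot I"
abbreviation "F \<equiv> free_mod R (carrier M \<times> carrier N)"
abbreviation "e m t \<equiv> basis_vec R (m, t)"
abbreviation "Rel \<equiv> tensor_rels R M N"
abbreviation "\<pi> r \<equiv> I +> r"

sublocale F: module R F by (rule R.free_mod_module)
sublocale NQ: module_quotient R "regular_mod R" I by (rule R.regular_quotient) (rule I.is_ideal)
sublocale N: module R N by (rule NQ.quot_module)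
lemma proj_eq: "NQ.proj r = \<pi> r"
  by (simp add: NQ.proj_def a_r_coset_def')

text \<open>\<open>N\<close> is R/I as a module and \<open>B\<close> is R/I as a ring; both are made
  of the same cosets, so elements can pass between them.\<close>

lemma carrier_N: "carrier N = carrier B"
  unfolding NQ.quot_carrier Quot_carrier proj_eq by simp

lemma \<pi>_closed: "r \<in> carrier R \<Longrightarrow> \<pi> r \<in> carrier N"
  unfolding carrier_N Quot_carrier by blast

lemma \<pi>_hom: "\<pi> \<in> ring_hom R B"
  by (rule I.rcos_ring_hom)

lemma N_add: "t \<in> carrier N \<Longrightarrow> t' \<in> carrier N \<Longrightarrow> t \<oplus>\<^bsub>N\<^esub> t' = t \<oplus>\<^bsub>B\<^esub> t'"
  using NQ.quot_add ring_hom_add[OF \<pi>_hom] unfolding carrier_N Quot_carrier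
  by (auto simp: proj_eq)

lemma N_smult: "r \<in> carrier R \<Longrightarrow> t \<in> carrier N \<Longrightarrow> r \<odot>\<^bsub>N\<^esub> t = \<pi> r \<otimes>\<^bsub>B\<^esub> t"
  using NQ.quot_smult ring_hom_mult[OF \<pi>_hom] unfolding carrier_N Quot_carrier
  by (auto simp: proj_eq)

lemma e_closed: "m \<in> carrier M \<Longrightarrow> t \<in> carrier N \<Longrightarrow> e m t \<in> carrier F"
  by (intro R.basis_vec_closed) auto

text \<open>The four families of bilinear relations, given a name of their own so that they can be
  treated case by case.\<close>

definition rel_gens :: "('m \<times> 'r set \<Rightarrow> 'r) set" where
  "rel_gens = {e (m \<oplus>\<^bsub>M\<^esub> m') n \<ominus>\<^bsub>F\<^esub> (e m n \<oplus>\<^bsub>F\<^esub> e m' n) |m m' n.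
           m \<in> carrier M \<and> m' \<in> carrier M \<and> n \<in> carrier N} \<union>
       {e m (n \<oplus>\<^bsub>N\<^esub> n') \<ominus>\<^bsub>F\<^esub> (e m n \<oplus>\<^bsub>F\<^esub> e m n') |m n n'.
           m \<in> carrier M \<and> n \<in> carrier N \<and> n' \<in> carrier N} \<union>
       {e (r \<odot>\<^bsub>M\<^esub> m) n \<ominus>\<^bsub>F\<^esub> (r \<odot>\<^bsub>F\<^esub> e m n) |r m n.
           r \<in> carrier R \<and> m \<in> carrier M \<and> n \<in> carrier N} \<union>
       {e m (r \<odot>\<^bsub>N\<^esub> n) \<ominus>\<^bsub>F\<^esub> (r \<odot>\<^bsub>F\<^esub> e m n) |r m n.
           r \<in> carrier R \<and> m \<in> carrier M \<and> n \<in> carrier N}"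

lemma Rel_eq: "Rel = mod_span R F rel_gens"
  by (simp only: tensor_rels_def rel_gens_def Let_def)

lemma rel_gensE:
  assumes "g \<in> rel_gens"
  obtains m m' n where "m \<in> carrier M" "m' \<in> carrier M" "n \<in> carrier N"
      "g = e (m \<oplus>\<^bsub>M\<^esub> m') n \<ominus>\<^bsub>F\<^esub> (e m n \<oplus>\<^bsub>F\<^esub> e m' n)"
  | m n n' where "m \<in> carrier M" "n \<in> carrier N" "n' \<in> carrier N"
      "g = e m (n \<oplus>\<^bsub>N\<^esub> n') \<ominus>\<^bsub>F\<^esub> (e m n \<oplus>\<^bsub>F\<^esub> e m n')"
  | r m n where "r \<in> carrier R" "m \<in> carrier M" "n \<in> carrier N" "g = e (r \<odot>\<^bsub>M\<^esub> m) n \<ominus>\<^bsub>F\<^esub> (r \<odot>\<^bsub>F\<^esub> e m n)"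
  | r m n where "r \<in> carrier R" "m \<in> carrier M" "n \<in> carrier N" "g = e m (r \<odot>\<^bsub>N\<^esub> n) \<ominus>\<^bsub>F\<^esub> (r \<odot>\<^bsub>F\<^esub> e m n)"
  using assms unfolding rel_gens_def by (elim UnE CollectE exE conjE) (rule that; assumption)+

lemma rel_gens_closed: "rel_gens \<subseteq> carrier F"
proof
  fix g assume "g \<in> rel_gens"
  thus "g \<in> carrier F"
    by (cases rule: rel_gensE) (simp_all add: e_closed)
qed

sublocale Q: module_quotient R F Rel
  by (rule module_quotient.intro[OF F.module_axioms module_quotient_axioms.intro])
    (unfold Rel_eq, rule mod_span_submodule[OF F.module_axioms rel_gens_closed])

section \<open>Pure tensors, and the map from the tensor product to M'\<close>

definition tens :: "'m \<Rightarrow> 'r set \<Rightarrow> ('m \<times> 'r set \<Rightarrow> 'r) set" where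
  "tens m t = Q.proj (e m t)"

abbreviation "T \<equiv> tensor R M N"

lemma T_eq: "T = quot_mod F Rel"
  by (simp add: tensor_def)

sublocale T: module R T
  unfolding T_eq by (rule Q.quot_module)

lemma proj_F_hom: "Q.proj \<in> mod_hom R F T"
  unfolding T_eq by (rule Q.proj_hom)

lemma tens_closed: "m \<in> carrier M \<Longrightarrow> t \<in> carrier N \<Longrightarrow> tens m t \<in> carrier T"
  unfolding tens_def using mod_hom_closed[OF proj_F_hom] e_closed by blast

lemma proj_eqI:
  assumes "f \<in> carrier F" "g \<in> carrier F" "f \<ominus>\<^bsub>F\<^esub> g \<in> rel_gens"
  shows "Q.proj f = Q.proj g"
  using assms mod_span_incl[of rel_gens R F] by (subst Q.proj_eq_iff) (auto simp: Rel_eq)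

lemma tens_add_l:
  assumes "m \<in> carrier M" "m' \<in> carrier M" "t \<in> carrier N"
  shows "tens (m \<oplus>\<^bsub>M\<^esub> m') t = tens m t \<oplus>\<^bsub>T\<^esub> tens m' t"
proof -
  have "Q.proj (e (m \<oplus>\<^bsub>M\<^esub> m') t) = Q.proj (e m t \<oplus>\<^bsub>F\<^esub> e m' t)"
    by (rule proj_eqI) (use assms in \<open>auto intro!: e_closed F.a_closed simp: rel_gens_def\<close>)
  thus ?thesis using assms by (simp add: tens_def mod_hom_add[OF proj_F_hom] e_closed)
qed

lemma tens_add_r:
  assumes "m \<in> carrier M" "t \<in> carrier N" "t' \<in> carrier N"
  shows "tens m (t \<oplus>\<^bsub>N\<^esub> t') = tens m t \<oplus>\<^bsub>T\<^esub> tens m t'"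
proof -
  have "Q.proj (e m (t \<oplus>\<^bsub>N\<^esub> t')) = Q.proj (e m t \<oplus>\<^bsub>F\<^esub> e m t')"
    by (rule proj_eqI) (use assms in \<open>auto intro!: e_closed F.a_closed simp: rel_gens_def\<close>)
  thus ?thesis using assms by (simp add: tens_def mod_hom_add[OF proj_F_hom] e_closed)
qed

lemma tens_smult_l:
  assumes "r \<in> carrier R" "m \<in> carrier M" "t \<in> carrier N"
  shows "tens (r \<odot>\<^bsub>M\<^esub> m) t = r \<odot>\<^bsub>T\<^esub> tens m t"
proof -
  have "Q.proj (e (r \<odot>\<^bsub>M\<^esub> m) t) = Q.proj (r \<odot>\<^bsub>F\<^esub> e m t)"
    by (rule proj_eqI) (use assms in \<open>auto intro!: e_closed F.smult_closed simp: rel_gens_def\<close>)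
  thus ?thesis using assms by (simp add: tens_def mod_hom_smult[OF proj_F_hom] e_closed)
qed

lemma tens_smult_r:
  assumes "r \<in> carrier R" "m \<in> carrier M" "t \<in> carrier N"
  shows "tens m (r \<odot>\<^bsub>N\<^esub> t) = r \<odot>\<^bsub>T\<^esub> tens m t"
proof -
  have "Q.proj (e m (r \<odot>\<^bsub>N\<^esub> t)) = Q.proj (r \<odot>\<^bsub>F\<^esub> e m t)"
    by (rule proj_eqI) (use assms in \<open>auto intro!: e_closed F.smult_closed simp: rel_gens_def\<close>)
  thus ?thesis using assms by (simp add: tens_def mod_hom_smult[OF proj_F_hom] e_closed)
qed

definition gen_tens :: "'r set \<Rightarrow> 'r set \<Rightarrow> ('m \<times> 'r set \<Rightarrow> 'r) set" where
  "gen_tens t1 t2 = tens m1 t1 \<oplus>\<^bsub>T\<^esub> tens m2 t2"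

lemma gen_tens_add:
  assumes "t1 \<in> carrier N" "t2 \<in> carrier N" "s1 \<in> carrier N" "s2 \<in> carrier N"
  shows "gen_tens t1 t2 \<oplus>\<^bsub>T\<^esub> gen_tens s1 s2 = gen_tens (t1 \<oplus>\<^bsub>N\<^esub> s1) (t2 \<oplus>\<^bsub>N\<^esub> s2)"
  using assms m12 by (simp add: gen_tens_def tens_add_r tens_closed T.a_ac)

text \<open>Since \<open>m1\<close> and \<open>m2\<close> generate M, the tensor of r1 m1 + r2 m2
  with t equals that of m1 with r1 t plus that of m2 with r2 t, and sums keep this shape.\<close>

lemma proj_eq_gen_tens:
  assumes "f \<in> carrier F"
  shows "\<exists>t1\<in>carrier N. \<exists>t2\<in>carrier N. Q.proj f = gen_tens t1 t2"
  using assms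
proof (induction rule: R.free_mod_induct)
  case zero
  have "tens m \<zero>\<^bsub>N\<^esub> = \<zero>\<^bsub>T\<^esub>" if "m \<in> carrier M" for m
    using tens_smult_r[of "\<zero>" m "\<zero>\<^bsub>N\<^esub>"] that tens_closed[of m "\<zero>\<^bsub>N\<^esub>"] by simp
  hence "gen_tens \<zero>\<^bsub>N\<^esub> \<zero>\<^bsub>N\<^esub> = \<zero>\<^bsub>T\<^esub>" using m12 by (simp add: gen_tens_def)
  thus ?case using mod_hom_zero[OF F.module_axioms T.module_axioms proj_F_hom] N.zero_closed by metis
next
  case (add r b g)
  obtain m t where b: "b = (m, t)" "m \<in> carrier M" "t \<in> carrier N" using add.hyps by auto
  obtain s1 s2 where s: "s1 \<in> carrier N" "s2 \<in> carrier N" "Q.proj g = gen_tens s1 s2" using add.IH by blast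
  obtain r1 r2 where m: "r1 \<in> carrier R" "r2 \<in> carrier R" "m = r1 \<odot>\<^bsub>M\<^esub> m1 \<oplus>\<^bsub>M\<^esub> r2 \<odot>\<^bsub>M\<^esub> m2"
    using generate[OF b(2)] by blast
  have "Q.proj (r \<odot>\<^bsub>F\<^esub> e m t \<oplus>\<^bsub>F\<^esub> g) = r \<odot>\<^bsub>T\<^esub> tens m t \<oplus>\<^bsub>T\<^esub> Q.proj g"
    using add.hyps b by (simp add: tens_def mod_hom_add[OF proj_F_hom] mod_hom_smult[OF proj_F_hom] e_closed)
  also have "r \<odot>\<^bsub>T\<^esub> tens m t = tens m (r \<odot>\<^bsub>N\<^esub> t)" using add.hyps b by (simp add: tens_smult_r)
  also have "\<dots> = gen_tens (r1 \<odot>\<^bsub>N\<^esub> (r \<odot>\<^bsub>N\<^esub> t)) (r2 \<odot>\<^bsub>N\<^esub> (r \<odot>\<^bsub>N\<^esub> t))"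
    using add.hyps b m m12 unfolding gen_tens_def m(3)
    by (simp add: tens_add_l tens_smult_l tens_smult_r[of r1] tens_smult_r[of r2])
  finally have "Q.proj (r \<odot>\<^bsub>F\<^esub> e m t \<oplus>\<^bsub>F\<^esub> g)
      = gen_tens (r1 \<odot>\<^bsub>N\<^esub> (r \<odot>\<^bsub>N\<^esub> t) \<oplus>\<^bsub>N\<^esub> s1) (r2 \<odot>\<^bsub>N\<^esub> (r \<odot>\<^bsub>N\<^esub> t) \<oplus>\<^bsub>N\<^esub> s2)"
    using s add.hyps b m by (simp add: gen_tens_add)
  thus ?case unfolding b(1) using s add.hyps b m by (metis N.smult_closed N.a_closed)
qed

text \<open>M' with scalars restricted to R, because the tensor product and the linear extension
  live over R.\<close>

definition M'R :: "('r, 'n) module" where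
  "M'R = \<lparr>carrier = carrier M', monoid.mult = undefined, one = undefined,
     ring.zero = \<zero>\<^bsub>M'\<^esub>, add = add M', module.smult = (\<lambda>r. module.smult M' (\<pi> r))\<rparr>"

lemma M'R_sel [simp]: "carrier M'R = carrier M'" "\<zero>\<^bsub>M'R\<^esub> = \<zero>\<^bsub>M'\<^esub>" "x \<oplus>\<^bsub>M'R\<^esub> y = x \<oplus>\<^bsub>M'\<^esub> y"
  "r \<odot>\<^bsub>M'R\<^esub> x = \<pi> r \<odot>\<^bsub>M'\<^esub> x"
  by (simp_all add: M'R_def)

lemma \<pi>_B: "r \<in> carrier R \<Longrightarrow> \<pi> r \<in> carrier B"
  using \<pi>_closed carrier_N by simp

sublocale M'R: module R M'R
proof (rule moduleI)
  show "abelian_group M'R"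
  proof (rule abelian_groupI)
    fix x assume "x \<in> carrier M'R"
    thus "\<exists>y\<in>carrier M'R. y \<oplus>\<^bsub>M'R\<^esub> x = \<zero>\<^bsub>M'R\<^esub>"
      by (intro bexI[of _ "\<ominus>\<^bsub>M'\<^esub> x"]) (auto simp: M'.l_neg)
  qed (auto simp: M'.a_ac)
qed (auto simp: \<pi>_B ring_hom_add[OF \<pi>_hom] ring_hom_mult[OF \<pi>_hom] ring_hom_one[OF \<pi>_hom]
    M'.smult_l_distr M'.smult_r_distr M'.smult_assoc1 R.is_cring)

definition \<Phi> :: "('m \<times> 'r set \<Rightarrow> 'r) \<Rightarrow> 'n" where
  "\<Phi> = lin_ext R M'R (\<lambda>(m, t). t \<odot>\<^bsub>M'\<^esub> red m)"

lemma \<Phi>_basis_closed: "(\<lambda>(m, t). t \<odot>\<^bsub>M'\<^esub> red m) \<in> carrier M \<times> carrier N \<rightarrow> carrier M'R"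
  using red_closed by (auto simp: carrier_N)

lemma \<Phi>_hom: "\<Phi> \<in> mod_hom R F M'R"
  unfolding \<Phi>_def by (rule M'R.lin_ext_hom[OF \<Phi>_basis_closed])

lemma \<Phi>_e: "m \<in> carrier M \<Longrightarrow> t \<in> carrier N \<Longrightarrow> \<Phi> (e m t) = t \<odot>\<^bsub>M'\<^esub> red m"
  unfolding \<Phi>_def by (subst M'R.lin_ext_basis_vec[OF \<Phi>_basis_closed]) auto

text \<open>The kernel of \<Phi> is a submodule, so it suffices to check the four families of
  generators; \<Phi> then factors through the tensor product.\<close>

lemma Rel_subset_kernel: "f \<in> Rel \<Longrightarrow> f \<in> carrier F \<and> \<Phi> f = \<zero>\<^bsub>M'\<^esub>"
proof -
  have "rel_gens \<subseteq> {f \<in> carrier F. \<Phi> f = \<zero>\<^bsub>M'R\<^esub>}"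
  proof
    fix g assume g: "g \<in> rel_gens"
    have D: "\<Phi> (f \<ominus>\<^bsub>F\<^esub> h) = \<zero>\<^bsub>M'R\<^esub>" if "f \<in> carrier F" "h \<in> carrier F" "\<Phi> f = \<Phi> h" for f h
      using that mod_hom_closed[OF \<Phi>_hom, of h]
      by (simp only: mod_hom_minus[OF F.module_axioms M'R.module_axioms \<Phi>_hom] M'R.minus_eq_zero_iff)
    note simps = e_closed \<Phi>_e mod_hom_add[OF \<Phi>_hom] mod_hom_smult[OF \<Phi>_hom] red_closed red_add red_smult
      M'.smult_l_distr M'.smult_r_distr M'.smult_assoc1[symmetric] N_add N_smult \<pi>_closed carrier_N[symmetric] M'.R.m_comm
    from g have "\<Phi> g = \<zero>\<^bsub>M'R\<^esub>"
    proof (cases rule: rel_gensE)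
      case (1 m m' n)
      show ?thesis unfolding 1(4) using 1(1-3) by (intro D) (simp_all add: simps)
    next
      case (2 m n n')
      hence "n \<oplus>\<^bsub>N\<^esub> n' \<in> carrier N" by simp
      thus ?thesis unfolding 2(4) using 2(1-3) by (intro D) (simp_all add: simps)
    next
      case (3 r m n)
      show ?thesis unfolding 3(4) using 3(1-3) by (intro D) (simp_all add: simps)
    next
      case (4 r m n)
      hence "r \<odot>\<^bsub>N\<^esub> n \<in> carrier N" by simp
      thus ?thesis unfolding 4(4) using 4(1-3) by (intro D) (simp_all add: simps)
    qed
    thus "g \<in> {f \<in> carrier F. \<Phi> f = \<zero>\<^bsub>M'R\<^esub>}" using g rel_gens_closed by blast
  qed
  from mod_span_minimal[OF F.kernel_submodule[OF M'R.module_axioms \<Phi>_hom] this]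
  show "f \<in> Rel \<Longrightarrow> f \<in> carrier F \<and> \<Phi> f = \<zero>\<^bsub>M'\<^esub>" unfolding Rel_eq by auto
qed

definition \<phi> :: "('m \<times> 'r set \<Rightarrow> 'r) set \<Rightarrow> 'n" where
  "\<phi> C = \<Phi> (SOME f. f \<in> C)"

lemma \<phi>_proj:
  assumes "f \<in> carrier F"
  shows "\<phi> (Q.proj f) = \<Phi> f"
proof -
  let ?g = "SOME g. g \<in> Q.proj f"
  have "?g \<in> Q.proj f" using Q.K.a_rcos_self[OF assms] unfolding Q.proj_def by (rule someI[where P = "\<lambda>g. g \<in> _"])
  hence g: "?g \<in> carrier F" "Q.proj ?g = Q.proj f" using Q.mem_proj[OF assms] by auto
  hence "?g \<ominus>\<^bsub>F\<^esub> f \<in> Rel" using Q.proj_eq_iff assms by blast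
  hence "\<Phi> (?g \<ominus>\<^bsub>F\<^esub> f) = \<zero>\<^bsub>M'R\<^esub>" using Rel_subset_kernel by simp
  hence "\<Phi> ?g \<ominus>\<^bsub>M'R\<^esub> \<Phi> f = \<zero>\<^bsub>M'R\<^esub>"
    using mod_hom_minus[OF F.module_axioms M'R.module_axioms \<Phi>_hom g(1) assms] by simp
  thus ?thesis unfolding \<phi>_def
    using M'R.minus_eq_zero_iff mod_hom_closed[OF \<Phi>_hom] g(1) assms by blast
qed

lemma \<phi>_hom: "\<phi> \<in> mod_hom R T M'R"
proof -
  have c: "carrier T = Q.proj ` carrier F" unfolding T_eq by (rule Q.quot_carrier)
  show ?thesis
    unfolding mod_hom_def c
    using mod_hom_add[OF proj_F_hom, symmetric] mod_hom_smult[OF proj_F_hom, symmetric]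
      mod_hom_closed[OF \<Phi>_hom] mod_hom_add[OF \<Phi>_hom] mod_hom_smult[OF \<Phi>_hom]
    by (auto simp: \<phi>_proj simp del: M'R_sel)
qed

lemma \<phi>_tens: "m \<in> carrier M \<Longrightarrow> t \<in> carrier N \<Longrightarrow> \<phi> (tens m t) = t \<odot>\<^bsub>M'\<^esub> red m"
  unfolding tens_def by (simp add: \<phi>_proj e_closed \<Phi>_e)

lemma \<phi>_gen_tens:
  "t1 \<in> carrier N \<Longrightarrow> t2 \<in> carrier N \<Longrightarrow> \<phi> (gen_tens t1 t2) = t1 \<odot>\<^bsub>M'\<^esub> red m1 \<oplus>\<^bsub>M'\<^esub> t2 \<odot>\<^bsub>M'\<^esub> red m2"
  unfolding gen_tens_def using m12 by (simp add: mod_hom_add[OF \<phi>_hom] tens_closed \<phi>_tens)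

lemma carrier_T: "carrier T = {gen_tens t1 t2 |t1 t2. t1 \<in> carrier N \<and> t2 \<in> carrier N}"
proof -
  have "x \<in> {gen_tens t1 t2 |t1 t2. t1 \<in> carrier N \<and> t2 \<in> carrier N}" if "x \<in> carrier T" for x
  proof -
    from that have "x \<in> Q.proj ` carrier F" unfolding T_eq Q.quot_carrier .
    then obtain f where "x = Q.proj f" "f \<in> carrier F" by (rule imageE)
    thus ?thesis using proj_eq_gen_tens by blast
  qed
  moreover have "gen_tens t1 t2 \<in> carrier T" if "t1 \<in> carrier N" "t2 \<in> carrier N" for t1 t2
    unfolding gen_tens_def using that m12 tens_closed by blast
  ultimately show ?thesis by blast
qed

text \<open>A relation between \<open>red m1\<close> and \<open>red m2\<close> lifts to s1 m1 + s2
  m2 = 0 without changing the classes of its coefficients, and the element is then the tensor of s1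
  m1 + s2 m2 with 1, which is zero.\<close>

lemma \<phi>_kernel:
  assumes "x \<in> carrier T" "\<phi> x = \<zero>\<^bsub>M'\<^esub>"
  shows "x = \<zero>\<^bsub>T\<^esub>"
proof -
  obtain t1 t2 where t: "t1 \<in> carrier N" "t2 \<in> carrier N" "x = gen_tens t1 t2"
    using assms(1) carrier_T by blast
  obtain r1 r2 where r: "r1 \<in> carrier R" "r2 \<in> carrier R" "t1 = \<pi> r1" "t2 = \<pi> r2"
    using t(1,2) unfolding carrier_N Quot_carrier by blast
  have "\<pi> r1 \<odot>\<^bsub>M'\<^esub> red m1 \<oplus>\<^bsub>M'\<^esub> \<pi> r2 \<odot>\<^bsub>M'\<^esub> red m2 = \<zero>\<^bsub>M'\<^esub>"
    using assms(2) \<phi>_gen_tens[OF t(1,2)] t(3) r by simp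
  from lift_relation[OF r(1,2) this] obtain s1 s2 where s: "s1 \<in> carrier R" "s2 \<in> carrier R"
    "\<pi> s1 = t1" "\<pi> s2 = t2" "s1 \<odot>\<^bsub>M\<^esub> m1 \<oplus>\<^bsub>M\<^esub> s2 \<odot>\<^bsub>M\<^esub> m2 = \<zero>\<^bsub>M\<^esub>" using r by metis
  have one: "\<pi> \<one> \<in> carrier N" by (rule \<pi>_closed) simp
  have *: "tens m (\<pi> s) = tens (s \<odot>\<^bsub>M\<^esub> m) (\<pi> \<one>)" if "s \<in> carrier R" "m \<in> carrier M" for s m
  proof -
    have "\<pi> s = s \<odot>\<^bsub>N\<^esub> \<pi> \<one>"
      using that one by (simp add: N_smult ring_hom_mult[OF \<pi>_hom, symmetric])
    thus ?thesis using that one by (simp add: tens_smult_l tens_smult_r)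
  qed
  have "x = tens (s1 \<odot>\<^bsub>M\<^esub> m1 \<oplus>\<^bsub>M\<^esub> s2 \<odot>\<^bsub>M\<^esub> m2) (\<pi> \<one>)"
    using s(1,2) m12 one by (simp add: t(3) gen_tens_def s(3,4)[symmetric] *[OF s(1) m12(1)] *[OF s(2) m12(2)] tens_add_l)
  also have "\<dots> = tens (\<zero> \<odot>\<^bsub>M\<^esub> m1) (\<pi> \<one>)" unfolding s(5) using m12 by simp
  also have "\<dots> = \<zero>\<^bsub>T\<^esub>" using m12 one tens_closed by (subst tens_smult_l) auto
  finally show ?thesis .
qed

lemma \<phi>_inj:
  assumes "x \<in> carrier T" "y \<in> carrier T" "\<phi> x = \<phi> y"
  shows "x = y"
proof -
  have "\<phi> (x \<ominus>\<^bsub>T\<^esub> y) = \<phi> x \<ominus>\<^bsub>M'R\<^esub> \<phi> y"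
    by (rule mod_hom_minus[OF T.module_axioms M'R.module_axioms \<phi>_hom assms(1,2)])
  also have "\<dots> = \<zero>\<^bsub>M'R\<^esub>"
    using M'R.minus_eq_zero_iff mod_hom_closed[OF \<phi>_hom] assms by blast
  finally have "x \<ominus>\<^bsub>T\<^esub> y = \<zero>\<^bsub>T\<^esub>" using \<phi>_kernel assms by simp
  thus ?thesis using T.minus_eq_zero_iff assms by blast
qed

section \<open>The base change as a module over R/I\<close>

abbreviation "L \<equiv> base_change_quot R I M"

lemma L_sel [simp]: "carrier L = carrier T" "\<zero>\<^bsub>L\<^esub> = \<zero>\<^bsub>T\<^esub>" "x \<oplus>\<^bsub>L\<^esub> y = x \<oplus>\<^bsub>T\<^esub> y"
  by (simp_all add: base_change_quot_def Let_def)

text \<open>The scalar action is a union over representatives of a coset. They all yield the same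
  coset by injectivity: under \<phi> the action becomes multiplication by \<open>s\<close> in M',
  which sees only the coset.\<close>

lemma L_smult_\<phi>:
  assumes "s \<in> carrier B" "x \<in> carrier T"
  shows "s \<odot>\<^bsub>L\<^esub> x \<in> carrier T" "\<phi> (s \<odot>\<^bsub>L\<^esub> x) = s \<odot>\<^bsub>M'\<^esub> \<phi> x"
proof -
  define \<sigma> where "\<sigma> = lin_ext R F (\<lambda>(m, t). e m (s \<otimes>\<^bsub>B\<^esub> t))"
  have cl: "(\<lambda>(m, t). e m (s \<otimes>\<^bsub>B\<^esub> t)) \<in> carrier M \<times> carrier N \<rightarrow> carrier F"
    using assms(1) e_closed by (auto simp: carrier_N)
  have \<sigma>: "\<sigma> \<in> mod_hom R F F" unfolding \<sigma>_def by (rule F.lin_ext_hom[OF cl])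
  have "(\<lambda>x. s \<odot>\<^bsub>M'\<^esub> x) \<in> mod_hom R M'R M'R"
    using assms(1) by (auto simp: mod_hom_def M'.smult_r_distr M'.smult_assoc1[symmetric] \<pi>_B M'.R.m_comm)
  note sh = mod_hom_compose[OF \<Phi>_hom this]
  have \<Phi>\<sigma>: "\<Phi> (\<sigma> f) = s \<odot>\<^bsub>M'\<^esub> \<Phi> f" if "f \<in> carrier F" for f
  proof (rule M'R.free_mod_hom_eqI[OF mod_hom_compose[OF \<sigma> \<Phi>_hom] sh _ that])
    fix b assume "b \<in> carrier M \<times> carrier N"
    then obtain m t where b: "b = (m, t)" "m \<in> carrier M" "t \<in> carrier N" by auto
    have st: "s \<otimes>\<^bsub>B\<^esub> t \<in> carrier N" using assms(1) b by (simp add: carrier_N)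
    have "\<sigma> (e m t) = e m (s \<otimes>\<^bsub>B\<^esub> t)" unfolding \<sigma>_def using b by (subst F.lin_ext_basis_vec[OF cl]) auto
    thus "\<Phi> (\<sigma> (basis_vec R b)) = s \<odot>\<^bsub>M'\<^esub> \<Phi> (basis_vec R b)"
      using b assms(1) st by (simp add: \<Phi>_e red_closed M'.smult_assoc1 carrier_N)
  qed
  obtain f where f: "f \<in> carrier F" "x = Q.proj f" using assms(2) unfolding T_eq Q.quot_carrier by blast
  have const: "Q.proj (\<sigma> g) = Q.proj (\<sigma> f)" if "g \<in> x" for g
  proof -
    have g: "g \<in> carrier F" "Q.proj g = Q.proj f" using Q.mem_proj[OF f(1)] that f(2) by auto
    hence "\<Phi> g = \<Phi> f" using \<phi>_proj f(1) by metis
    hence "\<phi> (Q.proj (\<sigma> g)) = \<phi> (Q.proj (\<sigma> f))"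
      using mod_hom_closed[OF \<sigma>] f(1) g(1) by (simp add: \<phi>_proj \<Phi>\<sigma>)
    thus ?thesis using mod_hom_closed[OF proj_F_hom] mod_hom_closed[OF \<sigma>] f(1) g(1) by (intro \<phi>_inj) auto
  qed
  have "f \<in> x" unfolding f(2) Q.proj_def by (rule Q.K.a_rcos_self[OF f(1)])
  hence "(\<Union>g\<in>x. Q.proj (\<sigma> g)) = Q.proj (\<sigma> f)" using const by (rule UN_eq_const)
  moreover have "s \<odot>\<^bsub>L\<^esub> x = (\<Union>g\<in>x. Q.proj (\<sigma> g))"
    unfolding base_change_quot_def Let_def \<sigma>_def Q.proj_def by simp
  ultimately have "s \<odot>\<^bsub>L\<^esub> x = Q.proj (\<sigma> f)" by (rule trans[rotated])
  thus "s \<odot>\<^bsub>L\<^esub> x \<in> carrier T" "\<phi> (s \<odot>\<^bsub>L\<^esub> x) = s \<odot>\<^bsub>M'\<^esub> \<phi> x"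
    using f mod_hom_closed[OF proj_F_hom] mod_hom_closed[OF \<sigma>] by (simp_all add: \<phi>_proj \<Phi>\<sigma>)
qed

lemma \<phi>_add: "x \<in> carrier T \<Longrightarrow> y \<in> carrier T \<Longrightarrow> \<phi> (x \<oplus>\<^bsub>T\<^esub> y) = \<phi> x \<oplus>\<^bsub>M'\<^esub> \<phi> y"
  using mod_hom_add[OF \<phi>_hom] by simp

lemma \<phi>_closed: "x \<in> carrier T \<Longrightarrow> \<phi> x \<in> carrier M'"
  using mod_hom_closed[OF \<phi>_hom] by simp

text \<open>Addition is that of the tensor product; the laws for scalars are pulled back from M'
  along the injection \<phi>.\<close>

lemma L_module: "module B L"
proof (rule moduleI)
  show "cring B" by (rule M'.R.is_cring)
  show "abelian_group L"
  proof (rule abelian_groupI)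
    fix x assume "x \<in> carrier L"
    thus "\<exists>y\<in>carrier L. y \<oplus>\<^bsub>L\<^esub> x = \<zero>\<^bsub>L\<^esub>"
      by (intro bexI[of _ "\<ominus>\<^bsub>T\<^esub> x"]) (auto simp: T.l_neg)
  qed (auto simp: T.a_ac)
next
  fix a b x y assume *: "a \<in> carrier B" "b \<in> carrier B" "x \<in> carrier L" "y \<in> carrier L"
  show "(a \<oplus>\<^bsub>B\<^esub> b) \<odot>\<^bsub>L\<^esub> x = a \<odot>\<^bsub>L\<^esub> x \<oplus>\<^bsub>L\<^esub> b \<odot>\<^bsub>L\<^esub> x"
    using * by (intro \<phi>_inj) (simp_all add: L_smult_\<phi> \<phi>_add \<phi>_closed M'.smult_l_distr)
  show "a \<odot>\<^bsub>L\<^esub> (x \<oplus>\<^bsub>L\<^esub> y) = a \<odot>\<^bsub>L\<^esub> x \<oplus>\<^bsub>L\<^esub> a \<odot>\<^bsub>L\<^esub> y"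
    using * by (intro \<phi>_inj) (simp_all add: L_smult_\<phi> \<phi>_add \<phi>_closed M'.smult_r_distr)
  show "(a \<otimes>\<^bsub>B\<^esub> b) \<odot>\<^bsub>L\<^esub> x = a \<odot>\<^bsub>L\<^esub> (b \<odot>\<^bsub>L\<^esub> x)"
    using * by (intro \<phi>_inj) (simp_all add: L_smult_\<phi> \<phi>_closed M'.smult_assoc1)
next
  fix x assume "x \<in> carrier L"
  thus "\<one>\<^bsub>B\<^esub> \<odot>\<^bsub>L\<^esub> x = x"
    by (intro \<phi>_inj) (simp_all add: L_smult_\<phi> \<phi>_closed)
qed (simp add: L_smult_\<phi>)

text \<open>The augmentation for L; it sends the two basis vectors to the tensors of
  \<open>m1\<close> and \<open>m2\<close> with 1.\<close>

definition \<epsilon> :: "(nat \<Rightarrow> 'r set) \<Rightarrow> ('m \<times> 'r set \<Rightarrow> 'r) set" where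
  "\<epsilon> b = gen_tens (b 1) (b 2)"

lemma \<epsilon>_closed: "b \<in> carrier (free2 B) \<Longrightarrow> \<epsilon> b \<in> carrier T"
  unfolding \<epsilon>_def carrier_T mem_free2_iff carrier_N by blast

lemma \<phi>_\<epsilon>: "b \<in> carrier (free2 B) \<Longrightarrow> \<phi> (\<epsilon> b) = b 1 \<odot>\<^bsub>M'\<^esub> red m1 \<oplus>\<^bsub>M'\<^esub> b 2 \<odot>\<^bsub>M'\<^esub> red m2"
  unfolding \<epsilon>_def mem_free2_iff using \<phi>_gen_tens carrier_N by simp

lemma \<epsilon>_hom: "\<epsilon> \<in> mod_hom B (free2 B) L"
proof -
  interpret F2: module B "free2 B" by (rule M'.R.free_mod_module)
  show ?thesis
    unfolding mod_hom_def
  proof (intro CollectI conjI funcsetI ballI)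
    fix x y assume xy: "x \<in> carrier (free2 B)" "y \<in> carrier (free2 B)"
    show "\<epsilon> (x \<oplus>\<^bsub>free2 B\<^esub> y) = \<epsilon> x \<oplus>\<^bsub>L\<^esub> \<epsilon> y"
    proof (rule \<phi>_inj)
      show "\<phi> (\<epsilon> (x \<oplus>\<^bsub>free2 B\<^esub> y)) = \<phi> (\<epsilon> x \<oplus>\<^bsub>L\<^esub> \<epsilon> y)"
        using xy F2.a_closed[OF xy] m12 red_closed unfolding L_sel
        by (simp add: \<phi>_\<epsilon> \<phi>_add \<epsilon>_closed)
          (simp add: free_mod_sel(2) mem_free2_iff M'.smult_l_distr M'.a_ac)
    qed (use xy F2.a_closed[OF xy] \<epsilon>_closed in simp_all)
  next
    fix r x assume rx: "r \<in> carrier B" "x \<in> carrier (free2 B)"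
    show "\<epsilon> (r \<odot>\<^bsub>free2 B\<^esub> x) = r \<odot>\<^bsub>L\<^esub> \<epsilon> x"
    proof (rule \<phi>_inj)
      show "\<phi> (\<epsilon> (r \<odot>\<^bsub>free2 B\<^esub> x)) = \<phi> (r \<odot>\<^bsub>L\<^esub> \<epsilon> x)"
        using rx F2.smult_closed[OF rx] m12 red_closed
        by (simp add: \<phi>_\<epsilon> L_smult_\<phi> \<epsilon>_closed)
          (simp add: free_mod_sel(3) mem_free2_iff M'.smult_r_distr M'.smult_assoc1)
    qed (use rx F2.smult_closed[OF rx] \<epsilon>_closed L_smult_\<phi> in simp_all)
  qed (simp add: \<epsilon>_closed)
qed

lemma \<epsilon>_surj: "\<epsilon> ` carrier (free2 B) = carrier L"
proof
  show "carrier L \<subseteq> \<epsilon> ` carrier (free2 B)"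
  proof
    fix x assume "x \<in> carrier L"
    then obtain t1 t2 where t: "t1 \<in> carrier B" "t2 \<in> carrier B" "x = gen_tens t1 t2"
      using carrier_T carrier_N by auto
    let ?b = "\<lambda>i :: nat. if i = 1 then t1 else if i = 2 then t2 else \<zero>\<^bsub>B\<^esub>"
    have "?b \<in> carrier (free2 B)" "x = \<epsilon> ?b" using t by (simp_all add: mem_free2_iff \<epsilon>_def)
    thus "x \<in> \<epsilon> ` carrier (free2 B)" by blast
  qed
qed (use \<epsilon>_closed in auto)

lemma \<epsilon>_zero_iff:
  assumes "b \<in> carrier (free2 B)"
  shows "\<epsilon> b = \<zero>\<^bsub>L\<^esub> \<longleftrightarrow> b 1 \<odot>\<^bsub>M'\<^esub> red m1 \<oplus>\<^bsub>M'\<^esub> b 2 \<odot>\<^bsub>M'\<^esub> red m2 = \<zero>\<^bsub>M'\<^esub>"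
proof -
  have "\<phi> \<zero>\<^bsub>T\<^esub> = \<zero>\<^bsub>M'\<^esub>" using mod_hom_zero[OF T.module_axioms M'R.module_axioms \<phi>_hom] by simp
  thus ?thesis using \<phi>_kernel[OF \<epsilon>_closed[OF assms]] \<phi>_\<epsilon>[OF assms] by auto
qed

end

section \<open>The rings and modules in coordinates\<close>

declare gen.simps [simp del]

lemma emb_simps:
  "emb \<alpha> u \<otimes>\<^bsub>A_ring \<alpha>\<^esub> emb \<alpha> v = emb \<alpha> (vmul \<alpha> u v)"
  "emb \<alpha> u \<oplus>\<^bsub>A_ring \<alpha>\<^esub> emb \<alpha> v = emb \<alpha> (u + v)"
  "\<one>\<^bsub>A_ring \<alpha>\<^esub> = emb \<alpha> (scalar 1)"
  using ring_hom_mult[OF emb_hom, of u \<alpha> v] ring_hom_add[OF emb_hom, of u \<alpha> v] ring_hom_one[OF emb_hom, of \<alpha>]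
  by simp_all

lemma emb_zero: "\<zero>\<^bsub>A_ring \<alpha>\<^esub> = emb \<alpha> 0"
proof -
  interpret A: cring "A_ring \<alpha>" by (rule A_cring)
  have "emb \<alpha> 0 \<in> carrier (A_ring \<alpha>)" by (simp add: carrier_A_emb)
  thus ?thesis using emb_simps(2)[of \<alpha> 0 0] A.add.r_cancel_one by simp
qed

lemma emb_closed [simp]: "emb \<alpha> u \<in> carrier (A_ring \<alpha>)"
  by (simp add: carrier_A_emb)

lemma emb_uminus: "\<ominus>\<^bsub>A_ring \<alpha>\<^esub> emb \<alpha> u = emb \<alpha> (- u)"
proof -
  interpret A: cring "A_ring \<alpha>" by (rule A_cring)
  show ?thesis by (rule A.minus_equality) (simp_all add: emb_simps emb_zero)
qed

lemma emb_minus: "emb \<alpha> u \<ominus>\<^bsub>A_ring \<alpha>\<^esub> emb \<alpha> v = emb \<alpha> (u - v)"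
  by (simp add: a_minus_def emb_uminus emb_simps)

text \<open>Negation comes for free, as -u is the product of u with the scalar -1. Ideals of A can
  thus be handled as sets of coordinate vectors.\<close>

lemma emb_ideal:
  assumes "0 \<in> K" "\<And>u v. u \<in> K \<Longrightarrow> v \<in> K \<Longrightarrow> u + v \<in> K" "\<And>u v. u \<in> K \<Longrightarrow> vmul \<alpha> v u \<in> K"
  shows "ideal (emb \<alpha> ` K) (A_ring \<alpha>)"
proof -
  interpret A: cring "A_ring \<alpha>" by (rule A_cring)
  have neg: "- u \<in> K" if "u \<in> K" for u
  proof -
    have "- u = vmul \<alpha> (scalar (- 1)) u" by (simp add: vmul_scalar vec12_eq_iff)
    thus ?thesis using assms(3)[OF that] by simp
  qed
  show ?thesis
  proof (rule idealI[OF A.ring_axioms])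
    show "subgroup (emb \<alpha> ` K) (add_monoid (A_ring \<alpha>))"
    proof (rule A.add.subgroupI)
      show "emb \<alpha> ` K \<noteq> {}" using assms(1) by blast
      fix a assume "a \<in> emb \<alpha> ` K"
      then obtain u where "u \<in> K" "a = emb \<alpha> u" by blast
      thus "\<ominus>\<^bsub>A_ring \<alpha>\<^esub> a \<in> emb \<alpha> ` K"
        using neg by (simp add: emb_uminus)
    qed (auto simp: emb_simps assms)
  next
    fix a x assume "a \<in> emb \<alpha> ` K" "x \<in> carrier (A_ring \<alpha>)"
    thus "x \<otimes>\<^bsub>A_ring \<alpha>\<^esub> a \<in> emb \<alpha> ` K" "a \<otimes>\<^bsub>A_ring \<alpha>\<^esub> x \<in> emb \<alpha> ` K"
      using assms(3) vmul_comm[of \<alpha>] by (auto simp: carrier_A_emb emb_simps)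
  qed
qed

text \<open>The coordinates left free are those of x5, x1 x5, x2 x5 and x1 x2 x5: this is the ideal
  (x5), of codimension eight.\<close>

definition K5 :: "'k::field vec12 set" where
  "K5 = {u. c0 u = 0 \<and> c1 u = 0 \<and> c2 u = 0 \<and> c3 u = 0 \<and> c4 u = 0 \<and> c12 u = 0 \<and> c13 u = 0 \<and> c14 u = 0}"

text \<open>The coefficients of \<open>1\<close> and \<open>x\<close> of the image of \<open>u\<close> in \<open>T\<^sub>q = k[x]/(x\<^sup>2)\<close>, for \<open>\<gamma> = \<alpha>\<^sup>-\<^sup>q\<close>.\<close>

definition tcoord :: "'k::field \<Rightarrow> 'k vec12 \<Rightarrow> 'k \<times> 'k" where
  "tcoord \<gamma> u = (c0 u, c1 u + c2 u + \<gamma> * c3 u + c4 u)"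


lemma x5_ideal_eq: "x5_ideal \<alpha> = emb \<alpha> ` K5"
proof -
  interpret A: cring "A_ring \<alpha>" by (rule A_cring)
  have id: "ideal (emb \<alpha> ` K5) (A_ring \<alpha>)"
    by (rule emb_ideal) (auto simp: K5_def vmul_def)
  show ?thesis
  proof
    show "x5_ideal \<alpha> \<subseteq> emb \<alpha> ` K5"
      unfolding x5_ideal_def by (rule A.genideal_minimal[OF id]) (auto simp: xA_eq K5_def gen.simps)
    interpret J: ideal "x5_ideal \<alpha>" "A_ring \<alpha>"
      unfolding x5_ideal_def by (rule A.genideal_ideal) (auto simp: xA_eq)
    have x5: "emb \<alpha> (gen V5) \<in> x5_ideal \<alpha>"
      using A.genideal_self'[of "emb \<alpha> (gen V5)"] by (simp add: x5_ideal_def xA_eq)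
    show "emb \<alpha> ` K5 \<subseteq> x5_ideal \<alpha>"
    proof (rule image_subsetI)
      fix u :: "'a vec12" assume "u \<in> K5"
      \<comment> \<open>The cofactor of x5 is c5 + c15 x1 + c25 x2 + c125 x1 x2.\<close>
      hence "vmul \<alpha> (gen V5) (Vec (c5 u) (c15 u) (c25 u) 0 0 0 (c125 u) 0 0 0 0 0) = u"
        by (simp add: vmul_gen K5_def vec12_eq_iff)
      thus "emb \<alpha> u \<in> x5_ideal \<alpha>" using J.I_r_closed[OF x5 emb_closed] emb_simps(1) by metis
    qed
  qed
qed

text \<open>Modulo the generators x1, x2, x4 become one element x, and x3 becomes \<gamma> x. All
  monomials of degree two lie in the ideal, so only the constant term and the combined coefficient
  of x survive.\<close>

lemma J_ideal_eq:
  assumes "\<alpha> powi q \<noteq> 0"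
  defines "\<gamma> \<equiv> inverse (\<alpha> powi q)"
  shows "J_ideal \<alpha> q = emb \<alpha> ` {u. tcoord \<gamma> u = (0, 0)}"
proof -
  interpret A: cring "A_ring \<alpha>" by (rule A_cring)
  define a where "a = \<alpha> powi q"
  have a: "a \<noteq> 0" "\<gamma> * a = 1" "a * \<gamma> = 1" using assms by (simp_all add: a_def)
  let ?g2 = "gen V1 - gen V2" and ?g3 = "gen V1 - vmul \<alpha> (scalar a) (gen V3)" and ?g4 = "gen V1 - gen V4"
  let ?G = "{emb \<alpha> ?g2, emb \<alpha> ?g3, emb \<alpha> ?g4, emb \<alpha> (gen V5)}"
  have J: "J_ideal \<alpha> q = Idl\<^bsub>A_ring \<alpha>\<^esub> ?G"
    by (simp only: J_ideal_def xA_eq cls_pconst emb_simps emb_minus a_def)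
  have id: "ideal (emb \<alpha> ` {u. tcoord \<gamma> u = (0, 0)}) (A_ring \<alpha>)"
  proof (rule emb_ideal)
    fix u v :: "'a vec12" assume u: "u \<in> {u. tcoord \<gamma> u = (0, 0)}" 
    hence "c0 u = 0" by (simp add: tcoord_def)
    \<comment> \<open>Without a constant term in u, multiplication by v merely scales the
      coefficient of x by the constant term of v.\<close>
    hence "tcoord \<gamma> (vmul \<alpha> v u) = (0, c0 v * snd (tcoord \<gamma> u))"
      by (simp add: tcoord_def vmul_def algebra_simps)
    thus "vmul \<alpha> v u \<in> {u. tcoord \<gamma> u = (0, 0)}" using u by simp
    assume v: "v \<in> {u. tcoord \<gamma> u = (0, 0)}"
    have "tcoord \<gamma> (u + v) = (fst (tcoord \<gamma> u) + fst (tcoord \<gamma> v), snd (tcoord \<gamma> u) + snd (tcoord \<gamma> v))"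
      by (simp add: tcoord_def algebra_simps)
    thus "u + v \<in> {u. tcoord \<gamma> u = (0, 0)}" using u v by simp
  qed (simp add: tcoord_def)
  have G: "?G \<subseteq> carrier (A_ring \<alpha>)" by simp
  interpret J: ideal "J_ideal \<alpha> q" "A_ring \<alpha>" unfolding J by (rule A.genideal_ideal[OF G])
  show ?thesis
  proof
    show "J_ideal \<alpha> q \<subseteq> emb \<alpha> ` {u. tcoord \<gamma> u = (0, 0)}"
      unfolding J using a(2) by (intro A.genideal_minimal[OF id]) (auto simp: tcoord_def vmul_scalar gen.simps)
    have mem: "emb \<alpha> (vmul \<alpha> g w) \<in> J_ideal \<alpha> q" if "emb \<alpha> g \<in> ?G" for g w
      using J.I_r_closed[of "emb \<alpha> g" "emb \<alpha> w"] A.genideal_self[OF G] that unfolding emb_simps(1) J by auto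
    have add: "emb \<alpha> (u + v) \<in> J_ideal \<alpha> q" if "emb \<alpha> u \<in> J_ideal \<alpha> q" "emb \<alpha> v \<in> J_ideal \<alpha> q" for u v
      using J.a_closed[OF that] by (simp add: emb_simps)
    show "emb \<alpha> ` {u. tcoord \<gamma> u = (0, 0)} \<subseteq> J_ideal \<alpha> q"
    proof (rule image_subsetI)
      fix u :: "'a vec12" assume "u \<in> {u. tcoord \<gamma> u = (0, 0)}"
      hence u: "c0 u = 0" "c1 u = - c2 u - \<gamma> * c3 u - c4 u"
        by (simp_all add: tcoord_def eq_neg_iff_add_eq_0 algebra_simps)
      \<comment> \<open>Constant terms of the cofactors produce x2, x3, x4 at the expense of x1,
        which the equation for c1 balances. Their linear terms produce x1 x2, x1 x3, x1 x4, and x5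
        supplies the rest.\<close>
      have "u = vmul \<alpha> ?g2 (Vec (- c2 u) 0 (c12 u) 0 0 0 0 0 0 0 0 0)
        + (vmul \<alpha> ?g3 (Vec (- \<gamma> * c3 u) (- \<gamma> * c13 u) 0 0 0 0 0 0 0 0 0 0)
        + (vmul \<alpha> ?g4 (Vec (- c4 u) (- c14 u) 0 0 0 0 0 0 0 0 0 0)
        + vmul \<alpha> (gen V5) (Vec (c5 u) (c15 u) (c25 u) 0 0 0 (c125 u) 0 0 0 0 0)))"
        using a by (simp add: vec12_eq_iff vmul_def scalar_def gen.simps u)
      thus "emb \<alpha> u \<in> J_ideal \<alpha> q" using mem add by (metis insertCI)
    qed
  qed
qed

section \<open>Exactness\<close>

text \<open>The rows of D_i in coordinates, \<open>c\<close> standing for \<alpha>^i; passing to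
  D_(i+1) replaces \<open>c\<close> by \<alpha> c.\<close>

definition row1 :: "'k::field \<Rightarrow> 'k \<Rightarrow> 'k vec12 \<Rightarrow> 'k vec12 \<Rightarrow> 'k vec12" where
  "row1 \<alpha> c u v = vmul \<alpha> (gen V1) u + vmul \<alpha> (scalar c) (vmul \<alpha> (gen V3) v)"

definition row2 :: "'k::field \<Rightarrow> 'k vec12 \<Rightarrow> 'k vec12 \<Rightarrow> 'k vec12" where
  "row2 \<alpha> u v = vmul \<alpha> (gen V4) u + vmul \<alpha> (gen V2) v"

lemmas row_simps = row1_def row2_def vmul_gen vmul_scalar

text \<open>The preimage solves the equations degree by degree, with undetermined coordinates set to zero.\<close>

lemma rows_exact:
  assumes "\<alpha> \<noteq> 0" "c \<noteq> 0" "row1 \<alpha> c u v = 0" "row2 \<alpha> u v = 0"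
  shows "\<exists>a b. u = row1 \<alpha> (\<alpha> * c) a b \<and> v = row2 \<alpha> a b"
proof -
  have k: "c0 u = 0" "c0 v = 0" "c2 u = 0" "c3 u + c * (c1 v - \<alpha> * c2 v) = 0" "c4 u = 0" "c5 u = c * \<alpha> * c3 v" "c3 v = 0"
    "c1 v = 0" "c1 u = c4 v" "c5 v = 0" "c25 u = - c * c13 v" "c15 v = - c14 u"
    using assms by (simp_all add: vec12_eq_iff row_simps eq_neg_iff_add_eq_0 add.commute)
  \<comment> \<open>Combines the x1 x3 coordinate of the first row with c1 v = 0 from the second;
    the factor \<alpha> c is the coefficient of x3 in the next matrix.\<close>
  hence k': "c3 u = \<alpha> * c * c2 v" by (simp add: algebra_simps)
  show ?thesis
    by (rule exI[of _ "Vec (c1 u) (c14 v + c12 u) (c12 u) (c13 u - \<alpha> * c * c12 v) (c14 u) (c15 u - \<alpha> * c * c13 v)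
        0 0 (c125 v) 0 (c125 u) 0"],
      rule exI[of _ "Vec (c2 v) (c12 v) 0 (- c13 v / \<alpha>) 0 (c25 v - c14 u) 0 0 0 0 0 0"])
      (use assms(1,2) k k' in \<open>simp add: vec12_eq_iff row_simps\<close>)
qed

text \<open>Over B the kernel conditions on multiples of x5 disappear and the kernel grows, so
  exactness is checked afresh. The preimage is the one used over A, cut down to the coordinates of
  1, x1, x2, x3, x4.\<close>

lemma rows_exact_mod_x5:
  assumes "\<alpha> \<noteq> 0" "c \<noteq> 0" "row1 \<alpha> c u v \<in> K5" "row2 \<alpha> u v \<in> K5"
  shows "\<exists>a b. u - row1 \<alpha> (\<alpha> * c) a b \<in> K5 \<and> v - row2 \<alpha> a b \<in> K5"
proof -
  have k: "c0 u = 0" "c0 v = 0" "c2 u = 0" "c3 u + c * (c1 v - \<alpha> * c2 v) = 0" "c4 u = 0" "c3 v = 0"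
    "c1 v = 0" "c1 u = c4 v"
    using assms by (simp_all add: K5_def row_simps eq_neg_iff_add_eq_0 add.commute)
  hence k': "c3 u = \<alpha> * c * c2 v" by (simp add: algebra_simps)
  show ?thesis
    by (rule exI[of _ "Vec (c1 u) (c14 v + c12 u) (c12 u) (c13 u - \<alpha> * c * c12 v) (c14 u) 0 0 0 0 0 0 0"],
      rule exI[of _ "Vec (c2 v) (c12 v) 0 (- c13 v / \<alpha>) 0 0 0 0 0 0 0 0"])
      (use assms(1,2) k k' in \<open>simp add: K5_def row_simps\<close>)
qed

text \<open>Covers both rings at once: A with K = {0} and B with K = (x5). Exactness is phrased on
  representatives, modulo K.\<close>

locale model_image = cring R for R :: "('r, 'x) ring_scheme" (structure) +
  fixes \<alpha> :: "'k::field" and \<kappa> :: "'k vec12 \<Rightarrow> 'r" and K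
  assumes \<kappa>_hom: "\<kappa> \<in> ring_hom (model \<alpha>) R" and \<kappa>_surj: "range \<kappa> = carrier R"
    and \<kappa>_ker: "\<kappa> u = \<zero> \<longleftrightarrow> u \<in> K"
    and \<alpha>_nz: "\<alpha> \<noteq> 0"
    and rows_exact_K: "c \<noteq> 0 \<Longrightarrow> row1 \<alpha> c u v \<in> K \<Longrightarrow> row2 \<alpha> u v \<in> K \<Longrightarrow>
      \<exists>a b. u - row1 \<alpha> (\<alpha> * c) a b \<in> K \<and> v - row2 \<alpha> a b \<in> K"
begin

lemma \<kappa>_simps: "\<kappa> u \<otimes> \<kappa> v = \<kappa> (vmul \<alpha> u v)" "\<kappa> u \<oplus> \<kappa> v = \<kappa> (u + v)" "\<kappa> (scalar 1) = \<one>"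
  using ring_hom_mult[OF \<kappa>_hom, of u v] ring_hom_add[OF \<kappa>_hom, of u v] ring_hom_one[OF \<kappa>_hom] by simp_all

lemma \<kappa>_closed [simp]: "\<kappa> u \<in> carrier R"
  using \<kappa>_surj by blast

lemma \<kappa>_zero: "\<kappa> 0 = \<zero>"
  using \<kappa>_simps(2)[of 0 0] add.r_cancel_one by simp

lemma \<kappa>_eqI: "u - v \<in> K \<Longrightarrow> \<kappa> u = \<kappa> v"
  using \<kappa>_simps(2)[of "u - v" v] \<kappa>_ker[of "u - v"] by simp

lemma \<kappa>_pow: "\<kappa> (scalar \<alpha>) [^] (i :: nat) = \<kappa> (scalar (\<alpha> ^ i))"
  by (induction i) (simp_all add: \<kappa>_simps scalar_mult mult.commute)

sublocale twisted_matrices R "\<kappa> (gen V1)" "\<kappa> (gen V2)" "\<kappa> (gen V3)" "\<kappa> (gen V4)" "\<kappa> (scalar \<alpha>)"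
  by unfold_locales
    (simp_all add: \<kappa>_simps \<kappa>_zero[symmetric] vmul_assoc,
     simp_all add: vmul_gen vmul_scalar,
     simp_all add: plus_vec12_def zero_vec12_def gen.simps)

lemma D_rows:
  assumes "v 1 = \<kappa> u1" "v 2 = \<kappa> u2"
  shows "D i v 1 = \<kappa> (row1 \<alpha> (\<alpha> ^ i) u1 u2)" "D i v 2 = \<kappa> (row2 \<alpha> u1 u2)"
  using assms by (simp_all add: D_def mat2_def \<kappa>_pow \<kappa>_simps row1_def row2_def vmul_assoc)

sublocale exact_twisted_matrices R "\<kappa> (gen V1)" "\<kappa> (gen V2)" "\<kappa> (gen V3)" "\<kappa> (gen V4)" "\<kappa> (scalar \<alpha>)"
proof (unfold_locales)
  fix v i assume v: "v \<in> carrier (free2 R)" "D i v = \<zero>\<^bsub>free2 R\<^esub>"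
  obtain u1 u2 where u: "v 1 = \<kappa> u1" "v 2 = \<kappa> u2"
    using v(1) unfolding mem_free2_iff \<kappa>_surj[symmetric] by blast
  have z: "D i v j = \<zero>" for j using v(2) by (simp add: free_mod_sel(1))
  have "row1 \<alpha> (\<alpha> ^ i) u1 u2 \<in> K" "row2 \<alpha> u1 u2 \<in> K"
    using D_rows[OF u, of i] z \<kappa>_ker by metis+
  then obtain a b where ab: "u1 - row1 \<alpha> (\<alpha> * \<alpha> ^ i) a b \<in> K" "u2 - row2 \<alpha> a b \<in> K"
    using rows_exact_K[of "\<alpha> ^ i" u1 u2] \<alpha>_nz by auto
  let ?w = "\<lambda>j :: nat. if j = 1 then \<kappa> a else if j = 2 then \<kappa> b else \<zero>"
  have w: "?w \<in> carrier (free2 R)" by (simp add: mem_free2_iff)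
  have "v = D (Suc i) ?w"
    using D_rows[of ?w a b "Suc i"] u ab
    by (intro free2_eqI[OF v(1) mod_hom_closed[OF D_hom w]]) (simp_all add: \<kappa>_eqI)
  thus "\<exists>w\<in>carrier (free2 R). v = D (Suc i) w" using w by blast
qed

text \<open>\<open>P\<close> plays the projection from coordinates onto T_q, over either ring. In
  the application \<gamma> = \<alpha>^(-q), so that c_i = \<alpha>^(i-q).\<close>

lemma ex_dual_number_module:
  assumes "module R N" "carrier N = range P" "\<And>u v. P u \<oplus>\<^bsub>N\<^esub> P v = P (u + v)"
    "\<And>u v. \<kappa> u \<odot>\<^bsub>N\<^esub> P v = P (vmul \<alpha> u v)" "\<And>u v. P u = P v \<longleftrightarrow> tcoord \<gamma> u = tcoord \<gamma> v"
  shows "\<exists>\<tau>. dual_number_module R N (\<kappa> (gen V1)) (\<kappa> (gen V2)) (\<kappa> (gen V3)) (\<kappa> (gen V4)) (\<kappa> (scalar \<alpha>))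
    \<tau> (\<lambda>i. \<alpha> ^ i * \<gamma>)"
proof -
  interpret N: module R N by fact
  define \<tau> where "\<tau> x = tcoord \<gamma> (SOME u. P u = x)" for x
  have \<tau>: "\<tau> (P u) = tcoord \<gamma> u" for u
  proof -
    have "P (SOME v. P v = P u) = P u" by (rule someI[of _ u]) simp
    thus ?thesis unfolding \<tau>_def using assms(5) by blast
  qed
  have "dual_number_module R N (\<kappa> (gen V1)) (\<kappa> (gen V2)) (\<kappa> (gen V3)) (\<kappa> (gen V4)) (\<kappa> (scalar \<alpha>))
    \<tau> (\<lambda>i. \<alpha> ^ i * \<gamma>)"
  proof (intro dual_number_module.intro dual_number_module_axioms.intro)
    have "inj_on \<tau> (carrier N)" unfolding assms(2) by (rule inj_onI) (auto simp: \<tau> assms(5))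
    moreover have "z \<in> \<tau> ` carrier N" for z
    proof -
      have "\<tau> (P (Vec (fst z) (snd z) 0 0 0 0 0 0 0 0 0 0)) = z" by (simp add: \<tau> tcoord_def)
      thus ?thesis unfolding assms(2) by (metis rangeI image_eqI)
    qed
    ultimately show "bij_betw \<tau> (carrier N) UNIV" unfolding bij_betw_def by blast
  next
    fix x y assume "x \<in> carrier N" "y \<in> carrier N"
    thus "\<tau> (x \<oplus>\<^bsub>N\<^esub> y) = (fst (\<tau> x) + fst (\<tau> y), snd (\<tau> x) + snd (\<tau> y))"
      unfolding assms(2) by (auto simp: assms(3) \<tau> tcoord_def algebra_simps)
  next
    fix x and i :: nat assume "x \<in> carrier N"
    then obtain u where x: "x = P u" unfolding assms(2) by blast
    show "\<tau> (\<kappa> (gen V1) \<odot>\<^bsub>N\<^esub> x) = (0, fst (\<tau> x))" "\<tau> (\<kappa> (gen V2) \<odot>\<^bsub>N\<^esub> x) = (0, fst (\<tau> x))"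
      "\<tau> (\<kappa> (gen V4) \<odot>\<^bsub>N\<^esub> x) = (0, fst (\<tau> x))"
      "\<tau> ((\<kappa> (scalar \<alpha>) [^] i \<otimes> \<kappa> (gen V3)) \<odot>\<^bsub>N\<^esub> x) = (0, \<alpha> ^ i * \<gamma> * fst (\<tau> x))"
      unfolding x \<kappa>_pow \<kappa>_simps assms(4) \<tau> vmul_assoc
      unfolding vmul_scalar vmul_gen by (simp_all add: tcoord_def)
  qed (rule twisted_matrices_axioms assms(1))+
  thus ?thesis by blast
qed

end

section \<open>Resolutions of \<open>M\<close> and \<open>L\<close>\<close>

lemma A_model_image: "\<alpha> \<noteq> 0 \<Longrightarrow> model_image (A_ring \<alpha>) \<alpha> (emb \<alpha>) {0}"
  using rows_exact[of \<alpha>]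
  by (intro model_image.intro model_image_axioms.intro A_cring emb_hom)
    (auto simp: carrier_A_emb emb_zero)

lemma x5_ideal_ideal: "ideal (x5_ideal \<alpha>) (A_ring \<alpha>)"
  unfolding x5_ideal_def by (intro ring.genideal_ideal cring.axioms(1) A_cring) (simp add: xA_eq)

lemma J_ideal_ideal: "ideal (J_ideal \<alpha> q) (A_ring \<alpha>)"
  unfolding J_ideal_def
  by (intro ring.genideal_ideal cring.axioms(1) A_cring) (simp add: xA_eq cls_pconst emb_simps emb_minus)

definition embB :: "'k::field \<Rightarrow> 'k vec12 \<Rightarrow> 'k poly5 set set" where
  "embB \<alpha> u = x5_ideal \<alpha> +>\<^bsub>A_ring \<alpha>\<^esub> emb \<alpha> u"

lemma B_model_image:
  assumes "\<alpha> \<noteq> 0"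
  shows "model_image (B_ring \<alpha>) \<alpha> (embB \<alpha>) K5"
proof -
  interpret I: ideal "x5_ideal \<alpha>" "A_ring \<alpha>" by (rule x5_ideal_ideal)
  interpret A: cring "A_ring \<alpha>" by (rule A_cring)
  show ?thesis
  proof (intro model_image.intro model_image_axioms.intro)
    show "cring (B_ring \<alpha>)" unfolding B_ring_def by (rule I.quotient_is_cring[OF A_cring])
    show "embB \<alpha> \<in> ring_hom (model \<alpha>) (B_ring \<alpha>)"
      using ring_hom_trans[OF emb_hom I.rcos_ring_hom] unfolding B_ring_def embB_def[abs_def] comp_def .
    show "range (embB \<alpha>) = carrier (B_ring \<alpha>)"
      unfolding B_ring_def Quot_carrier carrier_A_emb embB_def[abs_def] by auto
    show "embB \<alpha> u = \<zero>\<^bsub>B_ring \<alpha>\<^esub> \<longleftrightarrow> u \<in> K5" for u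
    proof -
      have "\<zero>\<^bsub>B_ring \<alpha>\<^esub> = x5_ideal \<alpha>" by (simp add: B_ring_def FactRing_def)
      moreover have "embB \<alpha> u = x5_ideal \<alpha> \<longleftrightarrow> emb \<alpha> u \<in> x5_ideal \<alpha>"
        unfolding embB_def using I.a_rcos_const I.a_rcos_self[of "emb \<alpha> u"] by auto
      moreover have "emb \<alpha> u \<in> x5_ideal \<alpha> \<longleftrightarrow> u \<in> K5" by (auto simp: x5_ideal_eq)
      ultimately show ?thesis by simp
    qed
  qed (use assms rows_exact_mod_x5 in auto)
qed

lemma (in module) image_submodule:
  assumes "module R N" "h \<in> mod_hom R N M"
  shows "submodule (h ` carrier N) R M"
proof -
  interpret N: module R N by fact
  show ?thesis
  proof (rule submoduleI)
    show "h ` carrier N \<subseteq> carrier M" using mod_hom_closed[OF assms(2)] by blast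
    show "\<zero>\<^bsub>M\<^esub> \<in> h ` carrier N"
      using mod_hom_zero[OF assms(1) module_axioms assms(2)] by (metis N.zero_closed image_eqI)
  next
    fix a assume "a \<in> h ` carrier N"
    then obtain x where x: "x \<in> carrier N" "a = h x" by blast
    have "h (\<ominus>\<^bsub>R\<^esub> \<one>\<^bsub>R\<^esub> \<odot>\<^bsub>N\<^esub> x) = \<ominus>\<^bsub>M\<^esub> a"
      using x mod_hom_closed[OF assms(2)] by (simp add: mod_hom_smult[OF assms(2)] smult_l_minus)
    thus "\<ominus>\<^bsub>M\<^esub> a \<in> h ` carrier N" using x by (metis N.smult_closed R.a_inv_closed R.one_closed image_eqI)
  next
    fix a b assume "a \<in> h ` carrier N" "b \<in> h ` carrier N"
    then obtain x y where "x \<in> carrier N" "a = h x" "y \<in> carrier N" "b = h y" by blast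
    thus "a \<oplus>\<^bsub>M\<^esub> b \<in> h ` carrier N"
      using mod_hom_add[OF assms(2)] by (intro image_eqI[of _ h "x \<oplus>\<^bsub>N\<^esub> y"]) simp_all
  next
    fix r a assume "r \<in> carrier R" "a \<in> h ` carrier N"
    then obtain x where "r \<in> carrier R" "x \<in> carrier N" "a = h x" by blast
    thus "r \<odot>\<^bsub>M\<^esub> a \<in> h ` carrier N"
      using mod_hom_smult[OF assms(2)] by (intro image_eqI[of _ h "r \<odot>\<^bsub>N\<^esub> x"]) simp_all
  qed
qed

lemma (in twisted_matrices) D_columns:
  assumes "v \<in> carrier (free2 R)"
  shows "D i v = (v 1 \<odot>\<^bsub>free2 R\<^esub> D i (basis_vec R 1)) \<oplus>\<^bsub>free2 R\<^esub> (v 2 \<odot>\<^bsub>free2 R\<^esub> D i (basis_vec R 2))"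
  using assms unfolding mem_free2_iff
  by (auto simp: D_def mat2_def basis_vec_def free_mod_sel fun_eq_iff m_comm)

context
  fixes \<alpha> :: "'k::field" and q :: int
  assumes \<alpha>: "\<alpha> \<noteq> 0"
begin

interpretation A: model_image "A_ring \<alpha>" \<alpha> "emb \<alpha>" "{0}" by (rule A_model_image[OF \<alpha>])
interpretation B: model_image "B_ring \<alpha>" \<alpha> "embB \<alpha>" K5 by (rule B_model_image[OF \<alpha>])
interpretation FA: module "A_ring \<alpha>" "free2 (A_ring \<alpha>)" by (rule A.free_mod_module)
interpretation FB: module "B_ring \<alpha>" "free2 (B_ring \<alpha>)" by (rule B.free_mod_module)
interpretation I: ideal "x5_ideal \<alpha>" "A_ring \<alpha>" by (rule x5_ideal_ideal)

lemma M_map_eq: "M_map \<alpha> = A.D 0"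
  by (auto simp: M_map_def A.D_def mat2_def xA_eq fun_eq_iff)

lemma M_mod_eq: "M_mod \<alpha> = (free2 (A_ring \<alpha>))\<lparr>carrier := A.D 0 ` carrier (free2 (A_ring \<alpha>))\<rparr>"
  by (simp add: M_mod_def M_map_eq Let_def)

lemma M_module: "module (A_ring \<alpha>) (M_mod \<alpha>)"
  unfolding M_mod_eq
  by (rule submodule.submodule_is_module[OF FA.image_submodule[OF FA.module_axioms A.D_hom] FA.module_axioms])

text \<open>M is by construction the image of D_0, so D_0 itself is the augmentation.\<close>

lemma M_resolution:
  "free_resolution (A_ring \<alpha>) (M_mod \<alpha>) (\<lambda>_. {1, 2}) (A.D 0) (\<lambda>i. A.D (Suc i))"
  by (rule A.resolution) (use A.D_hom[of 0] in \<open>auto simp: M_mod_eq mod_hom_def\<close>)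

lemma T_quotient: "module_quotient (A_ring \<alpha>) (regular_mod (A_ring \<alpha>)) (J_ideal \<alpha> q)"
  by (rule A.regular_quotient[OF J_ideal_ideal])

interpretation T: module_quotient "A_ring \<alpha>" "regular_mod (A_ring \<alpha>)" "J_ideal \<alpha> q" by (rule T_quotient)

lemma T_module: "module (A_ring \<alpha>) (T_mod \<alpha> q)"
  unfolding T_mod_def by (rule T.quot_module)

abbreviation P :: "'k vec12 \<Rightarrow> 'k poly5 set set" where "P u \<equiv> T.proj (emb \<alpha> u)"

lemma P_simps:
  "carrier (T_mod \<alpha> q) = range P" "P u \<oplus>\<^bsub>T_mod \<alpha> q\<^esub> P v = P (u + v)"
  "emb \<alpha> u \<odot>\<^bsub>T_mod \<alpha> q\<^esub> P v = P (vmul \<alpha> u v)" 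
  unfolding T_mod_def T.quot_carrier
  by (auto simp: carrier_A_emb T.quot_add T.quot_smult emb_simps)

lemma P_eq_iff: "P u = P v \<longleftrightarrow> tcoord (inverse (\<alpha> powi q)) u = tcoord (inverse (\<alpha> powi q)) v"
proof -
  have "emb \<alpha> u \<ominus>\<^bsub>regular_mod (A_ring \<alpha>)\<^esub> emb \<alpha> v = emb \<alpha> (u - v)"
  proof -
    have "\<ominus>\<^bsub>regular_mod (A_ring \<alpha>)\<^esub> emb \<alpha> v = emb \<alpha> (- v)"
      by (rule T.M.minus_equality) (simp_all add: emb_simps emb_zero)
    thus ?thesis by (simp add: a_minus_def emb_simps)
  qed
  hence "P u = P v \<longleftrightarrow> emb \<alpha> (u - v) \<in> J_ideal \<alpha> q" by (simp add: T.proj_eq_iff)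
  also have "\<dots> \<longleftrightarrow> tcoord (inverse (\<alpha> powi q)) (u - v) = (0, 0)"
    using \<alpha> by (auto simp: J_ideal_eq)
  also have "\<dots> \<longleftrightarrow> tcoord (inverse (\<alpha> powi q)) u = tcoord (inverse (\<alpha> powi q)) v"
    by (simp add: tcoord_def algebra_simps)
  finally show ?thesis .
qed

lemma Ext_A_nonzero_iff:
  "carrier (Ext (A_ring \<alpha>) i (M_mod \<alpha>) (T_mod \<alpha> q)) \<noteq> {\<zero>\<^bsub>Ext (A_ring \<alpha>) i (M_mod \<alpha>) (T_mod \<alpha> q)\<^esub>}
    \<longleftrightarrow> i = 0 \<or> \<alpha> ^ i * inverse (\<alpha> powi q) = 1 \<or> \<alpha> ^ Suc i * inverse (\<alpha> powi q) = 1"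
proof -
  obtain \<tau> where "dual_number_module (A_ring \<alpha>) (T_mod \<alpha> q) (emb \<alpha> (gen V1)) (emb \<alpha> (gen V2)) (emb \<alpha> (gen V3))
      (emb \<alpha> (gen V4)) (emb \<alpha> (scalar \<alpha>)) \<tau> (\<lambda>i. \<alpha> ^ i * inverse (\<alpha> powi q))"
    using A.ex_dual_number_module[OF T_module P_simps P_eq_iff] by blast
  from dual_number_module.cohomology_nonzero_iff[OF this]
  show ?thesis unfolding Ext_nonzero_iff[OF M_module T_module M_resolution] .
qed

text \<open>Multiples of x5 have zero constant term and zero coordinates at x1, ..., x4, the only
  ones visible in T_q.\<close>

lemma x5_annihilates:
  assumes "r \<in> x5_ideal \<alpha>" "n \<in> carrier (T_mod \<alpha> q)"
  shows "r \<odot>\<^bsub>T_mod \<alpha> q\<^esub> n = \<zero>\<^bsub>T_mod \<alpha> q\<^esub>"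
proof -
  interpret TM: module "A_ring \<alpha>" "T_mod \<alpha> q" by (rule T_module)
  obtain u v where uv: "r = emb \<alpha> u" "u \<in> K5" "n = P v"
    using assms unfolding x5_ideal_eq P_simps(1) by blast
  \<comment> \<open>An element equal to its own double is zero.\<close>
  have "P 0 \<oplus>\<^bsub>T_mod \<alpha> q\<^esub> P 0 = P 0" by (simp add: P_simps)
  hence z: "P 0 = \<zero>\<^bsub>T_mod \<alpha> q\<^esub>" using TM.add.r_cancel_one[of "P 0" "P 0"] P_simps(1) by blast
  have "P (vmul \<alpha> u v) = P 0"
    using uv(2) unfolding P_eq_iff by (simp add: K5_def tcoord_def vmul_def)
  thus ?thesis by (simp add: uv P_simps z)
qed

section \<open>T_q and L over the ring B\<close>

lemma TB_module: "module (B_ring \<alpha>) (T_mod_B \<alpha> q)"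
  unfolding B_ring_def T_mod_B_def
  by (rule quot_scalars_module[OF A.is_cring x5_ideal_ideal T_module x5_annihilates])

lemma P_simps_B:
  "carrier (T_mod_B \<alpha> q) = range P" "P u \<oplus>\<^bsub>T_mod_B \<alpha> q\<^esub> P v = P (u + v)"
  "embB \<alpha> u \<odot>\<^bsub>T_mod_B \<alpha> q\<^esub> P v = P (vmul \<alpha> u v)"
proof -
  have "P v \<in> carrier (T_mod \<alpha> q)" unfolding P_simps by blast
  from quot_scalars_smult[OF A.is_cring x5_ideal_ideal T_module x5_annihilates emb_closed this]
  show "embB \<alpha> u \<odot>\<^bsub>T_mod_B \<alpha> q\<^esub> P v = P (vmul \<alpha> u v)" by (simp add: T_mod_B_def embB_def P_simps)
qed (use P_simps in \<open>simp_all add: T_mod_B_def quot_scalars_def\<close>)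

text \<open>Reduction commutes with the matrices because both rings read D_i through the same
  coordinate rows.\<close>

lemma red_D:
  assumes "v \<in> carrier (free2 (A_ring \<alpha>))"
  shows "(\<lambda>j. x5_ideal \<alpha> +>\<^bsub>A_ring \<alpha>\<^esub> A.D i v j) = B.D i (\<lambda>j. x5_ideal \<alpha> +>\<^bsub>A_ring \<alpha>\<^esub> v j)"
proof -
  obtain u1 u2 where u: "v 1 = emb \<alpha> u1" "v 2 = emb \<alpha> u2"
    using assms unfolding mem_free2_iff carrier_A_emb by blast
  have z: "x5_ideal \<alpha> +>\<^bsub>A_ring \<alpha>\<^esub> \<zero>\<^bsub>A_ring \<alpha>\<^esub> = \<zero>\<^bsub>B_ring \<alpha>\<^esub>"
    using B.\<kappa>_zero by (simp add: embB_def emb_zero)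
  have "(\<lambda>j. x5_ideal \<alpha> +>\<^bsub>A_ring \<alpha>\<^esub> A.D i v j) x = B.D i (\<lambda>j. x5_ideal \<alpha> +>\<^bsub>A_ring \<alpha>\<^esub> v j) x" for x
  proof -
    consider "x = 1" | "x = 2" | "x \<noteq> 1 \<and> x \<noteq> 2" by blast
    thus ?thesis
    proof cases
      case 1
      thus ?thesis using A.D_rows(1)[OF u, of i] B.D_rows(1)[of "\<lambda>j. x5_ideal \<alpha> +>\<^bsub>A_ring \<alpha>\<^esub> v j" u1 u2 i] u
        by (simp add: embB_def)
    next
      case 2
      thus ?thesis using A.D_rows(2)[OF u, of i] B.D_rows(2)[of "\<lambda>j. x5_ideal \<alpha> +>\<^bsub>A_ring \<alpha>\<^esub> v j" u1 u2 i] u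
        by (simp add: embB_def)
    next
      case 3
      thus ?thesis by (simp add: A.D_def B.D_def mat2_def z)
    qed
  qed
  thus ?thesis by blast
qed

abbreviation red :: "(nat \<Rightarrow> 'k poly5 set) \<Rightarrow> nat \<Rightarrow> 'k poly5 set set" where
  "red m \<equiv> (\<lambda>j. x5_ideal \<alpha> +>\<^bsub>A_ring \<alpha>\<^esub> m j)"

lemma red_hom:
  "v \<in> carrier (free2 (A_ring \<alpha>)) \<Longrightarrow> red v \<in> carrier (free2 (B_ring \<alpha>))"
  "v \<in> carrier (free2 (A_ring \<alpha>)) \<Longrightarrow> w \<in> carrier (free2 (A_ring \<alpha>)) \<Longrightarrow>
     red (v \<oplus>\<^bsub>free2 (A_ring \<alpha>)\<^esub> w) = red v \<oplus>\<^bsub>free2 (B_ring \<alpha>)\<^esub> red w"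
  "r \<in> carrier (A_ring \<alpha>) \<Longrightarrow> v \<in> carrier (free2 (A_ring \<alpha>)) \<Longrightarrow>
     red (r \<odot>\<^bsub>free2 (A_ring \<alpha>)\<^esub> v) = (x5_ideal \<alpha> +>\<^bsub>A_ring \<alpha>\<^esub> r) \<odot>\<^bsub>free2 (B_ring \<alpha>)\<^esub> red v"
proof -
  note hom = I.rcos_ring_hom[folded B_ring_def]
  have z: "x5_ideal \<alpha> +>\<^bsub>A_ring \<alpha>\<^esub> \<zero>\<^bsub>A_ring \<alpha>\<^esub> = \<zero>\<^bsub>B_ring \<alpha>\<^esub>"
    using B.\<kappa>_zero by (simp add: embB_def emb_zero)
  show "red v \<in> carrier (free2 (B_ring \<alpha>))" if "v \<in> carrier (free2 (A_ring \<alpha>))"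
    using that ring_hom_closed[OF hom] unfolding mem_free2_iff by (simp add: z)
  show "red (v \<oplus>\<^bsub>free2 (A_ring \<alpha>)\<^esub> w) = red v \<oplus>\<^bsub>free2 (B_ring \<alpha>)\<^esub> red w"
    if "v \<in> carrier (free2 (A_ring \<alpha>))" "w \<in> carrier (free2 (A_ring \<alpha>))"
    using A.free_mod_val[OF that(1)] A.free_mod_val[OF that(2)] by (simp add: free_mod_sel ring_hom_add[OF hom])
  show "red (r \<odot>\<^bsub>free2 (A_ring \<alpha>)\<^esub> v) = (x5_ideal \<alpha> +>\<^bsub>A_ring \<alpha>\<^esub> r) \<odot>\<^bsub>free2 (B_ring \<alpha>)\<^esub> red v"
    if "r \<in> carrier (A_ring \<alpha>)" "v \<in> carrier (free2 (A_ring \<alpha>))"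
    using A.free_mod_val[OF that(2)] that(1) by (simp add: free_mod_sel ring_hom_mult[OF hom])
qed

lemma L_base_change:
  "base_change (A_ring \<alpha>) (x5_ideal \<alpha>) (M_mod \<alpha>) (free2 (B_ring \<alpha>)) red
    (A.D 0 (basis_vec (A_ring \<alpha>) 1)) (A.D 0 (basis_vec (A_ring \<alpha>) 2))"
proof -
  let ?FA = "free2 (A_ring \<alpha>)" and ?FB = "free2 (B_ring \<alpha>)"
  let ?e = "basis_vec (A_ring \<alpha>)"
  have e: "?e 1 \<in> carrier ?FA" "?e 2 \<in> carrier ?FA" by (auto intro!: A.basis_vec_closed)
  have M: "carrier (M_mod \<alpha>) = A.D 0 ` carrier ?FA" "add (M_mod \<alpha>) = add ?FA"
    "module.smult (M_mod \<alpha>) = module.smult ?FA" "\<zero>\<^bsub>M_mod \<alpha>\<^esub> = \<zero>\<^bsub>?FA\<^esub>"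
    by (simp_all add: M_mod_eq)
  have MF: "m \<in> carrier ?FA" if "m \<in> carrier (M_mod \<alpha>)" for m
    using that mod_hom_closed[OF A.D_hom] by (auto simp: M)
  have e_red: "red (A.D 0 (?e 1)) = B.D 0 (basis_vec (B_ring \<alpha>) 1)" "red (A.D 0 (?e 2)) = B.D 0 (basis_vec (B_ring \<alpha>) 2)"
  proof -
    have "red (?e j) = basis_vec (B_ring \<alpha>) j" for j
      using B.\<kappa>_zero B.\<kappa>_simps(3) by (auto simp: basis_vec_def embB_def emb_zero emb_simps fun_eq_iff)
    thus "red (A.D 0 (?e 1)) = B.D 0 (basis_vec (B_ring \<alpha>) 1)" "red (A.D 0 (?e 2)) = B.D 0 (basis_vec (B_ring \<alpha>) 2)"
      using red_D e by simp_all
  qed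
  let ?v = "\<lambda>r1 r2 :: 'k poly5 set. \<lambda>j :: nat. if j = 1 then r1 else if j = 2 then r2 else \<zero>\<^bsub>A_ring \<alpha>\<^esub>"
  show ?thesis
  proof (intro base_change.intro base_change_axioms.intro)
    show "ideal (x5_ideal \<alpha>) (A_ring \<alpha>)" by (rule x5_ideal_ideal)
    show "module (A_ring \<alpha>) (M_mod \<alpha>)" by (rule M_module)
    show "module (A_ring \<alpha> Quot x5_ideal \<alpha>) (free2 (B_ring \<alpha>))"
      using FB.module_axioms unfolding B_ring_def .
    show "A.D 0 (?e 1) \<in> carrier (M_mod \<alpha>)" "A.D 0 (?e 2) \<in> carrier (M_mod \<alpha>)" using e by (auto simp: M)
  next
    fix m assume "m \<in> carrier (M_mod \<alpha>)"
    then obtain v where v: "v \<in> carrier ?FA" "m = A.D 0 v" by (auto simp: M)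
    show "\<exists>r1\<in>carrier (A_ring \<alpha>). \<exists>r2\<in>carrier (A_ring \<alpha>).
      m = r1 \<odot>\<^bsub>M_mod \<alpha>\<^esub> A.D 0 (?e 1) \<oplus>\<^bsub>M_mod \<alpha>\<^esub> r2 \<odot>\<^bsub>M_mod \<alpha>\<^esub> A.D 0 (?e 2)"
      unfolding M v(2) using A.D_columns[OF v(1)] A.free_mod_val[OF v(1)] by blast
  next
    fix r1 r2 assume r: "r1 \<in> carrier (A_ring \<alpha>)" "r2 \<in> carrier (A_ring \<alpha>)"
      and eq: "(x5_ideal \<alpha> +>\<^bsub>A_ring \<alpha>\<^esub> r1) \<odot>\<^bsub>?FB\<^esub> red (A.D 0 (?e 1)) \<oplus>\<^bsub>?FB\<^esub>
        (x5_ideal \<alpha> +>\<^bsub>A_ring \<alpha>\<^esub> r2) \<odot>\<^bsub>?FB\<^esub> red (A.D 0 (?e 2)) = \<zero>\<^bsub>?FB\<^esub>"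
    have v: "?v r1 r2 \<in> carrier ?FA" using r by (simp add: mem_free2_iff)
    have "B.D 0 (red (?v r1 r2)) = \<zero>\<^bsub>?FB\<^esub>"
      using eq B.D_columns[OF red_hom(1)[OF v], of 0] unfolding e_red by simp
    then obtain w where w: "w \<in> carrier ?FB" "red (?v r1 r2) = B.D (Suc 0) w"
      using B.exact red_hom(1)[OF v] by blast
    obtain u1 u2 where u: "w 1 = embB \<alpha> u1" "w 2 = embB \<alpha> u2"
      using w(1) unfolding mem_free2_iff B.\<kappa>_surj[symmetric] by blast
    \<comment> \<open>A lift of w to A: by D_0 D_1 = 0 its image under D_1 is a relation over A, and
      it reduces to the given relation over B.\<close>
    let ?w = "?v (emb \<alpha> u1) (emb \<alpha> u2)"
    have w': "?w \<in> carrier ?FA" by (simp add: mem_free2_iff)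
    have "red ?w = w" using red_hom(1)[OF w'] w(1) u by (intro free2_eqI) (simp_all add: embB_def)
    hence eqs: "red (A.D (Suc 0) ?w) = red (?v r1 r2)" using red_D[OF w'] w(2) by simp
    let ?s = "A.D (Suc 0) ?w"
    have s: "?s \<in> carrier ?FA" by (rule mod_hom_closed[OF A.D_hom w'])
    have "A.D 0 ?s = \<zero>\<^bsub>?FA\<^esub>" by (rule A.D_D[OF w'])
    hence "?s 1 \<odot>\<^bsub>M_mod \<alpha>\<^esub> A.D 0 (?e 1) \<oplus>\<^bsub>M_mod \<alpha>\<^esub> ?s 2 \<odot>\<^bsub>M_mod \<alpha>\<^esub> A.D 0 (?e 2) = \<zero>\<^bsub>M_mod \<alpha>\<^esub>"
      unfolding M using A.D_columns[OF s, of 0] by simp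
    moreover have "x5_ideal \<alpha> +>\<^bsub>A_ring \<alpha>\<^esub> ?s 1 = x5_ideal \<alpha> +>\<^bsub>A_ring \<alpha>\<^esub> r1"
      "x5_ideal \<alpha> +>\<^bsub>A_ring \<alpha>\<^esub> ?s 2 = x5_ideal \<alpha> +>\<^bsub>A_ring \<alpha>\<^esub> r2"
      using fun_cong[OF eqs, of 1] fun_cong[OF eqs, of 2] by simp_all
    ultimately show "\<exists>s1\<in>carrier (A_ring \<alpha>). \<exists>s2\<in>carrier (A_ring \<alpha>).
        x5_ideal \<alpha> +>\<^bsub>A_ring \<alpha>\<^esub> s1 = x5_ideal \<alpha> +>\<^bsub>A_ring \<alpha>\<^esub> r1 \<and>
        x5_ideal \<alpha> +>\<^bsub>A_ring \<alpha>\<^esub> s2 = x5_ideal \<alpha> +>\<^bsub>A_ring \<alpha>\<^esub> r2 \<and>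
        s1 \<odot>\<^bsub>M_mod \<alpha>\<^esub> A.D 0 (?e 1) \<oplus>\<^bsub>M_mod \<alpha>\<^esub> s2 \<odot>\<^bsub>M_mod \<alpha>\<^esub> A.D 0 (?e 2) = \<zero>\<^bsub>M_mod \<alpha>\<^esub>"
      using A.free_mod_val[OF s] by blast
  qed (use MF red_hom A.is_cring in \<open>auto simp: M(2,3)\<close>)
qed

interpretation L: base_change "A_ring \<alpha>" "x5_ideal \<alpha>" "M_mod \<alpha>" "free2 (B_ring \<alpha>)" red
    "A.D 0 (basis_vec (A_ring \<alpha>) 1)" "A.D 0 (basis_vec (A_ring \<alpha>) 2)"
  by (rule L_base_change)

lemma L_module: "module (B_ring \<alpha>) (L_mod \<alpha>)"
  using L.L_module unfolding B_ring_def L_mod_def .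

text \<open>The columns of D_0 over A reduce to those over B, so the kernel of the augmentation,
  computed inside B^2, is the kernel of D_0 over B.\<close>

lemma L_resolution: "free_resolution (B_ring \<alpha>) (L_mod \<alpha>) (\<lambda>_. {1, 2}) L.\<epsilon> (\<lambda>i. B.D (Suc i))"
proof (rule B.resolution)
  show "L.\<epsilon> \<in> mod_hom (B_ring \<alpha>) (free2 (B_ring \<alpha>)) (L_mod \<alpha>)"
    using L.\<epsilon>_hom unfolding B_ring_def L_mod_def .
  show "L.\<epsilon> ` carrier (free2 (B_ring \<alpha>)) = carrier (L_mod \<alpha>)"
    using L.\<epsilon>_surj unfolding B_ring_def L_mod_def .
  fix v assume v: "v \<in> carrier (free2 (B_ring \<alpha>))"
  have e: "basis_vec (A_ring \<alpha>) 1 \<in> carrier (free2 (A_ring \<alpha>))"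
    "basis_vec (A_ring \<alpha>) 2 \<in> carrier (free2 (A_ring \<alpha>))" by (auto intro!: A.basis_vec_closed)
  have "red (basis_vec (A_ring \<alpha>) j) = basis_vec (B_ring \<alpha>) j" for j
    using B.\<kappa>_zero B.\<kappa>_simps(3) by (auto simp: basis_vec_def embB_def emb_zero emb_simps fun_eq_iff)
  with L.\<epsilon>_zero_iff[folded B_ring_def L_mod_def, OF v]
  show "L.\<epsilon> v = \<zero>\<^bsub>L_mod \<alpha>\<^esub> \<longleftrightarrow> B.D 0 v = \<zero>\<^bsub>free2 (B_ring \<alpha>)\<^esub>"
    using B.D_columns[OF v, of 0] by (simp add: red_D e)
qed

lemma Ext_B_nonzero_iff:
  "carrier (Ext (B_ring \<alpha>) i (L_mod \<alpha>) (T_mod_B \<alpha> q)) \<noteq> {\<zero>\<^bsub>Ext (B_ring \<alpha>) i (L_mod \<alpha>) (T_mod_B \<alpha> q)\<^esub>}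
    \<longleftrightarrow> i = 0 \<or> \<alpha> ^ i * inverse (\<alpha> powi q) = 1 \<or> \<alpha> ^ Suc i * inverse (\<alpha> powi q) = 1"
proof -
  obtain \<tau> where "dual_number_module (B_ring \<alpha>) (T_mod_B \<alpha> q) (embB \<alpha> (gen V1)) (embB \<alpha> (gen V2)) (embB \<alpha> (gen V3))
      (embB \<alpha> (gen V4)) (embB \<alpha> (scalar \<alpha>)) \<tau> (\<lambda>i. \<alpha> ^ i * inverse (\<alpha> powi q))"
    using B.ex_dual_number_module[OF TB_module P_simps_B P_eq_iff] by blast
  from dual_number_module.cohomology_nonzero_iff[OF this]
  show ?thesis unfolding Ext_nonzero_iff[OF L_module TB_module L_resolution] .
qed

end

text \<open>If i > j, cancelling \<alpha>^j leaves \<alpha>^(i-j) = 1 with a positive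
  exponent.\<close>

lemma power_inj_of_infinite_order:
  fixes \<alpha> :: "'k::field"
  assumes "\<alpha> \<noteq> 0" "\<And>n::nat. n > 0 \<Longrightarrow> \<alpha> ^ n \<noteq> 1" "\<alpha> ^ i = \<alpha> ^ j"
  shows "i = j"
proof -
  have *: "i \<le> j" if "\<alpha> ^ i = \<alpha> ^ j" for i j
  proof (rule ccontr)
    assume "\<not> i \<le> j"
    hence "\<alpha> ^ i = \<alpha> ^ j * \<alpha> ^ (i - j)" by (simp add: power_add[symmetric])
    thus False using that assms(1) assms(2)[of "i - j"] \<open>\<not> i \<le> j\<close> by simp
  qed
  show ?thesis using *[OF assms(3)] *[OF assms(3)[symmetric]] by simp
qed

theorem corollary3p3:
  fixes \<alpha> :: "'k::field" and q :: int and i :: nat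
  assumes "\<alpha> \<noteq> 0"
    and "\<And>n::nat. n > 0 \<Longrightarrow> \<alpha> ^ n \<noteq> 1"
    and "q > 0"
  shows "(carrier (Ext (A_ring \<alpha>) i (M_mod \<alpha>) (T_mod \<alpha> q))
            \<noteq> {\<zero>\<^bsub>Ext (A_ring \<alpha>) i (M_mod \<alpha>) (T_mod \<alpha> q)\<^esub>}
          \<longleftrightarrow> int i \<in> {0, q - 1, q})
       \<and> (carrier (Ext (B_ring \<alpha>) i (L_mod \<alpha>) (T_mod_B \<alpha> q))
            \<noteq> {\<zero>\<^bsub>Ext (B_ring \<alpha>) i (L_mod \<alpha>) (T_mod_B \<alpha> q)\<^esub>}
          \<longleftrightarrow> int i \<in> {0, q - 1, q})"
proof -
  obtain n where q: "q = int n" using assms(3) by (metis nonneg_int_cases less_imp_le)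
  have eq: "\<alpha> ^ j * inverse (\<alpha> powi q) = 1 \<longleftrightarrow> j = n" for j
  proof -
    have "\<alpha> ^ j * inverse (\<alpha> powi q) = 1 \<longleftrightarrow> \<alpha> ^ j = \<alpha> ^ n"
      using assms(1) by (simp add: q divide_inverse[symmetric])
    also have "\<dots> \<longleftrightarrow> j = n" using power_inj_of_infinite_order[OF assms(1,2)] by blast
    finally show ?thesis .
  qed
  \<comment> \<open>The differential into degree i is D_i and the one out of it is D_(i+1); they
    become singular at i = q and at i = q - 1.\<close>
  have i: "(i = 0 \<or> \<alpha> ^ i * inverse (\<alpha> powi q) = 1 \<or> \<alpha> ^ Suc i * inverse (\<alpha> powi q) = 1)
      \<longleftrightarrow> int i \<in> {0, q - 1, q}"
    unfolding eq unfolding q by auto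
  show ?thesis unfolding Ext_A_nonzero_iff[OF assms(1)] Ext_B_nonzero_iff[OF assms(1)] i by simp
qed

end
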